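(* Fix $n\geq 1$. Let $M$ be a smooth hypersurface of the Heisenberg group $\mathbb{H}^n$ which is connected, orientable, compact, and without boundary. Suppose that $M$ is cylindrically symmetric and that there is a constant $c\neq 0$ such that, at every non-characteristic point $\xi=(x,y,t)\in M$, the horizontal mean curvature of $M$ (with respect to the outward normal) satisfies $H_M(\xi)=c\sqrt{|x|^2+|y|^2}$. Then $c>0$ and there exists $t_0\in\mathbb{R}$ such that $M=\partial B_R(\xi_0)$ with $R=\sqrt{\frac{1}{c}\,\frac{2n+1}{2n-1}}$ and $\xi_0=(0,0,t_0)$.
   Context: The Heisenberg group $\mathbb{H}^n$ is $\mathbb{R}^n\times\mathbb{R}^n\times\mathbb{R}$ with points $\xi=(x,y,t)$ and group law $(x,y,t)\circ(x',y',t')=(x+x',y+y',t+t'+2\sum_{k=1}^n(x_ky'_k-y_kx'_k))$. Let $X_j=\partial_{x_j}-2y_j\partial_t$, $Y_j=\partial_{y_j}+2x_j\partial_t$ ($j=1,\dots,n$), $T=\partial_t$; let $\mathcal{H}_\xi=\mathrm{span}\{X_1,\dots,X_n,Y_1,\dots,Y_n\}$ at $\xi$ be the horizontal distribution, let $\langle\cdot,\cdot\rangle$ be the Riemannian metric making $\{X_1,\dots,X_n,Y_1,\dots,Y_n,T\}$ orthonormal, with norm $|\cdot|$ and Levi-Civita connection $\nabla$, and let $\mathcal{P}_H$ be the orthogonal projection onto $\mathcal{H}$. The homogeneous gauge is $\rho(x,y,t)=((|x|^2+|y|^2)^2+t^2)^{1/4}$ and the gauge balls are $B_R(\xi_0)=\{\xi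 : \rho(\xi_0^{-1}\circ\xi)<R\}$. A smooth hypersurface $M\subset\mathbb{H}^n$ is an (embedded) codimension-one submanifold of class $C^2$ that is $C^\infty$ away from its characteristic set. Let $\nu$ be the outward unit normal ($M$ compact without boundary). A point $\xi\in M$ is characteristic if $T_\xi M=\mathcal{H}_\xi$, equivalently $\mathcal{P}_H(\nu)=0$ at $\xi$. At non-characteristic points the horizontal normal is $\nu^H=\mathcal{P}_H(\nu)/|\mathcal{P}_H(\nu)|$, and the horizontal mean curvature is $H_M(\xi)=\frac{1}{2n-1}\sum_{i=1}^{2n-1}\langle\nabla_{e_i}\nu^H,e_i\rangle$ for any orthonormal basis $\{e_i\}$ of $\mathcal{H}_\xi\cap T_\xi M$ (equivalently $\mathrm{div}(\nu^H)/(2n-1)$). A smooth hypersurface $M\subset\mathbb{H}^n$ is cylindrically symmetric if, locally around any point of $M$, there exists a defining function $f$ for $M$ (i.e. $M$ is locally the zero set of $f$, with non-vanishing gradient) which can be written as $f(x,y,t)=v(|x|^2+|y|^2,t)$ for some smooth function $v$. *)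

theory Defs
  imports "HOL-Analysis.Analysis"
begin

section \<open>Differentiability classes\<close>

primrec Ck_on :: "nat \<Rightarrow> 'a::real_normed_vector set \<Rightarrow> ('a \<Rightarrow> 'b::real_normed_vector) \<Rightarrow> bool" where
  "Ck_on 0 U f \<longleftrightarrow> continuous_on U f"
| "Ck_on (Suc k) U f \<longleftrightarrow> (\<forall>p\<in>U. f differentiable (at p)) \<and>
     (\<forall>v. Ck_on k U (\<lambda>p. frechet_derivative f (at p) v))"

definition smooth_on :: "'a::real_normed_vector set \<Rightarrow> ('a \<Rightarrow> 'b::real_normed_vector) \<Rightarrow> bool" where
  "smooth_on U f \<longleftrightarrow> (\<forall>k. Ck_on k U f)"


section \<open>The Heisenberg group\<close>

text \<open>The dimension \<open>n\<close> is \<open>CARD('n)\<close>, which is at least 1. Since the underlying manifold is a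
  vector space, tangent vectors at every point are elements of the same type, in the coordinate
  frame \<open>\<partial>\<^sub>x, \<partial>\<^sub>y, \<partial>\<^sub>t\<close>.\<close>

type_synonym 'n heis = "(real, 'n) vec \<times> (real, 'n) vec \<times> real"

fun heis_mult :: "'n::finite heis \<Rightarrow> 'n heis \<Rightarrow> 'n heis" where
  "heis_mult (x, y, t) (x', y', t') =
     (x + x', y + y', t + t' + 2 * (\<Sum>k\<in>UNIV. x $ k * y' $ k - y $ k * x' $ k))"

fun heis_inv :: "'n::finite heis \<Rightarrow> 'n heis" where
  "heis_inv (x, y, t) = (- x, - y, - t)"

lemma heis_mult_assoc: "heis_mult (heis_mult p q) r = heis_mult p (heis_mult q r)"
  by (cases p; cases q; cases r) (simp add: algebra_simps sum.distrib sum_subtractf)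

lemma heis_mult_zero: "heis_mult 0 p = p" "heis_mult p 0 = p"
  by (cases p; simp add: zero_prod_def)+

lemma heis_inv_left: "heis_mult (heis_inv p) p = 0"
  by (cases p) (simp add: zero_prod_def algebra_simps)

fun gauge :: "'n::finite heis \<Rightarrow> real" where
  "gauge (x, y, t) = root 4 (((norm x)\<^sup>2 + (norm y)\<^sup>2)\<^sup>2 + t\<^sup>2)"

definition gauge_ball :: "'n::finite heis \<Rightarrow> real \<Rightarrow> 'n heis set" where
  "gauge_ball p0 R = {p. gauge (heis_mult (heis_inv p0) p) < R}"

fun X_field :: "'n::finite \<Rightarrow> 'n heis \<Rightarrow> 'n heis" where
  "X_field j (x, y, t) = (axis j 1, 0, - 2 * y $ j)"

fun Y_field :: "'n::finite \<Rightarrow> 'n heis \<Rightarrow> 'n heis" where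
  "Y_field j (x, y, t) = (0, axis j 1, 2 * x $ j)"

definition T_field :: "'n::finite heis \<Rightarrow> 'n heis" where
  "T_field p = (0, 0, 1)"

definition horizontal :: "'n::finite heis \<Rightarrow> 'n heis set" where
  "horizontal p = span (range (\<lambda>j. X_field j p) \<union> range (\<lambda>j. Y_field j p))"


section \<open>The Riemannian metric and its Levi-Civita connection\<close>

text \<open>In the frame \<open>X, Y, T\<close> at \<open>(x, y, t)\<close> the coordinate vector \<open>(a, b, s)\<close> has components
  \<open>a\<close>, \<open>b\<close> and \<open>T_coeff (x, y, t) (a, b, s)\<close>; see the lemma \<open>frame_expansion\<close>.\<close>

fun T_coeff :: "'n::finite heis \<Rightarrow> 'n heis \<Rightarrow> real" where
  "T_coeff (x, y, t) (a, b, s) = s + 2 * (y \<bullet> a - x \<bullet> b)"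

definition heis_metric :: "'n::finite heis \<Rightarrow> 'n heis \<Rightarrow> 'n heis \<Rightarrow> real" where
  "heis_metric p u v = fst u \<bullet> fst v + fst (snd u) \<bullet> fst (snd v) + T_coeff p u * T_coeff p v"

definition heis_norm :: "'n::finite heis \<Rightarrow> 'n heis \<Rightarrow> real" where
  "heis_norm p u = sqrt (heis_metric p u u)"

definition proj_H :: "'n::finite heis \<Rightarrow> 'n heis \<Rightarrow> 'n heis" where
  "proj_H p u = (\<Sum>j\<in>UNIV. heis_metric p u (X_field j p) *\<^sub>R X_field j p)
              + (\<Sum>j\<in>UNIV. heis_metric p u (Y_field j p) *\<^sub>R Y_field j p)"

text \<open>The Koszul formula for the constant (hence commuting) coordinate fields \<open>u\<close>, \<open>v\<close>, \<open>w\<close>: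
  \<open>christoffel p u v\<close> is the covariant derivative of the field \<open>v\<close> in direction \<open>u\<close> at \<open>p\<close>.\<close>

definition koszul :: "'n::finite heis \<Rightarrow> 'n heis \<Rightarrow> 'n heis \<Rightarrow> 'n heis \<Rightarrow> real" where
  "koszul p u v w =
     (frechet_derivative (\<lambda>q. heis_metric q v w) (at p) u
    + frechet_derivative (\<lambda>q. heis_metric q u w) (at p) v
    - frechet_derivative (\<lambda>q. heis_metric q u v) (at p) w) / 2"

definition christoffel :: "'n::finite heis \<Rightarrow> 'n heis \<Rightarrow> 'n heis \<Rightarrow> 'n heis" where
  "christoffel p u v = (THE z. \<forall>w. heis_metric p z w = koszul p u v w)"

text \<open>Derivative at \<open>p\<close>, in a direction \<open>u\<close> tangent to \<open>M\<close>, of a map that matters only on \<open>M\<close>.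
  For tangent \<open>u\<close> the value \<open>D u\<close> does not depend on the choice of the derivative \<open>D\<close> within \<open>M\<close>,
  and it equals the derivative along \<open>u\<close> of any differentiable extension.\<close>

definition deriv_along :: "'a::real_normed_vector set \<Rightarrow> ('a \<Rightarrow> 'b::real_normed_vector) \<Rightarrow> 'a \<Rightarrow> 'a \<Rightarrow> 'b" where
  "deriv_along M V p u = (THE d. \<exists>D. (V has_derivative D) (at p within M) \<and> D u = d)"

definition nabla_along :: "'n::finite heis set \<Rightarrow> ('n heis \<Rightarrow> 'n heis) \<Rightarrow> 'n heis \<Rightarrow> 'n heis \<Rightarrow> 'n heis" where
  "nabla_along M V p u = deriv_along M V p u + christoffel p u (V p)"


section \<open>Hypersurfaces\<close>

definition local_defining_function ::
    "'a::real_normed_vector set \<Rightarrow> 'a \<Rightarrow> 'a set \<Rightarrow> ('a \<Rightarrow> real) \<Rightarrow> bool" where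
  "local_defining_function M p U f \<longleftrightarrow> open U \<and> p \<in> U \<and> M \<inter> U = {q\<in>U. f q = 0} \<and>
     (\<forall>q\<in>U. f differentiable (at q) \<and> frechet_derivative f (at q) \<noteq> (\<lambda>_. 0))"

text \<open>Velocities of curves in \<open>M\<close>.\<close>

definition tangent_space :: "'a::real_normed_vector set \<Rightarrow> 'a \<Rightarrow> 'a set" where
  "tangent_space M p = {u. \<exists>\<gamma> \<epsilon>. \<epsilon> > 0 \<and> \<gamma> 0 = p \<and> (\<forall>s. \<bar>s\<bar> < \<epsilon> \<longrightarrow> \<gamma> s \<in> M) \<and>
     (\<gamma> has_vector_derivative u) (at (0::real))}"

definition characteristic_set :: "'n::finite heis set \<Rightarrow> 'n heis set" where
  "characteristic_set M = {p\<in>M. tangent_space M p = horizontal p}"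

text \<open>An embedded hypersurface of class \<open>C\<^sup>2\<close>, and \<open>C\<^sup>\<infinity>\<close> away from its characteristic set. As \<open>M\<close> is a
  regular level set around each of its points, it has no boundary.\<close>

definition smooth_hypersurface :: "'n::finite heis set \<Rightarrow> bool" where
  "smooth_hypersurface M \<longleftrightarrow>
     (\<forall>p\<in>M. \<exists>U f. local_defining_function M p U f \<and> Ck_on 2 U f) \<and>
     (\<forall>p\<in>M - characteristic_set M. \<exists>U f. local_defining_function M p U f \<and> smooth_on U f)"

definition unit_normal_field :: "'n::finite heis set \<Rightarrow> ('n heis \<Rightarrow> 'n heis) \<Rightarrow> bool" where
  "unit_normal_field M \<nu> \<longleftrightarrow>
     (\<forall>p\<in>M. heis_norm p (\<nu> p) = 1 \<and> (\<forall>u\<in>tangent_space M p. heis_metric p (\<nu> p) u = 0))"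

text \<open>The ambient space being orientable, an orientation of \<open>M\<close> is a continuous unit normal field.\<close>

definition orientable :: "'n::finite heis set \<Rightarrow> bool" where
  "orientable M \<longleftrightarrow> (\<exists>N. unit_normal_field M N \<and> continuous_on M N)"

text \<open>For a compact connected hypersurface, \<open>inside M\<close> is the region bounded by \<open>M\<close> and
  \<open>outside M\<close> is the unbounded component of the complement.\<close>

definition outward_unit_normal :: "'n::finite heis set \<Rightarrow> ('n heis \<Rightarrow> 'n heis) \<Rightarrow> bool" where
  "outward_unit_normal M \<nu> \<longleftrightarrow> unit_normal_field M \<nu> \<and>
     (\<forall>p\<in>M. \<exists>\<epsilon>>0. \<forall>s. 0 < s \<and> s < \<epsilon> \<longrightarrow> p + s *\<^sub>R \<nu> p \<in> outside M \<and> p - s *\<^sub>R \<nu> p \<in> inside M)"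

definition cylindrically_symmetric :: "'n::finite heis set \<Rightarrow> bool" where
  "cylindrically_symmetric M \<longleftrightarrow>
     (\<forall>p\<in>M. \<exists>U f W v. local_defining_function M p U f \<and> open W \<and> smooth_on W v \<and>
        (\<forall>x y t. (x, y, t) \<in> U \<longrightarrow>
           ((norm x)\<^sup>2 + (norm y)\<^sup>2, t) \<in> W \<and> f (x, y, t) = v ((norm x)\<^sup>2 + (norm y)\<^sup>2, t)))"


section \<open>Horizontal mean curvature\<close>

definition horizontal_normal :: "('n::finite heis \<Rightarrow> 'n heis) \<Rightarrow> 'n heis \<Rightarrow> 'n heis" where
  "horizontal_normal \<nu> p = proj_H p (\<nu> p) /\<^sub>R heis_norm p (proj_H p (\<nu> p))"

definition orthonormal_basis :: "'n::finite heis \<Rightarrow> 'n heis set \<Rightarrow> 'n heis set \<Rightarrow> bool" where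
  "orthonormal_basis p S B \<longleftrightarrow> finite B \<and> span B = S \<and>
     (\<forall>u\<in>B. \<forall>v\<in>B. heis_metric p u v = (if u = v then 1 else 0))"

text \<open>At a non-characteristic point the basis has \<open>2n - 1\<close> elements, and the sum, being a trace,
  does not depend on its choice.\<close>

definition horizontal_mean_curvature ::
    "'n::finite heis set \<Rightarrow> ('n heis \<Rightarrow> 'n heis) \<Rightarrow> 'n heis \<Rightarrow> real" where
  "horizontal_mean_curvature M \<nu> p =
     (\<Sum>e\<in>(SOME B. orthonormal_basis p (horizontal p \<inter> tangent_space M p) B).
        heis_metric p (nabla_along M (horizontal_normal \<nu>) p e) e) / (2 * real CARD('n) - 1)"


section \<open>Consistency of the definitions\<close>

lemma frame_expansion:
  fixes p :: "'n::finite heis"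
  shows "(a, b, s) = (\<Sum>j\<in>UNIV. (a $ j) *\<^sub>R X_field j p) + (\<Sum>j\<in>UNIV. (b $ j) *\<^sub>R Y_field j p)
                   + T_coeff p (a, b, s) *\<^sub>R T_field p"
proof -
  obtain x y t where p: "p = (x, y, t)" by (cases p)
  have 1: "(\<Sum>j\<in>UNIV. (c $ j) *\<^sub>R axis j 1) = c" for c :: "(real, 'n) vec"
    using basis_expansion[of c] by (simp add: scalar_mult_eq_scaleR)
  show ?thesis
    unfolding p T_field_def
    by (intro prod_eqI)
      (simp_all add: 1 fst_sum snd_sum inner_vec_def sum_distrib_left sum_negf algebra_simps sum.distrib)
qed

lemma frame_orthonormal:
  "heis_metric p (X_field i p) (X_field j p) = (if i = j then 1 else 0)"
  "heis_metric p (Y_field i p) (Y_field j p) = (if i = j then 1 else 0)"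
  "heis_metric p (X_field i p) (Y_field j p) = 0"
  "heis_metric p (X_field i p) (T_field p) = 0"
  "heis_metric p (Y_field i p) (T_field p) = 0"
  "heis_metric p (T_field p) (T_field p) = 1"
proof -
  obtain x y t where p: "p = (x, y, t)" by (cases p)
  show "heis_metric p (X_field i p) (X_field j p) = (if i = j then 1 else 0)"
    "heis_metric p (Y_field i p) (Y_field j p) = (if i = j then 1 else 0)"
    "heis_metric p (X_field i p) (Y_field j p) = 0"
    "heis_metric p (X_field i p) (T_field p) = 0"
    "heis_metric p (Y_field i p) (T_field p) = 0"
    "heis_metric p (T_field p) (T_field p) = 1"
    unfolding p
    by (simp_all add: heis_metric_def T_field_def inner_axis_axis inner_axis) (simp_all add: axis_def)
qed

lemma metric_sym: "heis_metric p u v = heis_metric p v u"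
  by (simp add: heis_metric_def inner_commute mult.commute)

lemma linear_T_coeff: "linear (T_coeff p)"
  by (cases p) (auto intro!: linearI simp: algebra_simps inner_simps)

lemma linear_metric: "linear (heis_metric p u)"
  unfolding heis_metric_def
  by (intro linearI)
    (simp_all add: inner_simps algebra_simps linear_add[OF linear_T_coeff] linear_cmul[OF linear_T_coeff])

lemma metric_add_left: "heis_metric p (u + v) w = heis_metric p u w + heis_metric p v w"
  and metric_scale_left: "heis_metric p (c *\<^sub>R u) w = c * heis_metric p u w"
  by (simp_all add: metric_sym[of p _ w] linear_add[OF linear_metric] linear_cmul[OF linear_metric])

lemma metric_pos: "u \<noteq> 0 \<Longrightarrow> heis_metric p u u > 0"
proof -
  assume u: "u \<noteq> 0"
  obtain x y t a b s where p: "p = (x, y, t)" "u = (a, b, s)" by (cases p; cases u)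
  show ?thesis
  proof (cases "a = 0 \<and> b = 0")
    case True
    with u p show ?thesis
      by (auto simp: heis_metric_def zero_prod_def zero_less_mult_iff linorder_neq_iff)
  next
    case False
    then have "a \<bullet> a + b \<bullet> b > 0"
      by (auto simp: add_pos_nonneg add_nonneg_pos)
    then show ?thesis by (simp add: p heis_metric_def add_pos_nonneg)
  qed
qed

lemma metric_riesz:
  fixes p :: "'n::finite heis"
  assumes "linear F"
  shows "\<exists>!z. \<forall>w. heis_metric p z w = F w"
proof -
  define z where "z = (\<Sum>j\<in>UNIV. F (X_field j p) *\<^sub>R X_field j p)
    + (\<Sum>j\<in>UNIV. F (Y_field j p) *\<^sub>R Y_field j p) + F (T_field p) *\<^sub>R T_field p"
  have sum_left: "heis_metric p (\<Sum>j\<in>UNIV. f j) w = (\<Sum>j\<in>UNIV. heis_metric p (f j) w)"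
    for f :: "'n \<Rightarrow> 'n heis" and w
    by (simp add: metric_sym[of p _ w] linear_sum[OF linear_metric])
  have frame: "heis_metric p z (X_field i p) = F (X_field i p)"
    "heis_metric p z (Y_field i p) = F (Y_field i p)" "heis_metric p z (T_field p) = F (T_field p)" for i
    unfolding z_def
    by (simp_all add: metric_add_left metric_scale_left sum_left frame_orthonormal
        metric_sym[of p "T_field p"] metric_sym[of p "Y_field _ p" "X_field _ p"] if_distrib[of "(*) _"] cong: if_cong)
  have "heis_metric p z w = F w" for w
  proof -
    obtain a b s where w: "w = (a, b, s)" by (cases w)
    show ?thesis
      unfolding w
      by (subst (1 2) frame_expansion[of a b s p])
        (simp add: linear_add[OF assms] linear_add[OF linear_metric] linear_sum[OF assms]
          linear_sum[OF linear_metric] linear_cmul[OF assms] linear_cmul[OF linear_metric] frame)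
  qed
  moreover have "z' = z" if "\<forall>w. heis_metric p z' w = F w" for z'
  proof (rule ccontr)
    assume "z' \<noteq> z"
    then have "heis_metric p (z' + (-1) *\<^sub>R z) (z' + (-1) *\<^sub>R z) > 0" by (intro metric_pos) simp
    then show False
      unfolding metric_add_left metric_scale_left using that calculation by simp
  qed
  ultimately show ?thesis by blast
qed

lemma proj_H_orthogonal:
  "proj_H p u \<in> horizontal p"
  "h \<in> horizontal p \<Longrightarrow> heis_metric p (u - proj_H p u) h = 0"
proof -
  show "proj_H p u \<in> horizontal p"
    unfolding proj_H_def horizontal_def
    by (rule span_add[OF span_sum span_sum]; rule span_scale; rule span_base; simp)
  have sum_left: "heis_metric p (\<Sum>j\<in>UNIV. f j) w = (\<Sum>j\<in>UNIV. heis_metric p (f j) w)"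
    for f :: "'a \<Rightarrow> 'a heis" and w
    by (simp add: metric_sym[of p _ w] linear_sum[OF linear_metric])
  have X: "heis_metric p (proj_H p u) (X_field i p) = heis_metric p u (X_field i p)" for i
    unfolding proj_H_def
    by (simp add: metric_add_left metric_scale_left sum_left frame_orthonormal
        metric_sym[of p "Y_field _ p" "X_field _ p"] if_distrib[of "(*) _"] cong: if_cong)
  have Y: "heis_metric p (proj_H p u) (Y_field i p) = heis_metric p u (Y_field i p)" for i
    unfolding proj_H_def
    by (simp add: metric_add_left metric_scale_left sum_left frame_orthonormal
        if_distrib[of "(*) _"] cong: if_cong)
  assume "h \<in> horizontal p"
  then have "heis_metric p (proj_H p u) h = heis_metric p u h"
    unfolding horizontal_def
    by (rule linear_eq_on_span[OF linear_metric linear_metric, rotated]) (auto simp: X Y)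
  then show "heis_metric p (u - proj_H p u) h = 0"
    using metric_add_left[of p u "(-1) *\<^sub>R proj_H p u" h] by (simp only: metric_scale_left) simp
qed

lemma has_derivative_metric:
  "((\<lambda>q. heis_metric q u v) has_derivative
     (\<lambda>h. 2 * (fst (snd h) \<bullet> fst u - fst h \<bullet> fst (snd u)) * T_coeff p v
        + T_coeff p u * (2 * (fst (snd h) \<bullet> fst v - fst h \<bullet> fst (snd v))))) (at p)"
proof -
  have T: "T_coeff q w = snd (snd w) + 2 * (fst (snd q) \<bullet> fst w - fst q \<bullet> fst (snd w))"
    for q w :: "'a heis"
    by (cases q; cases w) simp
  show ?thesis
    unfolding heis_metric_def T
    by (auto intro!: derivative_eq_intros simp: algebra_simps)
qed

text \<open>The connection is torsion-free and compatible with the metric.\<close>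

lemma christoffel_metric: "heis_metric p (christoffel p u v) w = koszul p u v w"
proof -
  note fd = frechet_derivative_at[OF has_derivative_metric, symmetric]
  have "linear (koszul p u v)"
    unfolding koszul_def fd
    by (intro linearI)
      (simp_all add: linear_add[OF linear_T_coeff] linear_cmul[OF linear_T_coeff] inner_simps field_simps)
  from theI'[OF metric_riesz[OF this, of p]] show ?thesis
    unfolding christoffel_def by blast
qed

lemma christoffel_sym: "christoffel p u v = christoffel p v u"
  by (simp add: christoffel_def koszul_def metric_sym[of _ v u] algebra_simps)

lemma christoffel_compatible:
  "frechet_derivative (\<lambda>q. heis_metric q v w) (at p) u
     = heis_metric p (christoffel p u v) w + heis_metric p v (christoffel p u w)"
  by (simp add: christoffel_metric metric_sym[of _ v "christoffel _ _ _"] koszul_def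
      metric_sym[of _ w v] field_simps)

end

theory Submission
  imports Defs
begin

text \<open>Write \<open>s = |x|\<^sup>2 + |y|\<^sup>2\<close>. By symmetry \<open>M\<close> is locally \<open>{v(s, t) = 0}\<close>. Let \<open>(a, b)\<close> be the outward
  unit normal of this profile curve in the \<open>(s, t)\<close> plane, \<open>\<kappa>\<close> its curvature, and \<open>m = n - 1/2\<close>. The
  horizontal normal is \<open>(a z + b J z) / |z|\<close>, and the curvature condition becomes
  \<open>s \<kappa> = m (c s - a)\<close>. Along the curve, with tangent \<open>(-b, a)\<close>, one has \<open>a' = -\<kappa> b\<close> and \<open>b' = \<kappa> a\<close>.

  If \<open>M\<close> missed the axis \<open>s = 0\<close>, then \<open>c t - b / m\<close> (whose derivative is \<open>a\<^sup>2 / s\<close>), corrected by a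
  small multiple of \<open>a b\<close>, would be strictly increasing along the profile curve and could not have a
  maximum on the compact \<open>M\<close>. So \<open>M\<close> meets the axis, where the first integral
  \<open>s\<^sup>m (a - k s)\<close> with \<open>k = m c / (m + 1)\<close> vanishes. Hence \<open>a = k s\<close> and \<open>\<kappa> = k\<close>, so \<open>t - b / k\<close> is a
  constant \<open>t\<^sub>0\<close>, and \<open>a\<^sup>2 + b\<^sup>2 = 1\<close> puts \<open>M\<close> on the gauge sphere \<open>s\<^sup>2 + (t - t\<^sub>0)\<^sup>2 = 1 / k\<^sup>2\<close>. At the
  maximum of \<open>s\<close> the outward normal is \<open>(1, 0)\<close>, which gives \<open>k > 0\<close>; and \<open>M\<close> is the whole sphere
  because a proper subset of it bounds nothing.\<close>

section \<open>Level sets and implicit curves\<close>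

text \<open>Where \<open>a = 0\<close> the derivative \<open>a\<^sup>2 / s\<close> of
  \<open>c t - b / m\<close> degenerates. There \<open>\<kappa> = m c\<close> and
  \<open>b\<^sup>2 = 1\<close>, so \<open>a b\<close> has derivative
  \<open>\<kappa> (a\<^sup>2 - b\<^sup>2) = - m c\<close>; subtracting \<open>e c a b\<close> with
  \<open>e > 0\<close> adds \<open>e m c\<^sup>2 > 0\<close> exactly where it is missing.
  Compactness, through the extreme values of \<open>s\<close>, makes one \<open>e\<close> work on
  all of \<open>M\<close>. The constant \<open>k\<close> comes from differentiating
  \<open>s\<^sup>m (a - k s)\<close> along the profile: with \<open>s' = -b\<close> the result is
  \<open>-b s\<^sup>m (m c - (m + 1) k)\<close>, which forces \<open>(m + 1) k = m c\<close>. Two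
  obstacles shape the proof. Profiles are local, so quantities are followed along \<open>M\<close>
  as functions of the normal itself, off the axis, and spread by the connectedness of
  \<open>M\<close> and the density of its points off the axis. Moreover, tangent vectors are
  velocities at a single instant, so curves in \<open>M\<close> are built by choosing roots and need
  no regularity elsewhere.\<close>

lemma tangent_correction:
  fixes f :: "'a::real_normed_vector \<Rightarrow> real"
  assumes U: "open U" "p \<in> U" "continuous_on U f" and f: "(f has_derivative f') (at p)"
    and z: "f p = 0" "f' u = 0" "f' w \<noteq> 0"
  shows "\<exists>h. h 0 = 0 \<and> (h has_real_derivative 0) (at 0) \<and>
     (\<exists>d>0. \<forall>s. \<bar>s\<bar> < d \<longrightarrow> p + s *\<^sub>R u + h s *\<^sub>R w \<in> U \<and> f (p + s *\<^sub>R u + h s *\<^sub>R w) = 0)"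
proof -
  interpret f': bounded_linear f' using f by (rule has_derivative_bounded_linear)
  define K where "K = norm u + norm w + 1"
  have K: "K > 0" by (simp add: K_def add_nonneg_pos)
  obtain r where r: "r > 0" "ball p r \<subseteq> U" using U openE by blast
  define Z where "Z s = {h. p + s *\<^sub>R u + h *\<^sub>R w \<in> U \<and> f (p + s *\<^sub>R u + h *\<^sub>R w) = 0}" for s
  \<comment> \<open>The intermediate value theorem on
    \<open>\<bar>h\<bar> \<le> \<eta> * \<bar>s\<bar>\<close> supplies roots. Differentiability of
    \<open>f\<close> is given at \<open>p\<close> only, so the roots for a given \<open>s\<close>
    may be many, and one must be selected later.\<close>
  have key: "\<exists>d>0. \<forall>s. \<bar>s\<bar> < d \<longrightarrow> (\<exists>h\<in>Z s. \<bar>h\<bar> \<le> \<eta> * \<bar>s\<bar>)" if \<eta>: "0 < \<eta>" "\<eta> \<le> 1" for \<eta>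
  proof -
    \<comment> \<open>With this \<open>e\<close> the remainder is at most
      \<open>\<eta> * \<bar>s\<bar> * \<bar>f' w\<bar> / 2\<close>, so at both ends of the interval
      the sign of \<open>f\<close> is that of the linear term \<open>h * f' w\<close>.\<close>
    define e where "e = \<eta> * \<bar>f' w\<bar> / (2 * K)"
    have "e > 0" using \<eta> K z by (simp add: e_def)
    then obtain d where d: "d > 0" "\<And>y. norm (y - p) < d \<Longrightarrow> norm (f y - f p - f' (y - p)) \<le> e * norm (y - p)"
      using f unfolding has_derivative_at_alt by blast
    define d' where "d' = min d r / K"
    have "d' > 0" using d r K by (simp add: d'_def)
    moreover have "\<exists>h\<in>Z s. \<bar>h\<bar> \<le> \<eta> * \<bar>s\<bar>" if s: "\<bar>s\<bar> < d'" for s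
    proof (cases "s = 0")
      case True
      then show ?thesis using U z by (intro bexI[of _ 0]) (auto simp: Z_def)
    next
      case False
      define y where "y h = p + s *\<^sub>R u + h *\<^sub>R w" for h
      have ny: "norm (y h - p) \<le> \<bar>s\<bar> * K" "norm (y h - p) < min d r" if h: "\<bar>h\<bar> \<le> \<eta> * \<bar>s\<bar>" for h
      proof -
        have h1: "\<bar>h\<bar> \<le> \<bar>s\<bar>" using h \<eta> by (smt (verit) mult_left_le_one_le)
        have "norm (y h - p) \<le> \<bar>s\<bar> * norm u + \<bar>h\<bar> * norm w"
          using norm_triangle_ineq[of "s *\<^sub>R u" "h *\<^sub>R w"] by (simp add: y_def)
        also have "\<dots> \<le> \<bar>s\<bar> * norm u + \<bar>s\<bar> * norm w" using h1 by (simp add: mult_right_mono)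
        also have "\<dots> \<le> \<bar>s\<bar> * K" by (simp add: K_def algebra_simps)
        finally show A: "norm (y h - p) \<le> \<bar>s\<bar> * K" .
        have "\<bar>s\<bar> * K < min d r" using s K by (simp add: d'_def field_simps)
        with A show "norm (y h - p) < min d r" by simp
      qed
      have fy: "f' (y h - p) = h * f' w" for h
        by (simp add: y_def f'.add f'.scaleR z)
      have est: "\<bar>f (y h) - h * f' w\<bar> \<le> e * (\<bar>s\<bar> * K)" if h: "\<bar>h\<bar> \<le> \<eta> * \<bar>s\<bar>" for h
      proof -
        have "\<bar>f (y h) - h * f' w\<bar> \<le> e * norm (y h - p)"
          using d(2)[of "y h"] ny(2)[OF h] by (simp add: z fy)
        also have "\<dots> \<le> e * (\<bar>s\<bar> * K)" using ny(1)[OF h] \<open>e > 0\<close> by (intro mult_left_mono) auto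
        finally show ?thesis .
      qed
      have lt: "e * (\<bar>s\<bar> * K) < \<eta> * \<bar>s\<bar> * \<bar>f' w\<bar>"
        using K False \<eta> z by (simp add: e_def field_simps)
      have yU: "y h \<in> U" if "\<bar>h\<bar> \<le> \<eta> * \<bar>s\<bar>" for h
        using ny(2)[OF that] r by (auto simp: dist_norm norm_minus_commute subset_iff)
      let ?I = "{- (\<eta> * \<bar>s\<bar>) .. \<eta> * \<bar>s\<bar>}"
      have cont: "continuous_on ?I (\<lambda>h. f (y h))"
      proof (rule continuous_on_compose2[OF U(3)])
        show "continuous_on ?I y" unfolding y_def[abs_def] by (intro continuous_intros)
        show "y ` ?I \<subseteq> U" using yU by (auto simp: abs_le_iff)
      qed
      have nn: "0 \<le> \<eta> * \<bar>s\<bar>" using \<eta> by simp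
      have e1: "\<bar>f (y (\<eta> * \<bar>s\<bar>)) - \<eta> * \<bar>s\<bar> * f' w\<bar> < \<eta> * \<bar>s\<bar> * \<bar>f' w\<bar>"
        using est[of "\<eta> * \<bar>s\<bar>"] lt nn by simp
      have e2: "\<bar>f (y (-(\<eta> * \<bar>s\<bar>))) + \<eta> * \<bar>s\<bar> * f' w\<bar> < \<eta> * \<bar>s\<bar> * \<bar>f' w\<bar>"
        using est[of "-(\<eta> * \<bar>s\<bar>)"] lt nn by simp
      have "\<exists>h\<in>?I. f (y h) = 0"
      proof (cases "f' w > 0")
        case True
        then have "f (y (\<eta> * \<bar>s\<bar>)) \<ge> 0" "f (y (-(\<eta> * \<bar>s\<bar>))) \<le> 0" 
          using e1 e2 unfolding abs_of_pos[OF True] abs_less_iff by linarith+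
        then show ?thesis using IVT'[of "\<lambda>h. f (y h)" "-(\<eta> * \<bar>s\<bar>)" 0 "\<eta> * \<bar>s\<bar>"] cont nn by auto
      next
        case False
        then have "f (y (\<eta> * \<bar>s\<bar>)) \<le> 0" "f (y (-(\<eta> * \<bar>s\<bar>))) \<ge> 0" 
          using e1 e2 unfolding abs_of_nonpos[OF leI[OF False]] abs_less_iff minus_mult_right[symmetric]
          by linarith+
        then show ?thesis using IVT2'[of "\<lambda>h. f (y h)" "\<eta> * \<bar>s\<bar>" 0 "-(\<eta> * \<bar>s\<bar>)"] cont nn by auto
      qed
      then obtain h where "h \<in> ?I" and fh: "f (y h) = 0" by blast
      then have h: "\<bar>h\<bar> \<le> \<eta> * \<bar>s\<bar>" by (auto simp: abs_le_iff)
      then show ?thesis using yU[OF h] by (intro bexI[of _ h]) (use fh in \<open>auto simp: Z_def y_def\<close>)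
    qed
    ultimately show ?thesis by blast
  qed
  text \<open>A root of almost minimal modulus satisfies all the bounds \<open>\<eta> * \<bar>s\<bar>\<close> at once.\<close>
  define g where "g s = (if s = 0 then 0 else SOME h. h \<in> Z s \<and> \<bar>h\<bar> \<le> Inf (abs ` Z s) + s\<^sup>2)" for s
  have bdd: "bdd_below (abs ` Z s)" for s by (rule bdd_belowI[of _ 0]) auto
  have g: "g s \<in> Z s \<and> \<bar>g s\<bar> \<le> Inf (abs ` Z s) + s\<^sup>2" if "Z s \<noteq> {}" for s
  proof (cases "s = 0")
    case True
    have "0 \<le> Inf (abs ` Z s)" by (rule cInf_greatest) (use that in auto)
    then show ?thesis using U z True by (auto simp: g_def Z_def)
  next
    case False
    have "\<exists>x\<in>abs ` Z s. x < Inf (abs ` Z s) + s\<^sup>2"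
      using that False bdd by (subst cInf_less_iff[symmetric]) auto
    then have "\<exists>h. h \<in> Z s \<and> \<bar>h\<bar> \<le> Inf (abs ` Z s) + s\<^sup>2" by force
    from someI_ex[OF this] show ?thesis using False by (simp add: g_def)
  qed
  have small: "\<exists>d>0. \<forall>s. \<bar>s\<bar> < d \<longrightarrow> g s \<in> Z s \<and> \<bar>g s\<bar> \<le> \<eta> * \<bar>s\<bar>" if \<eta>: "\<eta> > 0" for \<eta>
  proof -
    \<comment> \<open>\<open>key\<close> covers constants up to 1. Half of \<eta> is kept for the
      slack \<open>s\<^sup>2\<close> in the choice of \<open>g\<close>, which
      \<open>\<bar>s\<bar> < \<eta>/2\<close> bounds by
      \<open>\<eta>/2 * \<bar>s\<bar>\<close>.\<close>
    obtain d where d: "d > 0" "\<And>s. \<bar>s\<bar> < d \<Longrightarrow> \<exists>h\<in>Z s. \<bar>h\<bar> \<le> min (\<eta>/2) 1 * \<bar>s\<bar>"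
      using key[of "min (\<eta>/2) 1"] \<eta> by auto
    show ?thesis
    proof (intro exI[of _ "min d (\<eta>/2)"] conjI allI impI)
      show "min d (\<eta>/2) > 0" using d \<eta> by simp
      fix s assume s: "\<bar>s\<bar> < min d (\<eta>/2)"
      then obtain h where h: "h \<in> Z s" "\<bar>h\<bar> \<le> min (\<eta>/2) 1 * \<bar>s\<bar>" using d by auto
      then have gs: "g s \<in> Z s" "\<bar>g s\<bar> \<le> Inf (abs ` Z s) + s\<^sup>2" using g by auto
      show "g s \<in> Z s" by fact
      have "Inf (abs ` Z s) \<le> \<bar>h\<bar>" using h bdd by (auto intro: cInf_lower)
      also have "\<dots> \<le> \<eta>/2 * \<bar>s\<bar>" using h(2) by (smt (verit) mult_right_mono abs_ge_zero)
      finally have "Inf (abs ` Z s) \<le> \<eta>/2 * \<bar>s\<bar>" .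
      moreover have "s\<^sup>2 \<le> \<eta>/2 * \<bar>s\<bar>"
      proof -
        have "s\<^sup>2 = \<bar>s\<bar> * \<bar>s\<bar>" by (simp add: power2_eq_square)
        also have "\<dots> \<le> \<eta>/2 * \<bar>s\<bar>" using s by (intro mult_right_mono) auto
        finally show ?thesis .
      qed
      ultimately have "Inf (abs ` Z s) + s\<^sup>2 \<le> \<eta> * \<bar>s\<bar>" by simp
      then show "\<bar>g s\<bar> \<le> \<eta> * \<bar>s\<bar>" using gs by simp
    qed
  qed
  have g0: "g 0 = 0" by (simp add: g_def)
  have "(g has_derivative (\<lambda>_. 0)) (at 0)"
    unfolding has_derivative_at_alt
  proof (intro conjI allI impI)
    fix e :: real assume "e > 0"
    from small[OF this] show "\<exists>d>0. \<forall>y. norm (y - 0) < d \<longrightarrow> norm (g y - g 0 - 0) \<le> e * norm (y - 0)"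
      by (auto simp: g0)
  qed auto
  then have "(g has_real_derivative 0) (at 0)" by (simp add: has_field_derivative_def lambda_zero)
  then show ?thesis using small[of 1] g0 by (intro exI[of _ g]) (auto simp: Z_def)
qed

text \<open>The chain rule along a curve in \<open>M\<close> gives one inclusion. For the other,
  \<open>tangent_correction\<close> bends the line through \<open>p\<close> with direction in the
  kernel of \<open>f'\<close> into a curve in \<open>M\<close>, moving it along the transverse
  vector \<open>w\<close> without changing its velocity.\<close>

lemma tangent_space_level_set:
  fixes f :: "'a::real_normed_vector \<Rightarrow> real"
  assumes U: "open U" "p \<in> U" "p \<in> M" "M \<inter> U = {q\<in>U. f q = 0}" "continuous_on U f"
    and f: "(f has_derivative f') (at p)" "f' w \<noteq> 0"
  shows "tangent_space M p = {u. f' u = 0}"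
proof (intro equalityI subsetI)
  fix u assume "u \<in> tangent_space M p"
  then obtain \<gamma> \<epsilon> where g: "\<epsilon> > 0" "\<gamma> 0 = p" "\<And>s. \<bar>s\<bar> < \<epsilon> \<Longrightarrow> \<gamma> s \<in> M"
    "(\<gamma> has_vector_derivative u) (at (0::real))" by (auto simp: tangent_space_def)
  have c: "isCont \<gamma> 0" using g(4) has_vector_derivative_continuous by blast
  have "((f \<circ> \<gamma>) has_vector_derivative f' u) (at 0)"
    using f(1) g(2,4) has_derivative_bounded_linear[OF f(1)]
    by (simp add: vector_derivative_diff_chain_within[of \<gamma> u 0 UNIV f f'] has_derivative_at_withinI)
  moreover have "\<forall>\<^sub>F s in nhds 0. (f \<circ> \<gamma>) s = 0"
  proof -
    have "\<forall>\<^sub>F s in nhds 0. \<gamma> s \<in> U"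
      using c U(1,2) g(2) unfolding continuous_at_open eventually_nhds by metis
    moreover have "\<forall>\<^sub>F s in nhds 0. \<gamma> s \<in> M"
      unfolding eventually_nhds_metric using g by (intro exI[of _ \<epsilon>]) (auto simp: dist_norm)
    ultimately show ?thesis by eventually_elim (use U(4) in auto)
  qed
  ultimately have "((\<lambda>s. 0::real) has_vector_derivative f' u) (at 0)"
    unfolding has_real_derivative_iff_has_vector_derivative[symmetric]
    by (subst (asm) DERIV_cong_ev[OF refl _ refl]) auto
  then show "u \<in> {u. f' u = 0}"
    using vector_derivative_unique_at[of "\<lambda>_. 0::real" 0 0 "f' u"] by auto
next
  fix u assume "u \<in> {u. f' u = 0}"
  then have "f' u = 0" by simp
  moreover have "f p = 0" using U by blast
  ultimately obtain h d where h: "h 0 = 0" "(h has_real_derivative 0) (at 0)" "d > 0"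
     "\<And>s. \<bar>s\<bar> < d \<Longrightarrow> p + s *\<^sub>R u + h s *\<^sub>R w \<in> U \<and> f (p + s *\<^sub>R u + h s *\<^sub>R w) = 0"
    using tangent_correction[OF U(1,2,5) f(1) _ _ f(2)] by metis
  have "((\<lambda>s. p + s *\<^sub>R u + h s *\<^sub>R w) has_vector_derivative (0 + (0 *\<^sub>R 0 + 1 *\<^sub>R u) + (h 0 *\<^sub>R 0 + 0 *\<^sub>R w))) (at 0)"
    by (intro has_vector_derivative_add has_vector_derivative_scaleR has_vector_derivative_const h(2) DERIV_ident)
  then have "((\<lambda>s. p + s *\<^sub>R u + h s *\<^sub>R w) has_vector_derivative u) (at 0)" by simp
  then show "u \<in> tangent_space M p"
    unfolding tangent_space_def mem_Collect_eq using h U(4)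
    by (intro exI[of _ "\<lambda>s. p + s *\<^sub>R u + h s *\<^sub>R w"] exI[of _ d]) auto
qed

text \<open>Positivity of \<open>v'\<close> on \<open>w\<close> makes \<open>v\<close> strictly
  increasing along segments in direction \<open>w\<close>, so each of them carries one root. This
  uniqueness identifies the curve given by \<open>tangent_correction\<close> with the graph of
  \<open>\<tau>\<close>, which is how \<open>\<tau>\<close> is seen to be differentiable.\<close>

lemma implicit_curve:
  fixes v :: "'a::real_normed_vector \<Rightarrow> real"
  assumes W: "open W" "q0 \<in> W" "v q0 = 0" and v: "\<And>q. q \<in> W \<Longrightarrow> (v has_derivative v' q) (at q)"
    and pos: "\<And>q. q \<in> W \<Longrightarrow> v' q w > 0"
  shows "\<exists>\<delta>>0. \<exists>\<epsilon>>0. \<exists>\<tau>. \<forall>s. \<bar>s\<bar> < \<delta> \<longrightarrow> \<bar>\<tau> s\<bar> < \<epsilon> \<and> \<tau> differentiable (at s) \<and>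
     (\<forall>h. \<bar>h\<bar> < \<epsilon> \<longrightarrow> q0 + s *\<^sub>R u + h *\<^sub>R w \<in> W \<and> (v (q0 + s *\<^sub>R u + h *\<^sub>R w) = 0 \<longleftrightarrow> h = \<tau> s))"
proof -
  define Q where "Q s h = q0 + s *\<^sub>R u + h *\<^sub>R w" for s h
  have cv: "continuous_on W v"
    using v by (meson continuous_at_imp_continuous_on has_derivative_continuous)
  obtain r where r: "r > 0" "ball q0 r \<subseteq> W" using W openE by blast
  define K where "K = norm u + norm w + 1"
  have K: "K > 0" by (simp add: K_def add_nonneg_pos)
  define \<epsilon> where "\<epsilon> = r / (2 * K)"
  have e: "\<epsilon> > 0" using r K by (simp add: \<epsilon>_def)
  have QW: "Q s h \<in> W" if "\<bar>s\<bar> \<le> \<epsilon>" "\<bar>h\<bar> \<le> \<epsilon>" for s h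
  proof -
    have "norm (s *\<^sub>R u + h *\<^sub>R w) \<le> \<bar>s\<bar> * norm u + \<bar>h\<bar> * norm w"
      using norm_triangle_ineq[of "s *\<^sub>R u" "h *\<^sub>R w"] by simp
    also have "\<dots> \<le> \<epsilon> * norm u + \<epsilon> * norm w" using that by (intro add_mono mult_right_mono) auto
    also have "\<dots> \<le> \<epsilon> * K" using e by (simp add: K_def algebra_simps)
    also have "\<dots> < r" using r K by (simp add: \<epsilon>_def)
    finally have "norm (s *\<^sub>R u + h *\<^sub>R w) < r" .
    moreover have "q0 - Q s h = - (s *\<^sub>R u + h *\<^sub>R w)" by (simp add: Q_def)
    ultimately have "dist q0 (Q s h) < r" unfolding dist_norm by (simp only: norm_minus_cancel)
    then show ?thesis using r by auto
  qed
  have dQ: "((\<lambda>h. v (Q s h)) has_real_derivative v' (Q s h) w) (at h)" if "\<bar>s\<bar> \<le> \<epsilon>" "\<bar>h\<bar> \<le> \<epsilon>" for s h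
  proof -
    interpret bounded_linear "v' (Q s h)" using v[OF QW[OF that]] by (rule has_derivative_bounded_linear)
    have "((\<lambda>h. Q s h) has_derivative (\<lambda>k. k *\<^sub>R w)) (at h)"
      unfolding Q_def by (auto intro!: derivative_eq_intros)
    from has_derivative_compose[OF this v[OF QW[OF that]]] show ?thesis
      by (simp add: has_field_derivative_def scaleR mult_commute_abs)
  qed
  have mono: "v (Q s h1) < v (Q s h2)" if "\<bar>s\<bar> \<le> \<epsilon>" "-\<epsilon> \<le> h1" "h1 < h2" "h2 \<le> \<epsilon>" for s h1 h2
  proof (rule DERIV_pos_imp_increasing[OF that(3)])
    fix x assume "h1 \<le> x" "x \<le> h2"
    then have x: "\<bar>x\<bar> \<le> \<epsilon>" using that by auto
    show "\<exists>y. ((\<lambda>h. v (Q s h)) has_real_derivative y) (at x) \<and> 0 < y"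
      using dQ[OF that(1) x] pos[OF QW[OF that(1) x]] by blast
  qed
  have Q00: "Q 0 0 = q0" by (simp add: Q_def)
  have "v (Q 0 0) < v (Q 0 \<epsilon>)" "v (Q 0 (-\<epsilon>)) < v (Q 0 0)" using e by (auto intro!: mono)
  then have sg: "v (Q 0 \<epsilon>) > 0" "v (Q 0 (-\<epsilon>)) < 0" by (simp_all add: Q00 W)
  have cQ: "isCont (\<lambda>s. v (Q s h)) 0" if "\<bar>h\<bar> \<le> \<epsilon>" for h
  proof -
    have "isCont v (Q 0 h)" using QW[of 0 h] that e v has_derivative_continuous by fastforce
    moreover have "isCont (\<lambda>s. Q s h) 0" by (simp add: Q_def)
    ultimately show ?thesis by (rule isCont_o2[rotated])
  qed
  have "\<forall>\<^sub>F s in nhds 0. v (Q s \<epsilon>) > 0 \<and> v (Q s (-\<epsilon>)) < 0"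
    using order_tendstoD(1)[OF cQ[of \<epsilon>, unfolded isCont_def] sg(1)]
      order_tendstoD(2)[OF cQ[of "-\<epsilon>", unfolded isCont_def] sg(2)] e sg
    by (simp add: eventually_nhds_conv_at eventually_conj_iff)
  then obtain d where d: "d > 0" "\<And>s. \<bar>s\<bar> < d \<Longrightarrow> v (Q s \<epsilon>) > 0 \<and> v (Q s (-\<epsilon>)) < 0"
    unfolding eventually_nhds_metric by (auto simp: dist_norm)
  define \<delta> where "\<delta> = min d \<epsilon>"
  have \<delta>: "\<delta> > 0" using d e by (simp add: \<delta>_def)
  have ex: "\<exists>!h. \<bar>h\<bar> < \<epsilon> \<and> v (Q s h) = 0" if s: "\<bar>s\<bar> < \<delta>" for s
  proof -
    have "\<exists>h\<ge>-\<epsilon>. h \<le> \<epsilon> \<and> v (Q s h) = 0"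
    proof (rule IVT)
      show "v (Q s (- \<epsilon>)) \<le> 0" "0 \<le> v (Q s \<epsilon>)" using d(2)[of s] s by (auto simp: \<delta>_def)
      show "\<forall>x. - \<epsilon> \<le> x \<and> x \<le> \<epsilon> \<longrightarrow> isCont (\<lambda>h. v (Q s h)) x"
      proof (intro allI impI)
        fix x assume "- \<epsilon> \<le> x \<and> x \<le> \<epsilon>"
        then have "\<bar>x\<bar> \<le> \<epsilon>" by auto
        then show "isCont (\<lambda>h. v (Q s h)) x" using dQ[of s x] s by (auto simp: \<delta>_def intro: DERIV_isCont)
      qed
    qed (use e in simp)
    then obtain h where h: "-\<epsilon> \<le> h" "h \<le> \<epsilon>" "v (Q s h) = 0" by blast
    then have "h \<noteq> \<epsilon>" "h \<noteq> -\<epsilon>" using d(2)[of s] s h(3) by (auto simp: \<delta>_def)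
    then have "\<bar>h\<bar> < \<epsilon>" using h by auto
    moreover have "h' = h" if "\<bar>h'\<bar> < \<epsilon>" "v (Q s h') = 0" for h'
    proof (rule ccontr)
      assume "h' \<noteq> h"
      then consider "h' < h" | "h < h'" by linarith
      moreover have "\<bar>s\<bar> \<le> \<epsilon>" "-\<epsilon> \<le> h'" "h' \<le> \<epsilon>" using s that by (auto simp: \<delta>_def)
      ultimately show False using mono[of s h' h] mono[of s h h'] that h by cases auto
    qed
    ultimately show ?thesis using h by blast
  qed
  define \<tau> where "\<tau> s = (THE h. \<bar>h\<bar> < \<epsilon> \<and> v (Q s h) = 0)" for s
  have \<tau>: "\<bar>\<tau> s\<bar> < \<epsilon>" "v (Q s (\<tau> s)) = 0" if "\<bar>s\<bar> < \<delta>" for s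
    using theI'[OF ex[OF that]] by (auto simp: \<tau>_def)
  have uniq: "h = \<tau> s" if "\<bar>s\<bar> < \<delta>" "\<bar>h\<bar> < \<epsilon>" "v (Q s h) = 0" for s h
    using ex[OF that(1)] \<tau>[OF that(1)] that by auto
  have "\<tau> differentiable (at s)" if s: "\<bar>s\<bar> < \<delta>" for s
  proof -
    define q where "q = Q s (\<tau> s)"
    have qW: "q \<in> W" unfolding q_def using s \<tau>[OF s] by (intro QW) (auto simp: \<delta>_def)
    interpret bounded_linear "v' q" using v[OF qW] by (rule has_derivative_bounded_linear)
    \<comment> \<open>\<open>- \<rho>\<close> will be the slope of \<open>\<tau>\<close> at
      \<open>s\<close>, since \<open>u - \<rho> *\<^sub>R w\<close> is tangent to the level set at
      \<open>q\<close>.\<close>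
    define \<rho> where "\<rho> = v' q u / v' q w"
    have "v' q (u - \<rho> *\<^sub>R w) = 0" using pos[OF qW] by (simp add: diff scaleR \<rho>_def)
    moreover have "v q = 0" using \<tau>[OF s] by (simp add: q_def)
    ultimately obtain h d where h: "h 0 = 0" "(h has_real_derivative 0) (at 0)" "d > 0"
      "\<And>\<sigma>. \<bar>\<sigma>\<bar> < d \<Longrightarrow> v (q + \<sigma> *\<^sub>R (u - \<rho> *\<^sub>R w) + h \<sigma> *\<^sub>R w) = 0"
      using tangent_correction[OF W(1) qW cv v[OF qW], of "u - \<rho> *\<^sub>R w" w] pos[OF qW] by (metis less_irrefl)
    define g where "g \<sigma> = \<tau> s - \<rho> * (\<sigma> - s) + h (\<sigma> - s)" for \<sigma>
    have "((\<lambda>\<sigma>. h (\<sigma> - s)) has_real_derivative 0) (at s)"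
      using h(2) DERIV_shift[of h 0 s "-s"] by (simp add: algebra_simps)
    then have dg: "(g has_real_derivative (- \<rho>)) (at s)"
      unfolding g_def by (auto intro!: derivative_eq_intros)
    have gs: "g s = \<tau> s" by (simp add: g_def h)
    have "isCont g s" using dg DERIV_isCont by blast
    then have c: "(g \<longlongrightarrow> \<tau> s) (at s)" by (simp add: isCont_def gs)
    have "\<forall>\<^sub>F \<sigma> in nhds s. \<bar>g \<sigma>\<bar> < \<epsilon>" 
      using order_tendstoD(2)[OF tendsto_rabs[OF c] \<tau>(1)[OF s]] \<tau>(1)[OF s]
      by (simp add: eventually_nhds_conv_at gs)
    moreover have "\<forall>\<^sub>F \<sigma> in nhds s. \<bar>\<sigma>\<bar> < \<delta>"
      unfolding eventually_nhds_metric using s by (intro exI[of _ "\<delta> - \<bar>s\<bar>"]) (auto simp: dist_real_def)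
    moreover have "\<forall>\<^sub>F \<sigma> in nhds s. \<bar>\<sigma> - s\<bar> < d"
      unfolding eventually_nhds_metric using h(3) by (auto simp: dist_real_def)
    ultimately have "\<forall>\<^sub>F \<sigma> in nhds s. g \<sigma> = \<tau> \<sigma>"
    proof eventually_elim
      case (elim \<sigma>)
      have "Q \<sigma> (g \<sigma>) = q + (\<sigma> - s) *\<^sub>R (u - \<rho> *\<^sub>R w) + h (\<sigma> - s) *\<^sub>R w"
        by (simp add: Q_def q_def g_def algebra_simps)
      then have "v (Q \<sigma> (g \<sigma>)) = 0" using h(4) elim by simp
      then show ?case using uniq elim by blast
    qed
    then have "(\<tau> has_real_derivative (- \<rho>)) (at s)"
      using dg by (subst DERIV_cong_ev[OF refl _ refl, of _ g]) (auto elim: eventually_mono)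
    then show ?thesis using real_differentiable_def by blast
  qed
  then show ?thesis
    unfolding Q_def[symmetric] using \<delta> e \<tau> uniq QW
    by (intro exI[of _ \<delta>] exI[of _ \<epsilon>] exI[of _ \<tau>] conjI allI impI) (auto simp: \<delta>_def)
qed

text \<open>Along a curve in \<open>M\<close> with velocity \<open>u\<close>, every derivative
  \<open>D\<close> of \<open>V\<close> within \<open>M\<close> gives
  \<open>V \<circ> \<gamma>\<close> the derivative \<open>D u\<close>; uniqueness of vector
  derivatives then justifies the definite description in \<open>deriv_along\<close>.\<close>

lemma deriv_along_tangent:
  assumes D: "(V has_derivative D) (at p within M)" and u: "u \<in> tangent_space M p"
  shows "deriv_along M V p u = D u"
proof -
  obtain \<gamma> \<epsilon> where g: "\<epsilon> > 0" "\<gamma> 0 = p" "\<And>s. \<bar>s\<bar> < \<epsilon> \<Longrightarrow> \<gamma> s \<in> M"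
    "(\<gamma> has_vector_derivative u) (at (0::real))" using u by (auto simp: tangent_space_def)
  let ?S = "ball 0 \<epsilon> :: real set"
  have *: "((V \<circ> \<gamma>) has_vector_derivative D u) (at 0)" if D: "(V has_derivative D) (at p within M)" for D
  proof -
    have "(V has_derivative D) (at (\<gamma> 0) within \<gamma> ` ?S)"
      using D g(2,3) by (intro has_derivative_subset[OF D[folded g(2)]]) auto
    from vector_derivative_diff_chain_within[OF has_vector_derivative_at_within[OF g(4)] this]
    have "((V \<circ> \<gamma>) has_vector_derivative D u) (at 0 within ?S)" .
    then show ?thesis using g(1) by (simp add: has_vector_derivative_within_open[of _ ?S])
  qed
  show ?thesis unfolding deriv_along_def
    by (rule the_equality) (use D * vector_derivative_unique_at in blast)+
qed

section \<open>Horizontal mean curvature in coordinates\<close>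

definition hz :: "'n::finite heis \<Rightarrow> (real, 'n) vec \<times> (real, 'n) vec" where
  "hz p = (fst p, fst (snd p))"

definition ht :: "'n::finite heis \<Rightarrow> real" where
  "ht p = snd (snd p)"

definition heis_point :: "(real, 'n) vec \<times> (real, 'n) vec \<Rightarrow> real \<Rightarrow> 'n::finite heis" where
  "heis_point z t = (fst z, snd z, t)"

text \<open>Multiplication by \<open>i\<close> when the pair \<open>(x, y)\<close> is read as
  \<open>x + i y\<close>.\<close>

definition Jrot :: "'a::real_normed_vector \<times> 'a \<Rightarrow> 'a \<times> 'a" where
  "Jrot z = (- snd z, fst z)"

text \<open>The unique horizontal vector at \<open>p\<close> with coordinates \<open>w\<close>. On
  such vectors the metric is the Euclidean inner product of the coordinates, so horizontal geometry
  at \<open>p\<close> becomes Euclidean geometry of \<open>w\<close>.\<close>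

definition lift :: "'n::finite heis \<Rightarrow> (real, 'n) vec \<times> (real, 'n) vec \<Rightarrow> 'n heis" where
  "lift p w = heis_point w (2 * (Jrot (hz p) \<bullet> w))"

definition cyl :: "'n::finite heis \<Rightarrow> real \<times> real" where
  "cyl p = ((norm (hz p))\<^sup>2, ht p)"

lemma hz_point [simp]: "hz (heis_point z t) = z" and ht_point [simp]: "ht (heis_point z t) = t"
  by (simp_all add: hz_def ht_def heis_point_def)

lemma point_hz_ht [simp]: "heis_point (hz p) (ht p) = p"
  by (simp add: hz_def ht_def heis_point_def)

lemma heis_eqI: "hz p = hz q \<Longrightarrow> ht p = ht q \<Longrightarrow> p = q"
  by (metis point_hz_ht)

lemma bounded_linear_hz: "bounded_linear hz"
  unfolding hz_def[abs_def]
  by (intro bounded_linear_Pair bounded_linear_fst bounded_linear_compose[OF bounded_linear_fst bounded_linear_snd])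

lemma bounded_linear_ht: "bounded_linear ht"
  unfolding ht_def[abs_def] by (intro bounded_linear_compose[OF bounded_linear_snd bounded_linear_snd])

lemma bounded_linear_Jrot: "bounded_linear Jrot"
  unfolding Jrot_def[abs_def]
  by (intro bounded_linear_Pair bounded_linear_minus bounded_linear_fst bounded_linear_snd)

lemma hz_simps [simp]: "hz (p + q) = hz p + hz q" "hz (p - q) = hz p - hz q" "hz (- p) = - hz p"
    "hz (c *\<^sub>R p) = c *\<^sub>R hz p" "hz 0 = 0"
  and ht_simps [simp]: "ht (p + q) = ht p + ht q" "ht (p - q) = ht p - ht q" "ht (- p) = - ht p"
    "ht (c *\<^sub>R p) = c * ht p" "ht 0 = 0"
  by (simp_all add: hz_def ht_def zero_prod_def)

lemmas continuous_on_hz [continuous_intros] = bounded_linear.continuous_on[OF bounded_linear_hz]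
  and continuous_on_ht [continuous_intros] = bounded_linear.continuous_on[OF bounded_linear_ht]
  and continuous_on_Jrot [continuous_intros] = bounded_linear.continuous_on[OF bounded_linear_Jrot]
  and has_derivative_hz [derivative_intros] = bounded_linear.has_derivative[OF bounded_linear_hz]
  and has_derivative_ht [derivative_intros] = bounded_linear.has_derivative[OF bounded_linear_ht]
  and has_derivative_Jrot [derivative_intros] = bounded_linear.has_derivative[OF bounded_linear_Jrot]

lemma Jrot_simps [simp]: "Jrot (z + w) = Jrot z + Jrot w" "Jrot (c *\<^sub>R z) = c *\<^sub>R Jrot z"
  by (simp_all add: Jrot_def)

lemma Jrot_inner [simp]:
  fixes z w :: "'a::real_inner \<times> 'a"
  shows "Jrot z \<bullet> z = 0" "z \<bullet> Jrot z = 0" "Jrot z \<bullet> Jrot w = z \<bullet> w"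
  by (simp_all add: Jrot_def inner_prod_def inner_commute)

lemma norm_Jrot [simp]: "norm (Jrot z) = norm (z :: 'a::real_inner \<times> 'a)"
  by (simp add: norm_eq_sqrt_inner)

lemma continuous_on_heis_point [continuous_intros]:
  "continuous_on S f \<Longrightarrow> continuous_on S g \<Longrightarrow> continuous_on S (\<lambda>x. heis_point (f x) (g x))"
  unfolding heis_point_def by (intro continuous_intros)

lemma hz_lift [simp]: "hz (lift p w) = w" and ht_lift [simp]: "ht (lift p w) = 2 * (Jrot (hz p) \<bullet> w)"
  by (simp_all add: lift_def)

lemma linear_lift: "linear (lift p)"
  by (intro linearI heis_eqI) (simp_all add: inner_simps algebra_simps)

lemma T_coeff_eq: "T_coeff p u = ht u - 2 * (Jrot (hz p) \<bullet> hz u)"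
  by (cases p; cases u) (simp add: hz_def ht_def Jrot_def)

lemma T_coeff_lift [simp]: "T_coeff p (lift p w) = 0"
  by (simp add: T_coeff_eq)

lemma lift_hz: "T_coeff p u = 0 \<Longrightarrow> lift p (hz u) = u"
  by (intro heis_eqI) (simp_all add: T_coeff_eq)

lemma heis_metric_eq: "heis_metric p u v = hz u \<bullet> hz v + T_coeff p u * T_coeff p v"
  by (simp add: heis_metric_def hz_def)

lemma heis_norm_lift [simp]: "heis_norm p (lift p w) = norm w"
  by (simp add: heis_norm_def heis_metric_eq norm_eq_sqrt_inner)

lemma horizontal_eq: "horizontal p = {u. T_coeff p u = 0}"
proof
  have "subspace {u. T_coeff p u = 0}" using linear_subspace_kernel[OF linear_T_coeff] by blast
  moreover have "T_coeff p (X_field j p) = 0" "T_coeff p (Y_field j p) = 0" for j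
    by (cases p; simp add: inner_axis)+
  ultimately show "horizontal p \<subseteq> {u. T_coeff p u = 0}"
    unfolding horizontal_def by (intro span_minimal) auto
  show "{u. T_coeff p u = 0} \<subseteq> horizontal p"
  proof
    fix u assume "u \<in> {u. T_coeff p u = 0}"
    moreover obtain a b s where u: "u = (a, b, s)" by (cases u)
    ultimately have "u = (\<Sum>j\<in>UNIV. (a $ j) *\<^sub>R X_field j p) + (\<Sum>j\<in>UNIV. (b $ j) *\<^sub>R Y_field j p)"
      using frame_expansion[of a b s p] by simp
    then show "u \<in> horizontal p"
      unfolding horizontal_def by (auto intro!: span_add span_sum span_scale intro: span_base)
  qed
qed

lemma hz_T_field: "hz (T_field p) = 0" "ht (T_field p) = 1"
  by (simp_all add: T_field_def hz_def ht_def zero_prod_def)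

lemma proj_H_eq: "proj_H p u = lift p (hz u)"
proof -
  obtain x y t a b s where p: "p = (x, y, t)" and u: "u = (a, b, s)" by (cases p; cases u)
  have X: "heis_metric p u (X_field j p) = a $ j" for j
    using p by (simp add: heis_metric_eq u hz_def) (simp add: hz_def inner_axis)
  have Y: "heis_metric p u (Y_field j p) = b $ j" for j
    using p by (simp add: heis_metric_eq u hz_def) (simp add: hz_def inner_axis)
  have "u = proj_H p u + T_coeff p u *\<^sub>R T_field p"
    unfolding proj_H_def X Y using frame_expansion[of a b s p] by (simp add: u)
  then have "proj_H p u = u - T_coeff p u *\<^sub>R T_field p" by (simp add: algebra_simps)
  also have "\<dots> = lift p (hz u)"
    by (intro heis_eqI) (simp_all add: hz_T_field T_coeff_eq)
  finally show ?thesis .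
qed

lemma has_derivative_cyl:
  "(cyl has_derivative (\<lambda>u. (2 * (hz p \<bullet> hz u), ht u))) (at p)"
  unfolding cyl_def power2_norm_eq_inner
  by (auto intro!: derivative_eq_intros simp: inner_commute)

lemma continuous_on_cyl [continuous_intros]: "continuous_on S cyl"
  unfolding cyl_def by (intro continuous_intros continuous_on_id)

text \<open>The curvature is a trace over the hyperplane orthogonal to \<open>A \<xi>\<close>, of
  dimension \<open>2n - 1\<close>: the first part of the quadratic form contributes \<alpha> per
  basis vector, and by Parseval the squares of \<open>e0 \<bullet> w\<close> add up to 1. The value
  is the same for every orthonormal basis, which settles the unspecified choice in the
  definition.\<close>

lemma horizontal_mean_curvature_eq:
  fixes \<xi> :: "'n::finite heis"
  assumes U: "open U" "\<xi> \<in> U" "\<xi> \<in> M"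
    and V: "\<And>\<eta>. \<eta> \<in> M \<inter> U \<Longrightarrow> horizontal_normal \<nu> \<eta> = lift \<eta> (A \<eta>)"
    and A: "(A has_derivative DA) (at \<xi>)" and N: "norm (A \<xi>) = 1"
    and T: "\<And>w. lift \<xi> w \<in> tangent_space M \<xi> \<longleftrightarrow> A \<xi> \<bullet> w = 0"
    and e0: "norm e0 = 1" "A \<xi> \<bullet> e0 = 0"
    and quad: "\<And>w. A \<xi> \<bullet> w = 0 \<Longrightarrow> DA (lift \<xi> w) \<bullet> w = \<alpha> * (norm w)\<^sup>2 + \<beta> * (e0 \<bullet> w)\<^sup>2"
  shows "(2 * real CARD('n) - 1) * horizontal_mean_curvature M \<nu> \<xi> = (2 * real CARD('n) - 1) * \<alpha> + \<beta>"
proof -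
  let ?S = "horizontal \<xi> \<inter> tangent_space M \<xi>"
  define H where "H = {w. A \<xi> \<bullet> w = 0}"
  have sH: "subspace H" unfolding H_def by (rule subspace_hyperplane)
  have dH: "dim H = 2 * CARD('n) - 1" unfolding H_def using N by (subst dim_hyperplane) auto
  have S: "?S = lift \<xi> ` H"
  proof (intro equalityI subsetI)
    fix u assume "u \<in> ?S"
    then have "u = lift \<xi> (hz u)" "u \<in> tangent_space M \<xi>" by (auto simp: horizontal_eq lift_hz)
    then show "u \<in> lift \<xi> ` H" using T unfolding H_def by (metis (mono_tags) image_iff mem_Collect_eq)
  qed (auto simp: horizontal_eq H_def T)
  have trace: "(\<Sum>e\<in>B. heis_metric \<xi> (nabla_along M (horizontal_normal \<nu>) \<xi> e) e)
      = (2 * real CARD('n) - 1) * \<alpha> + \<beta>" if B: "orthonormal_basis \<xi> ?S B" for B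
  proof -
    have B': "finite B" "span B = ?S" "\<And>u v. u \<in> B \<Longrightarrow> v \<in> B \<Longrightarrow> heis_metric \<xi> u v = (if u = v then 1 else 0)"
      using B by (auto simp: orthonormal_basis_def)
    have BS: "e \<in> ?S" if "e \<in> B" for e using B'(2) span_base[OF that] by auto
    then have TB: "T_coeff \<xi> e = 0" if "e \<in> B" for e using that by (auto simp: horizontal_eq)
    then have inj: "inj_on hz B" by (intro inj_onI) (metis lift_hz)
    have orth: "hz u \<bullet> hz v = (if u = v then 1 else 0)" if "u \<in> B" "v \<in> B" for u v
      using B'(3)[OF that] TB that by (simp add: heis_metric_eq)
    have pw: "pairwise orthogonal (hz ` B)"
      unfolding pairwise_def orthogonal_def using orth by auto
    have n1: "norm w = 1" if "w \<in> hz ` B" for w using that orth by (auto simp: norm_eq_1)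
    have indep: "independent (hz ` B)"
      by (rule pairwise_orthogonal_independent[OF pw]) (use n1[of 0] in auto)
    have "linear hz" using bounded_linear_hz bounded_linear.linear by blast
    from linear_span_image[OF this, of B] have spB: "span (hz ` B) = H"
      by (simp add: B'(2) S image_image)
    have "card B = dim H" 
      using dim_span_eq_card_independent[OF indep] card_image[OF inj] spB sH by simp
    then have cB: "real (card B) = 2 * real CARD('n) - 1"
      using dH by (simp add: of_nat_diff Suc_leI)
    have "e0 \<in> span (hz ` B)" using e0 spB by (simp add: H_def)
    then have "(\<Sum>w\<in>hz ` B. (e0 \<bullet> w) *\<^sub>R w) = e0"
      using orthonormal_basis_expand[OF pw n1] B'(1) by blast
    then have "(\<Sum>w\<in>hz ` B. (e0 \<bullet> w) *\<^sub>R w) \<bullet> e0 = 1" using e0 by (simp add: norm_eq_1)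
    then have pars: "(\<Sum>e\<in>B. (e0 \<bullet> hz e)\<^sup>2) = 1"
      by (simp add: inner_sum_left inner_sum_right sum.reindex[OF inj] power2_eq_square inner_commute)
    have summand: "heis_metric \<xi> (nabla_along M (horizontal_normal \<nu>) \<xi> e) e = \<alpha> + \<beta> * (e0 \<bullet> hz e)\<^sup>2"
      if e: "e \<in> B" for e
    proof -
      have tan: "e \<in> tangent_space M \<xi>" using BS[OF e] by simp
      define L where "L = (\<lambda>\<eta>. lift \<eta> (A \<eta>))"
      have "L differentiable (at \<xi>)"
        unfolding L_def lift_def heis_point_def differentiable_def
        by (rule exI, (rule derivative_intros A)+)
      then obtain D where D: "(L has_derivative D) (at \<xi>)" by (auto simp: differentiable_def)
      have "((\<lambda>\<eta>. hz (L \<eta>)) has_derivative (\<lambda>u. hz (D u))) (at \<xi>)"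
        by (rule has_derivative_hz[OF D])
      then have hD: "(\<lambda>u. hz (D u)) = DA"
        unfolding L_def hz_lift using A has_derivative_unique by blast
      obtain d where d: "d > 0" "ball \<xi> d \<subseteq> U" using U openE by blast
      have "(horizontal_normal \<nu> has_derivative D) (at \<xi> within M)"
        by (rule has_derivative_transform_within[OF has_derivative_at_withinI[OF D] d(1) U(3)])
           (use d V in \<open>auto simp: L_def dist_commute subset_iff\<close>)
      then have "deriv_along M (horizontal_normal \<nu>) \<xi> e = D e" by (rule deriv_along_tangent[OF _ tan])
      \<comment> \<open>The Christoffel symbols drop out: two terms of the Koszul formula cancel,
        and the derivative of \<open>heis_metric q e e\<close> at \<open>\<xi>\<close> has the
        factor \<open>T_coeff \<xi> e = 0\<close>. What remains is the Euclidean derivative of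
        \<open>A\<close>.\<close>
      moreover have "koszul \<xi> e W e = 0" for W
        unfolding koszul_def metric_sym[of _ W e]
        by (simp add: frechet_derivative_at[OF has_derivative_metric, symmetric] TB[OF e])
      ultimately have "heis_metric \<xi> (nabla_along M (horizontal_normal \<nu>) \<xi> e) e = heis_metric \<xi> (D e) e"
        by (simp add: nabla_along_def metric_add_left christoffel_metric)
      also have "\<dots> = DA e \<bullet> hz e" by (simp add: heis_metric_eq TB[OF e] hD[symmetric])
      also have "\<dots> = DA (lift \<xi> (hz e)) \<bullet> hz e" by (simp add: lift_hz TB[OF e])
      also have "\<dots> = \<alpha> * (norm (hz e))\<^sup>2 + \<beta> * (e0 \<bullet> hz e)\<^sup>2"
        using spB span_base[of "hz e" "hz ` B"] e by (intro quad) (auto simp: H_def)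
      also have "norm (hz e) = 1" using n1 e by auto
      finally show ?thesis by simp
    qed
    show ?thesis
      by (simp add: summand sum.distrib sum_distrib_left[symmetric] pars cB)
  qed
  have "\<exists>B. orthonormal_basis \<xi> ?S B"
  proof -
    obtain B where B: "B \<subseteq> H" "pairwise orthogonal B" "\<And>x. x \<in> B \<Longrightarrow> norm x = 1" "independent B" "span B = H"
      using orthonormal_basis_subspace[OF sH] by metis
    have "span (lift \<xi> ` B) = ?S" using linear_span_image[OF linear_lift, of \<xi> B] B(5) S by simp
    moreover have "finite B" using B(4) by (rule independent_imp_finite)
    moreover have "heis_metric \<xi> (lift \<xi> u) (lift \<xi> v) = (if u = v then 1 else 0)" if "u \<in> B" "v \<in> B" for u v
      using that B(2,3) by (auto simp: heis_metric_eq norm_eq_1 pairwise_def orthogonal_def)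
    moreover have "lift \<xi> u = lift \<xi> v \<longleftrightarrow> u = v" for u v by (metis hz_lift)
    ultimately show ?thesis unfolding orthonormal_basis_def by (intro exI[of _ "lift \<xi> ` B"]) auto
  qed
  then have "orthonormal_basis \<xi> ?S (SOME B. orthonormal_basis \<xi> ?S B)" by (rule someI_ex)
  moreover have "real CARD('n) \<ge> 1" by (simp add: Suc_leI)
  then have "2 * real CARD('n) - 1 \<noteq> 0" by linarith
  ultimately show ?thesis
    using trace by (simp add: horizontal_mean_curvature_def)
qed

section \<open>The outward side of a level set\<close>

text \<open>A conormal covector \<open>F\<close> records the side of \<open>M\<close>: every
  direction in its positive half-space points outward. Stated for all these directions, the notion
  involves no metric and is invariant under positive rescaling of \<open>F\<close>.\<close>

definition outward_at :: "'a::real_normed_vector set \<Rightarrow> 'a \<Rightarrow> ('a \<Rightarrow> real) \<Rightarrow> bool" where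
  "outward_at M p F \<longleftrightarrow> (\<forall>w. F w > 0 \<longrightarrow>
     (\<exists>\<epsilon>>0. \<forall>s. 0 < s \<and> s < \<epsilon> \<longrightarrow> p + s *\<^sub>R w \<in> outside M \<and> p - s *\<^sub>R w \<in> inside M))"

lemma connected_same_side:
  assumes "connected T" "T \<inter> M = {}" "x \<in> T" "y \<in> T"
  shows "x \<in> outside M \<longleftrightarrow> y \<in> outside M" "x \<in> inside M \<longleftrightarrow> y \<in> inside M"
proof -
  have "T \<subseteq> inside M \<union> outside M" using assms(2) by (auto simp: inside_Un_outside)
  moreover have "inside M \<inter> T = {} \<or> outside M \<inter> T = {}"
    using inside_outside_intersect_connected[OF assms(1), of M] assms(2) by blast
  moreover have "inside M \<inter> outside M = {}" by (rule inside_Int_outside)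
  ultimately show "x \<in> outside M \<longleftrightarrow> y \<in> outside M" "x \<in> inside M \<longleftrightarrow> y \<in> inside M"
    using assms(3,4) by blast+
qed

lemma unbounded_connected_subset_outside:
  assumes "connected T" "T \<inter> M = {}" "\<not> bounded T"
  shows "T \<subseteq> outside M"
proof
  fix x assume x: "x \<in> T"
  have "T \<subseteq> connected_component_set (- M) x"
    using x assms by (intro connected_component_maximal) auto
  then have "\<not> bounded (connected_component_set (- M) x)" using assms(3) bounded_subset by blast
  then show "x \<in> outside M" using x assms(2) by (auto simp: outside_def)
qed

text \<open>Along the segment \<open>F (q - p) \<ge> s * \<mu>\<close> by convexity, while the
  remainder is at most half of that, so \<open>f\<close> stays positive. Points reached from
  \<open>p\<close> in two directions of the same half-space are thereby connected off
  \<open>M\<close>.\<close>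

lemma segment_avoids_level_set:
  fixes f :: "'a::real_normed_vector \<Rightarrow> real"
  assumes U: "open U" "p \<in> U" "\<And>q. q \<in> M \<inter> U \<Longrightarrow> f q = 0"
    and f: "(f has_derivative F) (at p)" "f p = 0" "F x > 0" "F y > 0"
  shows "\<exists>\<epsilon>>0. \<forall>s. 0 < s \<and> s < \<epsilon> \<longrightarrow> closed_segment (p + s *\<^sub>R x) (p + s *\<^sub>R y) \<inter> M = {}"
proof -
  interpret F: bounded_linear F using f(1) by (rule has_derivative_bounded_linear)
  define K where "K = norm x + norm y + 1"
  have K: "K > 0" by (simp add: K_def add_nonneg_pos)
  define \<mu> where "\<mu> = min (F x) (F y)"
  have \<mu>: "\<mu> > 0" using f by (simp add: \<mu>_def)
  obtain r where r: "r > 0" "ball p r \<subseteq> U" using U openE by blast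
  have "\<mu> / (2 * K) > 0" using \<mu> K by simp
  then obtain d where d: "d > 0" "\<And>y. norm (y - p) < d \<Longrightarrow> norm (f y - f p - F (y - p)) \<le> \<mu> / (2 * K) * norm (y - p)"
    using f(1) unfolding has_derivative_at_alt by blast
  show ?thesis
  proof (intro exI[of _ "min d r / K"] conjI allI impI)
    show "0 < min d r / K" using d r K by simp
    fix s assume s: "0 < s \<and> s < min d r / K"
    have "q \<notin> M" if q: "q \<in> closed_segment (p + s *\<^sub>R x) (p + s *\<^sub>R y)" for q
    proof -
      obtain t where t: "0 \<le> t" "t \<le> 1" "q = (1 - t) *\<^sub>R (p + s *\<^sub>R x) + t *\<^sub>R (p + s *\<^sub>R y)"
        using q by (auto simp: closed_segment_def)
      then have q': "q - p = s *\<^sub>R ((1 - t) *\<^sub>R x + t *\<^sub>R y)" by (simp add: algebra_simps)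
      have "norm ((1 - t) *\<^sub>R x + t *\<^sub>R y) \<le> (1 - t) * norm x + t * norm y"
        using t norm_triangle_ineq[of "(1 - t) *\<^sub>R x" "t *\<^sub>R y"] by simp
      also have "\<dots> \<le> 1 * norm x + 1 * norm y" using t by (intro add_mono mult_right_mono) auto
      finally have "norm ((1 - t) *\<^sub>R x + t *\<^sub>R y) < K" by (simp add: K_def)
      then have nq: "norm (q - p) < s * K" using s by (simp add: q')
      have "s * K < min d r" using s K by (simp add: field_simps)
      then have nd: "norm (q - p) < d" and "norm (q - p) < r" using nq by auto
      then have qU: "q \<in> U" using r by (auto simp: dist_norm norm_minus_commute subset_iff)
      have "\<mu> = (1 - t) * \<mu> + t * \<mu>" by (simp add: algebra_simps)
      also have "\<dots> \<le> (1 - t) * F x + t * F y"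
        using t by (intro add_mono mult_left_mono) (auto simp: \<mu>_def)
      finally have "s * \<mu> \<le> F (q - p)" using s by (simp add: q' F.add F.scaleR)
      moreover have "\<bar>f q - F (q - p)\<bar> \<le> \<mu> / (2 * K) * norm (q - p)" using d(2)[OF nd] f(2) by simp
      moreover have "\<mu> / (2 * K) * norm (q - p) \<le> \<mu> / (2 * K) * (s * K)"
        using nq \<mu> K by (intro mult_left_mono) auto
      moreover have "\<mu> / (2 * K) * (s * K) = s * \<mu> / 2" using K by (simp add: field_simps)
      moreover have "s * \<mu> > 0" using s \<mu> by simp
      ultimately have "f q > 0" by linarith
      then show ?thesis using U(3) qU by force
    qed
    then show "closed_segment (p + s *\<^sub>R x) (p + s *\<^sub>R y) \<inter> M = {}" by blast
  qed
qed

text \<open>One outward direction decides for all: short segments missing \<open>M\<close> join it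
  to any other direction with \<open>F w > 0\<close>, and the same argument for \<open>- f\<close>
  joins the reflected points on the inner side.\<close>

lemma outward_atI:
  fixes f :: "'a::real_normed_vector \<Rightarrow> real"
  assumes U: "open U" "p \<in> U" "\<And>q. q \<in> M \<inter> U \<Longrightarrow> f q = 0"
    and f: "(f has_derivative F) (at p)" "f p = 0" "F x > 0"
    and x: "\<exists>\<epsilon>>0. \<forall>s. 0 < s \<and> s < \<epsilon> \<longrightarrow> p + s *\<^sub>R x \<in> outside M \<and> p - s *\<^sub>R x \<in> inside M"
  shows "outward_at M p F"
  unfolding outward_at_def
proof (intro allI impI)
  fix w assume w: "F w > 0"
  interpret F: bounded_linear F using f(1) by (rule has_derivative_bounded_linear)
  obtain e1 where e1: "e1 > 0" "\<And>s. 0 < s \<Longrightarrow> s < e1 \<Longrightarrow> p + s *\<^sub>R x \<in> outside M \<and> p - s *\<^sub>R x \<in> inside M"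
    using x by blast
  obtain e2 where e2: "e2 > 0" "\<And>s. 0 < s \<Longrightarrow> s < e2 \<Longrightarrow> closed_segment (p + s *\<^sub>R x) (p + s *\<^sub>R w) \<inter> M = {}"
    using segment_avoids_level_set[OF U f w] by metis
  have f': "((\<lambda>q. - f q) has_derivative (\<lambda>u. - F u)) (at p)" using f(1) by (rule has_derivative_minus)
  obtain e3 where e3: "e3 > 0" "\<And>s. 0 < s \<Longrightarrow> s < e3 \<Longrightarrow> closed_segment (p + s *\<^sub>R - x) (p + s *\<^sub>R - w) \<inter> M = {}"
  proof -
    have "- f q = 0" if "q \<in> M \<inter> U" for q using U(3)[OF that] by simp
    from segment_avoids_level_set[OF U(1,2) this f', of M "- x" "- w"] show ?thesis
      using that f w by (auto simp: F.neg)
  qed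
  show "\<exists>\<epsilon>>0. \<forall>s. 0 < s \<and> s < \<epsilon> \<longrightarrow> p + s *\<^sub>R w \<in> outside M \<and> p - s *\<^sub>R w \<in> inside M"
  proof (intro exI[of _ "min e1 (min e2 e3)"] conjI allI impI)
    show "min e1 (min e2 e3) > 0" using e1 e2 e3 by simp
    fix s assume s: "0 < s \<and> s < min e1 (min e2 e3)"
    then show "p + s *\<^sub>R w \<in> outside M"
      using connected_same_side(1)[OF connected_segment(1) e2(2), of s "p + s *\<^sub>R x" "p + s *\<^sub>R w"] e1(2)[of s] by auto
    show "p - s *\<^sub>R w \<in> inside M"
      using s connected_same_side(2)[OF connected_segment(1) e3(2), of s "p - s *\<^sub>R x" "p - s *\<^sub>R w"] e1(2)[of s] by auto
  qed
qed

lemma outward_at_cong: "(\<And>w. F w > 0 \<longleftrightarrow> G w > 0) \<Longrightarrow> outward_at M p F \<longleftrightarrow> outward_at M p G"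
  by (simp add: outward_at_def)

text \<open>Since \<open>f\<close> increases along \<open>w\<close>, short rays from points of
  \<open>M\<close> in this direction miss \<open>M\<close>. They end in one ball around
  \<open>P\<close> that also misses \<open>M\<close>, so they all lie on the side of
  \<open>P\<close>, and the alternative in \<open>alt\<close> is resolved uniformly near
  \<open>p\<close>.\<close>

lemma outward_side_locally_constant:
  fixes f :: "'a::real_normed_vector \<Rightarrow> real"
  assumes U: "open U" "p \<in> U" and M: "p \<in> M" "M \<inter> U = {q\<in>U. f q = 0}"
    and f: "\<And>q. q \<in> U \<Longrightarrow> (f has_derivative F q) (at q)" "\<And>q. q \<in> U \<Longrightarrow> F q w > 0"
    and alt: "\<And>q. q \<in> M \<inter> U \<Longrightarrow> outward_at M q (F q) \<or> outward_at M q (\<lambda>u. - F q u)"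
  shows "\<exists>r>0. (\<forall>q\<in>M \<inter> ball p r. outward_at M q (F q)) \<or> (\<forall>q\<in>M \<inter> ball p r. outward_at M q (\<lambda>u. - F q u))"
proof -
  have cf: "continuous_on U f" using f(1) by (meson continuous_at_imp_continuous_on has_derivative_continuous)
  have zero: "f q = 0" if "q \<in> M" "q \<in> U" for q using that M(2) by blast
  obtain R where R: "R > 0" "ball p R \<subseteq> U" using U openE by blast
  \<comment> \<open>Chosen so that \<open>\<delta> * norm w < R / 2\<close>: rays starting within
    \<open>R / 2\<close> of \<open>p\<close> then stay in \<open>ball p R\<close>.\<close>
  define \<delta> where "\<delta> = R / 2 / (norm w + 1)"
  have n1: "norm w + 1 > 0" by (simp add: add_nonneg_pos)
  have \<delta>: "\<delta> > 0" using R n1 by (simp add: \<delta>_def)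
  have "\<delta> * norm w < \<delta> * (norm w + 1)" using \<delta> by simp
  also have "\<dots> = R / 2" unfolding \<delta>_def using n1 by (metis less_irrefl nonzero_eq_divide_eq)
  finally have \<delta>w: "\<delta> * norm w < R / 2" .
  have inU: "q + s *\<^sub>R w \<in> U" if "q \<in> ball p (R/2)" "0 \<le> s" "s \<le> \<delta>" for q s
  proof -
    have "norm (s *\<^sub>R w) \<le> \<delta> * norm w" using that by (simp add: mult_right_mono)
    then have "norm (s *\<^sub>R w) < R / 2" using \<delta>w by linarith
    moreover have "norm (q - p) < R / 2" using that by (simp add: dist_norm norm_minus_commute)
    moreover have "norm (q + s *\<^sub>R w - p) \<le> norm (q - p) + norm (s *\<^sub>R w)"
      using norm_triangle_ineq[of "q - p" "s *\<^sub>R w"] by (simp add: algebra_simps)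
    ultimately have "norm (q + s *\<^sub>R w - p) < R" by linarith
    then show ?thesis using R by (auto simp: dist_norm norm_minus_commute)
  qed
  have fpos: "f (q + s *\<^sub>R w) > 0" if q: "q \<in> M" "q \<in> ball p (R/2)" and s: "0 < s" "s \<le> \<delta>" for q s
  proof -
    have d: "((\<lambda>s. f (q + s *\<^sub>R w)) has_real_derivative F (q + t *\<^sub>R w) w) (at t)" if "0 \<le> t" "t \<le> \<delta>" for t
    proof -
      have u: "q + t *\<^sub>R w \<in> U" using inU q that by auto
      interpret bounded_linear "F (q + t *\<^sub>R w)" using f(1)[OF u] by (rule has_derivative_bounded_linear)
      have "((\<lambda>s. q + s *\<^sub>R w) has_derivative (\<lambda>k. k *\<^sub>R w)) (at t)" by (auto intro!: derivative_eq_intros)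
      from has_derivative_compose[OF this f(1)[OF u]] show ?thesis
        by (simp add: has_field_derivative_def scaleR mult_commute_abs)
    qed
    have "f (q + 0 *\<^sub>R w) < f (q + s *\<^sub>R w)"
    proof (rule DERIV_pos_imp_increasing[OF s(1)])
      fix x assume "0 \<le> x" "x \<le> s"
      then have "0 \<le> x" "x \<le> \<delta>" using s by auto
      then show "\<exists>y. ((\<lambda>s. f (q + s *\<^sub>R w)) has_real_derivative y) (at x) \<and> 0 < y"
        using d[of x] f(2)[OF inU[OF q(2)]] by blast
    qed
    moreover have "f q = 0" using q M inU[OF q(2), of 0] \<delta> by auto
    ultimately show ?thesis by simp
  qed
  have ray: "(\<lambda>s. q + s *\<^sub>R w) ` {0<..\<delta>} \<inter> M = {}" if "q \<in> M" "q \<in> ball p (R/2)" for q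
  proof -
    have "q + s *\<^sub>R w \<notin> M" if "0 < s" "s \<le> \<delta>" for s
      using fpos[OF \<open>q \<in> M\<close> \<open>q \<in> ball p (R/2)\<close> that] 
        inU[OF \<open>q \<in> ball p (R/2)\<close>, of s] that zero by fastforce
    then show ?thesis by auto
  qed
  define P where "P = p + \<delta> *\<^sub>R w"
  have pR: "p \<in> ball p (R/2)" using R by simp
  have "P \<in> U" "f P > 0" using inU[OF pR, of \<delta>] fpos[OF M(1) pR \<delta>] \<delta> by (auto simp: P_def)
  moreover have "open (U \<inter> f -` {0<..})" using cf U(1) by (simp add: continuous_open_preimage)
  ultimately obtain r2 where r2: "r2 > 0" "ball P r2 \<subseteq> U \<inter> f -` {0<..}" using openE[of "U \<inter> f -` {0<..}" P] by (metis Int_iff greaterThan_iff vimage_eq)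
  have "q \<notin> M" if "q \<in> ball P r2" for q using r2(2) that zero by fastforce
  then have PM: "ball P r2 \<inter> M = {}" by blast
  have same: "q + s *\<^sub>R w \<in> outside M \<longleftrightarrow> P \<in> outside M" "q + s *\<^sub>R w \<in> inside M \<longleftrightarrow> P \<in> inside M"
    if q: "q \<in> M" "q \<in> ball p (min (R/2) r2)" and s: "0 < s" "s \<le> \<delta>" for q s
  proof -
    have q': "q \<in> ball p (R/2)" "q + \<delta> *\<^sub>R w \<in> ball P r2" using q by (auto simp: P_def dist_norm)
    have "connected ((\<lambda>s. q + s *\<^sub>R w) ` {0<..\<delta>})"
      by (intro connected_continuous_image continuous_intros connected_Ioc)
    note a = connected_same_side[OF this ray[OF q(1) q'(1)], of "q + s *\<^sub>R w" "q + \<delta> *\<^sub>R w"]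
    note b = connected_same_side[OF connected_ball PM, of "q + \<delta> *\<^sub>R w" P]
    show "q + s *\<^sub>R w \<in> outside M \<longleftrightarrow> P \<in> outside M" "q + s *\<^sub>R w \<in> inside M \<longleftrightarrow> P \<in> inside M"
      using a b q'(2) r2(1) imageI[of s "{0<..\<delta>}" "\<lambda>s. q + s *\<^sub>R w"]
        imageI[of \<delta> "{0<..\<delta>}" "\<lambda>s. q + s *\<^sub>R w"] s \<delta> by simp_all
  qed
  have qU: "q \<in> U" if "q \<in> ball p (min (R/2) r2)" for q using inU[of q 0] that \<delta> by auto
  have IO: "inside M \<inter> outside M = {}" by (rule inside_Int_outside)
  show ?thesis
  proof (intro exI[of _ "min (R/2) r2"] conjI)
    show "min (R/2) r2 > 0" using R r2 by simp
    show "(\<forall>q\<in>M \<inter> ball p (min (R/2) r2). outward_at M q (F q)) \<or>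
      (\<forall>q\<in>M \<inter> ball p (min (R/2) r2). outward_at M q (\<lambda>u. - F q u))"
    proof (cases "P \<in> outside M")
      case True
      have "outward_at M q (F q)" if q: "q \<in> M" "q \<in> ball p (min (R/2) r2)" for q
      proof (rule ccontr)
        assume "\<not> outward_at M q (F q)"
        then have *: "outward_at M q (\<lambda>u. - F q u)" using alt qU q by blast
        interpret bounded_linear "F q" using f(1)[OF qU[OF q(2)]] by (rule has_derivative_bounded_linear)
        have "- F q (- w) > 0" using f(2)[OF qU[OF q(2)]] by (simp add: neg)
        then obtain e where e: "e > 0" "\<And>s. 0 < s \<Longrightarrow> s < e \<Longrightarrow> q - s *\<^sub>R - w \<in> inside M"
          using * unfolding outward_at_def by blast
        have "q + min (e/2) \<delta> *\<^sub>R w \<in> inside M" using e(2)[of "min (e/2) \<delta>"] e(1) \<delta> by auto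
        moreover have "q + min (e/2) \<delta> *\<^sub>R w \<in> outside M"
          using same(1)[OF q, of "min (e/2) \<delta>"] True e(1) \<delta> by auto
        ultimately show False using IO by blast
      qed
      then show ?thesis by blast
    next
      case False
      have "outward_at M q (\<lambda>u. - F q u)" if q: "q \<in> M" "q \<in> ball p (min (R/2) r2)" for q
      proof (rule ccontr)
        assume "\<not> outward_at M q (\<lambda>u. - F q u)"
        then have *: "outward_at M q (F q)" using alt qU q by blast
        then obtain e where e: "e > 0" "\<And>s. 0 < s \<Longrightarrow> s < e \<Longrightarrow> q + s *\<^sub>R w \<in> outside M"
          using f(2)[OF qU[OF q(2)]] unfolding outward_at_def by blast
        have "q + min (e/2) \<delta> *\<^sub>R w \<in> outside M" using e(2)[of "min (e/2) \<delta>"] e(1) \<delta> by auto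
        then show False using same(1)[OF q, of "min (e/2) \<delta>"] False e(1) \<delta> by auto
      qed
      then show ?thesis by blast
    qed
  qed
qed

text \<open>The functional dual to \<open>\<nu> \<xi>\<close> vanishes on the kernel of
  \<open>F\<close>, hence is a multiple of \<open>F\<close>. Evaluating it at
  \<open>\<nu> \<xi>\<close> shows that \<open>F (\<nu> \<xi>)\<close> is not zero, so the normal is
  transverse to the level set.\<close>

lemma normal_proportional:
  assumes \<nu>: "unit_normal_field M \<nu>" "\<xi> \<in> M" and F: "linear F" "tangent_space M \<xi> = {u. F u = 0}" "F w \<noteq> 0"
  shows "\<exists>k. (\<forall>u. heis_metric \<xi> (\<nu> \<xi>) u = k * F u) \<and> k * F (\<nu> \<xi>) = (1::real)"
proof -
  interpret F: linear F by fact
  define k where "k = heis_metric \<xi> (\<nu> \<xi>) w / F w"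
  have L: "heis_metric \<xi> (\<nu> \<xi>) u = k * F u" for u
  proof -
    have "F (u - (F u / F w) *\<^sub>R w) = 0" using F(3) by (simp add: F.diff F.scale)
    then have "heis_metric \<xi> (\<nu> \<xi>) (u - (F u / F w) *\<^sub>R w) = 0"
      using \<nu> F(2) by (auto simp: unit_normal_field_def)
    then show ?thesis
      by (simp add: linear_diff[OF linear_metric] linear_cmul[OF linear_metric] k_def)
  qed
  have "heis_metric \<xi> (\<nu> \<xi>) (\<nu> \<xi>) = 1"
    using \<nu> by (auto simp: unit_normal_field_def heis_norm_def)
  then show ?thesis using L by auto
qed

lemma outward_alternative:
  assumes \<nu>: "outward_unit_normal M \<nu>"
    and U: "open U" "\<xi> \<in> U" "\<xi> \<in> M" "M \<inter> U = {q\<in>U. f q = 0}" "continuous_on U f"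
    and f: "(f has_derivative F) (at \<xi>)" "F w \<noteq> 0"
  shows "outward_at M \<xi> F \<or> outward_at M \<xi> (\<lambda>u. - F u)"
proof -
  have T: "tangent_space M \<xi> = {u. F u = 0}" by (rule tangent_space_level_set[OF U f])
  have "linear F" using f(1) has_derivative_bounded_linear bounded_linear.linear by blast
  then have "F (\<nu> \<xi>) \<noteq> 0" 
    using normal_proportional[OF _ U(3) _ T f(2)] \<nu> by (metis mult_zero_right outward_unit_normal_def zero_neq_one)
  moreover have out: "\<exists>\<epsilon>>0. \<forall>s. 0 < s \<and> s < \<epsilon> \<longrightarrow> \<xi> + s *\<^sub>R \<nu> \<xi> \<in> outside M \<and> \<xi> - s *\<^sub>R \<nu> \<xi> \<in> inside M"
    using \<nu> U(3) by (simp add: outward_unit_normal_def)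
  moreover have z: "f q = 0" "- f q = 0" if "q \<in> M \<inter> U" for q using that U by auto
  moreover have "f \<xi> = 0" "- f \<xi> = 0" using z[of \<xi>] U(2,3) by auto
  ultimately consider "F (\<nu> \<xi>) > 0" | "- F (\<nu> \<xi>) > 0" by linarith
  then show ?thesis
  proof cases
    case 1
    then show ?thesis using outward_atI[OF U(1,2) z(1) f(1) \<open>f \<xi> = 0\<close> _ out] by blast
  next
    case 2
    then show ?thesis
      using outward_atI[OF U(1,2) z(2) has_derivative_minus[OF f(1)] \<open>- f \<xi> = 0\<close> _ out] by blast
  qed
qed

section \<open>The profile curve\<close>

text \<open>\<open>(a, b)\<close> is \<open>\<nabla>v / |\<nabla>v|\<close> and \<open>r\<close> is \<open>|\<nabla>v|\<close>, with the sign of \<open>v\<close> chosen so that \<open>v\<close> increases outwards.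
  No global rotational symmetry of \<open>M\<close> is assumed, so two points of \<open>M\<close> with the same \<open>(s, t)\<close> may
  need different profiles.\<close>

locale profile =
  fixes M U :: "'n::finite heis set" and W :: "(real \<times> real) set" and v r a b :: "real \<times> real \<Rightarrow> real"
  assumes open_U: "open U" and open_W: "open W"
    and has_derivative_v: "q \<in> W \<Longrightarrow> (v has_derivative (\<lambda>h. r q * (a q * fst h + b q * snd h))) (at q)"
    and r_pos: "q \<in> W \<Longrightarrow> r q > 0"
    and unit: "q \<in> W \<Longrightarrow> (a q)\<^sup>2 + (b q)\<^sup>2 = 1"
    and diff_a: "q \<in> W \<Longrightarrow> a differentiable (at q)" and diff_b: "q \<in> W \<Longrightarrow> b differentiable (at q)"
    and cyl_W: "\<xi> \<in> U \<Longrightarrow> cyl \<xi> \<in> W"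
    and mem_iff: "\<xi> \<in> U \<Longrightarrow> \<xi> \<in> M \<longleftrightarrow> v (cyl \<xi>) = 0"
    and axis: "\<xi> \<in> U \<Longrightarrow> hz \<xi> = 0 \<Longrightarrow> b (cyl \<xi>) \<noteq> 0"
    and outward: "\<xi> \<in> M \<Longrightarrow> \<xi> \<in> U \<Longrightarrow>
      outward_at M \<xi> (\<lambda>u. a (cyl \<xi>) * (2 * (hz \<xi> \<bullet> hz u)) + b (cyl \<xi>) * ht u)"
begin

text \<open>The differential of \<open>v (cyl \<xi>)\<close> divided by the positive factor
  \<open>r (cyl \<xi>)\<close>; the term \<open>2 * (hz \<xi> \<bullet> hz u)\<close> is the
  differential of \<open>s\<close>.\<close>

definition conormal :: "'n heis \<Rightarrow> 'n heis \<Rightarrow> real" where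
  "conormal \<xi> u = a (cyl \<xi>) * (2 * (hz \<xi> \<bullet> hz u)) + b (cyl \<xi>) * ht u"

lemma outward_conormal: "\<xi> \<in> M \<Longrightarrow> \<xi> \<in> U \<Longrightarrow> outward_at M \<xi> (conormal \<xi>)"
  using outward by (simp add: conormal_def[abs_def])

lemma linear_conormal: "linear (conormal \<xi>)"
  by (intro linearI) (simp_all add: conormal_def inner_simps algebra_simps)

lemma has_derivative_level:
  assumes "\<xi> \<in> U"
  shows "((\<lambda>\<xi>. v (cyl \<xi>)) has_derivative (\<lambda>u. r (cyl \<xi>) * conormal \<xi> u)) (at \<xi>)"
  using has_derivative_compose[OF has_derivative_cyl has_derivative_v[OF cyl_W[OF assms]]]
  by (simp add: conormal_def)

lemma continuous_on_level: "continuous_on U (\<lambda>\<xi>. v (cyl \<xi>))"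
  using has_derivative_level by (meson continuous_at_imp_continuous_on has_derivative_continuous)

lemma level_set: "M \<inter> U = {\<xi>\<in>U. v (cyl \<xi>) = 0}"
  using mem_iff by blast

text \<open>On the axis the differential of \<open>s\<close> vanishes and only \<open>b\<close>
  keeps the level function regular; this is what the locale assumption \<open>axis\<close>
  provides.\<close>

lemma conormal_nonzero:
  assumes "\<xi> \<in> U" shows "\<exists>w. conormal \<xi> w \<noteq> 0"
proof (rule ccontr)
  assume "\<not> ?thesis"
  then have z: "conormal \<xi> w = 0" for w by blast
  have "b (cyl \<xi>) = 0" using z[of "heis_point 0 1"] by (simp add: conormal_def)
  moreover from this have "a (cyl \<xi>) \<noteq> 0" using unit[OF cyl_W[OF assms]] by auto
  moreover have "a (cyl \<xi>) * (2 * (hz \<xi> \<bullet> hz \<xi>)) = 0"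
    using z[of "heis_point (hz \<xi>) 0"] by (simp add: conormal_def)
  ultimately show False using axis[OF assms] by simp
qed

lemma tangent_space_eq:
  assumes "\<xi> \<in> M" "\<xi> \<in> U"
  shows "tangent_space M \<xi> = {u. conormal \<xi> u = 0}"
proof -
  have r: "r (cyl \<xi>) > 0" using r_pos cyl_W assms by blast
  obtain w where w: "conormal \<xi> w \<noteq> 0" using conormal_nonzero assms by blast
  show ?thesis
    using tangent_space_level_set[OF open_U assms(2,1) level_set continuous_on_level has_derivative_level, of w]
      r w assms by auto
qed

lemma conormal_lift: "conormal \<xi> (lift \<xi> w) = 2 * ((a (cyl \<xi>) *\<^sub>R hz \<xi> + b (cyl \<xi>) *\<^sub>R Jrot (hz \<xi>)) \<bullet> w)"
  by (simp add: conormal_def inner_simps)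

lemma norm_normal:
  assumes "q \<in> W" shows "norm (a q *\<^sub>R z + b q *\<^sub>R Jrot z) = norm (z :: 'a::real_inner \<times> 'a)"
proof -
  have "(norm (a q *\<^sub>R z + b q *\<^sub>R Jrot z))\<^sup>2 = ((a q)\<^sup>2 + (b q)\<^sup>2) * (norm z)\<^sup>2"
    unfolding power2_norm_eq_inner by (simp add: inner_simps algebra_simps power2_eq_square)
  then show ?thesis using unit[OF assms] by simp
qed

text \<open>The dual of \<nu> is \<open>k\<close> times the conormal, which on horizontal lifts
  reads \<open>hz (\<nu> \<xi>) = 2 k (a z + b J z)\<close>. Normalising leaves only the sign of
  \<open>k\<close>; it is positive, since otherwise points just behind \<open>\<xi>\<close> along
  the normal would be both inside and outside.\<close>

lemma horizontal_normal_eq: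
  assumes \<nu>: "outward_unit_normal M \<nu>" and \<xi>: "\<xi> \<in> M" "\<xi> \<in> U" "hz \<xi> \<noteq> 0"
  shows "horizontal_normal \<nu> \<xi> =
    lift \<xi> ((a (cyl \<xi>) *\<^sub>R hz \<xi> + b (cyl \<xi>) *\<^sub>R Jrot (hz \<xi>)) /\<^sub>R norm (hz \<xi>))"
proof -
  let ?A = "a (cyl \<xi>) *\<^sub>R hz \<xi> + b (cyl \<xi>) *\<^sub>R Jrot (hz \<xi>)"
  interpret F: linear "conormal \<xi>" by (rule linear_conormal)
  obtain w where w: "conormal \<xi> w \<noteq> 0" using conormal_nonzero \<xi> by blast
  have un: "unit_normal_field M \<nu>" using \<nu> by (simp add: outward_unit_normal_def)
  obtain k where k: "\<And>u. heis_metric \<xi> (\<nu> \<xi>) u = k * conormal \<xi> u" "k * conormal \<xi> (\<nu> \<xi>) = 1"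
    using normal_proportional[OF un \<xi>(1) linear_conormal tangent_space_eq[OF \<xi>(1,2)] w] by blast
  have "conormal \<xi> (\<nu> \<xi>) \<ge> 0"
  proof (rule ccontr)
    assume "\<not> ?thesis"
    then have "conormal \<xi> (- \<nu> \<xi>) > 0" by (simp add: F.neg)
    then obtain e1 where e1: "e1 > 0" "\<And>s. 0 < s \<Longrightarrow> s < e1 \<Longrightarrow> \<xi> + s *\<^sub>R - \<nu> \<xi> \<in> outside M"
      using outward_conormal[OF \<xi>(1,2)] unfolding outward_at_def by blast
    obtain e2 where e2: "e2 > 0" "\<And>s. 0 < s \<Longrightarrow> s < e2 \<Longrightarrow> \<xi> - s *\<^sub>R \<nu> \<xi> \<in> inside M"
      using \<nu> \<xi>(1) unfolding outward_unit_normal_def by blast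
    have "\<xi> - (min e1 e2 / 2) *\<^sub>R \<nu> \<xi> \<in> outside M" "\<xi> - (min e1 e2 / 2) *\<^sub>R \<nu> \<xi> \<in> inside M"
      using e1(2)[of "min e1 e2 / 2"] e2(2)[of "min e1 e2 / 2"] e1(1) e2(1) by auto
    then show False using inside_Int_outside by blast
  qed
  then have kp: "k > 0" using k(2) by (metis less_eq_real_def mult_zero_right zero_less_mult_pos2 zero_less_one zero_neq_one)
  have "hz (\<nu> \<xi>) \<bullet> w = ((2 * k) *\<^sub>R ?A) \<bullet> w" for w
  proof -
    have "hz (\<nu> \<xi>) \<bullet> w = heis_metric \<xi> (\<nu> \<xi>) (lift \<xi> w)" by (simp add: heis_metric_eq)
    then show ?thesis by (simp add: k(1) conormal_lift)
  qed
  then have "hz (\<nu> \<xi>) = (2 * k) *\<^sub>R ?A" by (metis inner_commute vector_eq_rdot)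
  moreover have n: "norm ?A = norm (hz \<xi>)" by (rule norm_normal[OF cyl_W[OF \<xi>(2)]])
  ultimately have "hz (\<nu> \<xi>) /\<^sub>R norm (hz (\<nu> \<xi>)) = (inverse (2 * k * norm (hz \<xi>)) * (2 * k)) *\<^sub>R ?A"
    using kp by simp
  also have "inverse (2 * k * norm (hz \<xi>)) * (2 * k) = inverse (norm (hz \<xi>))"
    using kp \<xi>(3) by (simp add: field_simps)
  finally show ?thesis
    unfolding horizontal_normal_def proj_H_eq heis_norm_lift linear_cmul[OF linear_lift, symmetric] by simp
qed

text \<open>For a horizontal tangent direction \<open>w\<close>, the profile point moves only
  through the component of \<open>w\<close> along \<open>e0 = J A\<close>, so the turning of
  \<open>(a, b)\<close> is felt in that single direction. The change of \<open>z\<close> contributes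
  \<open>a / |z|\<close> in every direction because \<open>J w\<close> is orthogonal to
  \<open>w\<close>, and the change of \<open>1 / |z|\<close> contributes nothing because
  \<open>N\<close> is.\<close>

lemma mean_curvature_eq:
  assumes \<nu>: "outward_unit_normal M \<nu>" and \<xi>: "\<xi> \<in> M" "\<xi> \<in> U" "hz \<xi> \<noteq> 0"
    and a': "(a has_derivative a') (at (cyl \<xi>))" and b': "(b has_derivative b') (at (cyl \<xi>))"
    and \<tau>: "\<tau> = (- b (cyl \<xi>), a (cyl \<xi>))"
  shows "(2 * real CARD('n) - 1) * horizontal_mean_curvature M \<nu> \<xi> =
    (2 * real CARD('n) - 1) * (a (cyl \<xi>) / norm (hz \<xi>)) + 2 * norm (hz \<xi>) * (a (cyl \<xi>) * b' \<tau> - b (cyl \<xi>) * a' \<tau>)"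
proof -
  define z where "z = hz \<xi>"
  define \<rho> where "\<rho> = norm z"
  have \<rho>: "\<rho> > 0" using \<xi> by (simp add: \<rho>_def z_def)
  define \<alpha> \<beta> where ab: "\<alpha> = a (cyl \<xi>)" "\<beta> = b (cyl \<xi>)"
  have u: "\<alpha>\<^sup>2 + \<beta>\<^sup>2 = 1" using unit[OF cyl_W[OF \<xi>(2)]] by (simp add: ab)
  define A where "A \<eta> = (a (cyl \<eta>) *\<^sub>R hz \<eta> + b (cyl \<eta>) *\<^sub>R Jrot (hz \<eta>)) /\<^sub>R norm (hz \<eta>)" for \<eta> :: "'n heis"
  define C where "C u = (2 * (z \<bullet> hz u), ht u)" for u :: "'n heis"
  define N where "N = \<alpha> *\<^sub>R z + \<beta> *\<^sub>R Jrot z"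
  define DA where "DA u = - ((z \<bullet> hz u) / \<rho> ^ 3) *\<^sub>R N
     + (a' (C u) *\<^sub>R z + \<alpha> *\<^sub>R hz u + (b' (C u) *\<^sub>R Jrot z + \<beta> *\<^sub>R Jrot (hz u))) /\<^sub>R \<rho>" for u
  have AN: "A \<xi> = N /\<^sub>R \<rho>" by (simp add: A_def N_def ab z_def \<rho>_def)
  have nN: "norm N = \<rho>" unfolding N_def ab \<rho>_def by (rule norm_normal[OF cyl_W[OF \<xi>(2)]])
  have c': "(cyl has_derivative C) (at \<xi>)" using has_derivative_cyl by (simp add: C_def[abs_def] z_def)
  have da: "((\<lambda>\<eta>. a (cyl \<eta>)) has_derivative (\<lambda>u. a' (C u))) (at \<xi>)"
    and db: "((\<lambda>\<eta>. b (cyl \<eta>)) has_derivative (\<lambda>u. b' (C u))) (at \<xi>)"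
    using has_derivative_compose[OF c' a'] has_derivative_compose[OF c' b'] by simp_all
  have dh: "(hz has_derivative hz) (at \<xi>)" by (rule bounded_linear_imp_has_derivative[OF bounded_linear_hz])
  have dJ: "((\<lambda>\<eta>. Jrot (hz \<eta>)) has_derivative (\<lambda>u. Jrot (hz u))) (at \<xi>)" 
    by (rule bounded_linear.has_derivative[OF bounded_linear_Jrot dh])
  have dn: "((\<lambda>\<eta>. norm (hz \<eta>)) has_derivative (\<lambda>u. sgn z \<bullet> hz u)) (at \<xi>)"
    using has_derivative_compose[OF dh has_derivative_norm[OF \<xi>(3)]] by (simp add: z_def inner_commute)
  have di: "((\<lambda>\<eta>. inverse (norm (hz \<eta>))) has_derivative (\<lambda>u. - ((z \<bullet> hz u) / \<rho> ^ 3))) (at \<xi>)"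
    by (rule has_derivative_eq_rhs[OF Deriv.has_derivative_inverse[OF _ dn]])
      (use \<rho> in \<open>auto simp: z_def[symmetric] \<rho>_def[symmetric] sgn_div_norm field_simps power3_eq_cube fun_eq_iff\<close>)
  have "(A has_derivative DA) (at \<xi>)"
    unfolding A_def[abs_def]
    by (rule has_derivative_eq_rhs[OF has_derivative_scaleR[OF di
            has_derivative_add[OF has_derivative_scaleR[OF da dh] has_derivative_scaleR[OF db dJ]]]])
      (auto simp: DA_def N_def ab z_def[symmetric] \<rho>_def[symmetric] fun_eq_iff algebra_simps)
  moreover have "norm (A \<xi>) = 1" using nN \<rho> by (simp add: AN)
  moreover have "lift \<xi> w \<in> tangent_space M \<xi> \<longleftrightarrow> A \<xi> \<bullet> w = 0" for w
    using \<rho> by (simp add: tangent_space_eq \<xi> conormal_lift AN N_def ab z_def)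
  moreover define e0 where "e0 = (- \<beta> *\<^sub>R z + \<alpha> *\<^sub>R Jrot z) /\<^sub>R \<rho>"
  have "(norm (- \<beta> *\<^sub>R z + \<alpha> *\<^sub>R Jrot z))\<^sup>2 = (\<alpha>\<^sup>2 + \<beta>\<^sup>2) * (norm z)\<^sup>2"
    unfolding power2_norm_eq_inner by (simp add: inner_simps algebra_simps power2_eq_square)
  then have "norm e0 = 1" using u \<rho> by (simp add: e0_def \<rho>_def)
  moreover have "A \<xi> \<bullet> e0 = 0"
    by (simp add: AN N_def e0_def inner_simps algebra_simps)
  moreover have "DA (lift \<xi> w) \<bullet> w = \<alpha> / \<rho> * (norm w)\<^sup>2 + 2 * \<rho> * (\<alpha> * b' \<tau> - \<beta> * a' \<tau>) * (e0 \<bullet> w)\<^sup>2"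
    if w: "A \<xi> \<bullet> w = 0" for w
  proof -
    define \<mu> where "\<mu> = e0 \<bullet> w"
    have 1: "\<alpha> * (z \<bullet> w) + \<beta> * (Jrot z \<bullet> w) = 0" using w \<rho> by (simp add: AN N_def inner_simps)
    have 2: "- \<beta> * (z \<bullet> w) + \<alpha> * (Jrot z \<bullet> w) = \<rho> * \<mu>" using \<rho> by (simp add: \<mu>_def e0_def inner_simps)
    have zw: "z \<bullet> w = - \<beta> * \<rho> * \<mu>"
    proof -
      have "z \<bullet> w = (\<alpha>\<^sup>2 + \<beta>\<^sup>2) * (z \<bullet> w)" by (simp add: u)
      also have "\<dots> = \<alpha> * (\<alpha> * (z \<bullet> w) + \<beta> * (Jrot z \<bullet> w)) - \<beta> * (- \<beta> * (z \<bullet> w) + \<alpha> * (Jrot z \<bullet> w))"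
        by (simp add: algebra_simps power2_eq_square)
      finally show ?thesis unfolding 1 2 by simp
    qed
    have Jw: "Jrot z \<bullet> w = \<alpha> * \<rho> * \<mu>"
    proof -
      have "Jrot z \<bullet> w = (\<alpha>\<^sup>2 + \<beta>\<^sup>2) * (Jrot z \<bullet> w)" by (simp add: u)
      also have "\<dots> = \<beta> * (\<alpha> * (z \<bullet> w) + \<beta> * (Jrot z \<bullet> w)) + \<alpha> * (- \<beta> * (z \<bullet> w) + \<alpha> * (Jrot z \<bullet> w))"
        by (simp add: algebra_simps power2_eq_square)
      finally show ?thesis unfolding 1 2 by simp
    qed
    \<comment> \<open>The factor \<open>2 * \<rho>\<close> in front of the profile curvature
      originates here: \<open>cyl\<close> sends the lift of \<open>w\<close> to this multiple of the
      unit tangent \<open>\<tau>\<close>.\<close>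
    have Cu: "C (lift \<xi> w) = (2 * \<rho> * \<mu>) *\<^sub>R \<tau>"
      by (simp add: C_def z_def[symmetric] zw Jw \<tau> ab)
    interpret a': bounded_linear a' using a' by (rule has_derivative_bounded_linear)
    interpret b': bounded_linear b' using b' by (rule has_derivative_bounded_linear)
    have "N \<bullet> w = 0" using 1 by (simp add: N_def inner_simps)
    then have "DA (lift \<xi> w) \<bullet> w = (2 * \<rho> * \<mu> * a' \<tau> * (z \<bullet> w) + \<alpha> * (w \<bullet> w)
        + 2 * \<rho> * \<mu> * b' \<tau> * (Jrot z \<bullet> w)) / \<rho>"
      by (simp add: DA_def Cu a'.scaleR b'.scaleR inner_simps field_simps)
    also have "\<dots> = \<alpha> / \<rho> * (w \<bullet> w) + 2 * \<rho> * (\<alpha> * b' \<tau> - \<beta> * a' \<tau>) * \<mu>\<^sup>2"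
      using \<rho> by (simp add: zw Jw field_simps power2_eq_square)
    finally show ?thesis by (simp add: \<mu>_def power2_norm_eq_inner)
  qed
  moreover have "open (U \<inter> hz -` (- {0}))"
    by (intro open_Int open_U open_vimage continuous_intros continuous_on_id)
  moreover have "\<xi> \<in> U \<inter> hz -` (- {0})" using \<xi> by simp
  moreover have "horizontal_normal \<nu> \<eta> = lift \<eta> (A \<eta>)" if "\<eta> \<in> M \<inter> (U \<inter> hz -` (- {0}))" for \<eta>
    using that unfolding A_def by (intro horizontal_normal_eq[OF \<nu>]) auto
  ultimately show ?thesis
    using horizontal_mean_curvature_eq[of "U \<inter> hz -` (- {0})" \<xi> M \<nu> A DA e0 "\<alpha> / \<rho>" "2 * \<rho> * (\<alpha> * b' \<tau> - \<beta> * a' \<tau>)"] \<xi>(1)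
    by (simp add: ab \<rho>_def z_def)
qed

text \<open>On the horizontal space the conormal is represented by \<open>2 (a z + b J z)\<close>, a
  vector of length \<open>2 |z|\<close>. Hence only points of the axis can be
  characteristic.\<close>

lemma not_characteristic:
  assumes \<xi>: "\<xi> \<in> M" "\<xi> \<in> U" "hz \<xi> \<noteq> 0"
  shows "\<xi> \<notin> characteristic_set M"
proof
  assume "\<xi> \<in> characteristic_set M"
  then have "horizontal \<xi> = {u. conormal \<xi> u = 0}" using tangent_space_eq \<xi> by (auto simp: characteristic_set_def)
  then have "conormal \<xi> (lift \<xi> w) = 0" for w
    using T_coeff_lift[of \<xi> w] unfolding horizontal_eq by blast
  then have "(a (cyl \<xi>) *\<^sub>R hz \<xi> + b (cyl \<xi>) *\<^sub>R Jrot (hz \<xi>)) \<bullet> w = 0" for w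
    by (simp add: conormal_lift)
  then have "a (cyl \<xi>) *\<^sub>R hz \<xi> + b (cyl \<xi>) *\<^sub>R Jrot (hz \<xi>) = 0" using inner_eq_zero_iff by blast
  then show False using norm_normal[OF cyl_W[OF \<xi>(2)], of "hz \<xi>"] \<xi>(3) by simp
qed

text \<open>Differentiating \<open>a\<^sup>2 + b\<^sup>2 = 1\<close> shows that the derivative of
  \<open>(a, b)\<close> along the tangent is a multiple \<kappa> of the tangent. The prescribed
  curvature then says \<open>(2n - 1) (c \<rho> - a / \<rho>) = 2 \<rho> \<kappa>\<close>; halving
  it produces \<open>n - 1/2\<close>.\<close>

lemma curvature_ode:
  assumes \<nu>: "outward_unit_normal M \<nu>" and \<xi>: "\<xi> \<in> M" "\<xi> \<in> U" "hz \<xi> \<noteq> 0"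
    and H: "\<And>x y t. (x, y, t) \<in> M - characteristic_set M \<Longrightarrow>
           horizontal_mean_curvature M \<nu> (x, y, t) = c * sqrt ((norm x)\<^sup>2 + (norm y)\<^sup>2)"
    and q: "q = cyl \<xi>"
  shows "\<exists>a' b' \<kappa>. (a has_derivative a') (at q) \<and> (b has_derivative b') (at q) \<and>
     a' (- b q, a q) = - \<kappa> * b q \<and> b' (- b q, a q) = \<kappa> * a q \<and>
     fst q * \<kappa> = (real CARD('n) - 1/2) * (c * fst q - a q)"
proof -
  have qW: "q \<in> W" using cyl_W \<xi> q by simp
  obtain a' b' where ab: "(a has_derivative a') (at q)" "(b has_derivative b') (at q)"
    using diff_a[OF qW] diff_b[OF qW] by (auto simp: differentiable_def)
  define \<tau> where "\<tau> = (- b q, a q)"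
  define \<kappa> where "\<kappa> = a q * b' \<tau> - b q * a' \<tau>"
  have "((\<lambda>q. (a q)\<^sup>2 + (b q)\<^sup>2) has_derivative (\<lambda>h. 2 * a q * a' h + 2 * b q * b' h)) (at q)"
    by (auto intro!: derivative_eq_intros ab)
  then have "((\<lambda>q. 1) has_derivative (\<lambda>h. 2 * a q * a' h + 2 * b q * b' h)) (at q)"
    by (rule has_derivative_transform_within_open[OF _ open_W qW]) (use unit in auto)
  then have "(\<lambda>h. 2 * a q * a' h + 2 * b q * b' h) = (\<lambda>h. 0)"
    using has_derivative_unique has_derivative_const by blast
  then have o: "a q * a' \<tau> + b q * b' \<tau> = 0" by (drule_tac fun_cong[of _ _ \<tau>]) simp
  note u = unit[OF qW]
  have "a' \<tau> = ((a q)\<^sup>2 + (b q)\<^sup>2) * a' \<tau>" by (simp add: u)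
  also have "\<dots> = a q * (a q * a' \<tau> + b q * b' \<tau>) - \<kappa> * b q"
    by (simp add: \<kappa>_def algebra_simps power2_eq_square)
  finally have 1: "a' \<tau> = - \<kappa> * b q" by (simp add: o)
  have "b' \<tau> = ((a q)\<^sup>2 + (b q)\<^sup>2) * b' \<tau>" by (simp add: u)
  also have "\<dots> = b q * (a q * a' \<tau> + b q * b' \<tau>) + \<kappa> * a q"
    by (simp add: \<kappa>_def algebra_simps power2_eq_square)
  finally have 2: "b' \<tau> = \<kappa> * a q" by (simp add: o)
  define \<rho> where "\<rho> = norm (hz \<xi>)"
  have \<rho>: "\<rho> > 0" using \<xi> by (simp add: \<rho>_def)
  have s: "fst q = \<rho>\<^sup>2" by (simp add: q cyl_def \<rho>_def)
  have "horizontal_mean_curvature M \<nu> \<xi> = c * \<rho>"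
    using H[of "fst \<xi>" "fst (snd \<xi>)" "snd (snd \<xi>)"] not_characteristic[OF \<xi>] \<xi>(1)
    by (simp add: \<rho>_def hz_def norm_prod_def)
  then have "(2 * real CARD('n) - 1) * (c * \<rho>) = (2 * real CARD('n) - 1) * (a q / \<rho>) + 2 * \<rho> * \<kappa>"
    using mean_curvature_eq[OF \<nu> \<xi> ab[unfolded q] \<tau>_def[unfolded q]] 
    by (simp add: \<kappa>_def \<rho>_def \<tau>_def q)
  then have "\<rho>\<^sup>2 * \<kappa> = (real CARD('n) - 1/2) * (c * \<rho>\<^sup>2 - a q)"
    using \<rho> by (simp add: field_simps power2_eq_square)
  then show ?thesis using ab 1 2 s unfolding \<tau>_def by metis
qed

end

text \<open>The gradient of a symmetric defining function is normalised. The neighbourhood shrinks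
  to where one direction \<open>w\<close> stays transverse and then to where the outward side is
  constant, so that a single sign \<open>e\<close> orients the profile.\<close>

lemma profile_exists:
  assumes M: "cylindrically_symmetric M" "p \<in> M" and \<nu>: "outward_unit_normal M \<nu>"
  shows "\<exists>U W v r a b. p \<in> U \<and> profile M U W v r a b"
proof -
  have "\<exists>U f W v. local_defining_function M p U f \<and> open W \<and> smooth_on W v \<and>
        (\<forall>x y t. (x, y, t) \<in> U \<longrightarrow>
           ((norm x)\<^sup>2 + (norm y)\<^sup>2, t) \<in> W \<and> f (x, y, t) = v ((norm x)\<^sup>2 + (norm y)\<^sup>2, t))"
    using M unfolding cylindrically_symmetric_def by (rule bspec)
  then obtain U f W v where *: "local_defining_function M p U f \<and> open W \<and> smooth_on W v \<and>
        (\<forall>x y t. (x, y, t) \<in> U \<longrightarrow>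
           ((norm x)\<^sup>2 + (norm y)\<^sup>2, t) \<in> W \<and> f (x, y, t) = v ((norm x)\<^sup>2 + (norm y)\<^sup>2, t))"
    by (elim exE) (rule that)
  then have f: "local_defining_function M p U f" and W: "open W" "smooth_on W v"
    and fv: "\<And>x y t. (x, y, t) \<in> U \<Longrightarrow>
           ((norm x)\<^sup>2 + (norm y)\<^sup>2, t) \<in> W \<and> f (x, y, t) = v ((norm x)\<^sup>2 + (norm y)\<^sup>2, t)"
    by simp_all
  have U: "open U" "p \<in> U" "M \<inter> U = {q\<in>U. f q = 0}"
    and df: "\<And>q. q \<in> U \<Longrightarrow> frechet_derivative f (at q) \<noteq> (\<lambda>_. 0)"
    using f by (auto simp: local_defining_function_def)
  have memf: "\<xi> \<in> M \<longleftrightarrow> f \<xi> = 0" if "\<xi> \<in> U" for \<xi> using U(3) that by blast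
  have cyl: "cyl \<xi> = ((norm (fst \<xi>))\<^sup>2 + (norm (fst (snd \<xi>)))\<^sup>2, snd (snd \<xi>))" for \<xi> :: "'a heis"
    by (simp add: cyl_def hz_def ht_def norm_prod_def)
  have cylW: "cyl \<xi> \<in> W" and fc: "f \<xi> = v (cyl \<xi>)" if "\<xi> \<in> U" for \<xi>
    using fv[of "fst \<xi>" "fst (snd \<xi>)" "snd (snd \<xi>)"] that by (simp_all add: cyl)
  define vs vt where "vs q = frechet_derivative v (at q) (1, 0)" and "vt q = frechet_derivative v (at q) (0, 1)" for q
  \<comment> \<open>The normalised gradient must itself be differentiable, hence two derivatives of
    \<open>v\<close>.\<close>
  have "Ck_on (Suc (Suc 0)) W v" using W(2) by (simp add: smooth_on_def del: Ck_on.simps)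
  then have d1: "v differentiable (at q)" and d2: "vs differentiable (at q)" "vt differentiable (at q)" if "q \<in> W" for q
    using that by (simp_all add: vs_def[abs_def] vt_def[abs_def])
  have dv: "(v has_derivative (\<lambda>h. vs q * fst h + vt q * snd h)) (at q)" if "q \<in> W" for q
  proof -
    let ?D = "frechet_derivative v (at q)"
    have D: "(v has_derivative ?D) (at q)" using d1[OF that] frechet_derivative_works by blast
    interpret bounded_linear ?D using D by (rule has_derivative_bounded_linear)
    have "?D h = vs q * fst h + vt q * snd h" for h
    proof -
      have "h = fst h *\<^sub>R (1, 0) + snd h *\<^sub>R (0, 1)" by (simp add: prod_eq_iff)
      then have "?D h = ?D (fst h *\<^sub>R (1, 0) + snd h *\<^sub>R (0, 1))" by simp
      then show ?thesis by (simp only: add scaleR) (simp add: vs_def vt_def)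
    qed
    then show ?thesis using D by (simp add: has_derivative_eq_rhs[OF D] fun_eq_iff)
  qed
  define G where "G \<xi> u = vs (cyl \<xi>) * (2 * (hz \<xi> \<bullet> hz u)) + vt (cyl \<xi>) * ht u" for \<xi> u :: "'a heis"
  have fG: "(f has_derivative G \<xi>) (at \<xi>)" if "\<xi> \<in> U" for \<xi>
    by (rule has_derivative_transform_within_open[OF _ U(1) that fc[symmetric]])
      (use has_derivative_compose[OF has_derivative_cyl dv[OF cylW[OF that]]] in \<open>simp add: G_def[abs_def]\<close>)
  have Gnz: "\<exists>w. G \<xi> w \<noteq> 0" if "\<xi> \<in> U" for \<xi>
    using df[OF that] frechet_derivative_at[OF fG[OF that]] by metis
  have cont_f: "continuous_on U f" using fG by (meson continuous_at_imp_continuous_on has_derivative_continuous)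
  have cv: "continuous_on W vs" "continuous_on W vt"
    using d2 by (simp_all add: continuous_at_imp_continuous_on differentiable_imp_continuous_within)
  obtain w where "G p w \<noteq> 0" using Gnz U by blast
  then obtain w where w: "G p w > 0"
  proof (cases "G p w > 0")
    case False
    then have "G p (- w) > 0" using \<open>G p w \<noteq> 0\<close> by (simp add: G_def)
    then show ?thesis using that by blast
  qed
  have "continuous_on U (\<lambda>\<xi>. G \<xi> w)" unfolding G_def
    by (intro continuous_intros continuous_on_compose2[OF cv(1)] continuous_on_compose2[OF cv(2)] continuous_on_id)
      (auto intro: cylW)
  define U1 where "U1 = U \<inter> (\<lambda>\<xi>. G \<xi> w) -` {0<..}"
  have U1: "open U1" "p \<in> U1" "U1 \<subseteq> U" "\<And>\<xi>. \<xi> \<in> U1 \<Longrightarrow> G \<xi> w > 0"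
    using \<open>continuous_on U (\<lambda>\<xi>. G \<xi> w)\<close> U w by (auto simp: U1_def continuous_open_preimage)
  have lev: "M \<inter> U1 = {q\<in>U1. f q = 0}" using U U1 by blast
  have alt: "outward_at M q (G q) \<or> outward_at M q (\<lambda>u. - G q u)" if "q \<in> M \<inter> U1" for q
  proof -
    have q: "q \<in> U1" "q \<in> M" "q \<in> U" using that U1(3) by auto
    have "continuous_on U1 f" using cont_f U1(3) continuous_on_subset by blast
    from outward_alternative[OF \<nu> U1(1) q(1,2) lev this fG[OF q(3)]] show ?thesis
      using U1(4)[OF q(1)] by (metis less_irrefl)
  qed
  obtain \<rho> where \<rho>: "\<rho> > 0" "(\<forall>q\<in>M \<inter> ball p \<rho>. outward_at M q (G q)) \<or> (\<forall>q\<in>M \<inter> ball p \<rho>. outward_at M q (\<lambda>u. - G q u))"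
    using outward_side_locally_constant[OF U1(1,2) M(2) lev fG U1(4) alt] U1(3) by blast
  \<comment> \<open>Away from the zeros of the gradient the square root in \<open>R\<close> is
    differentiable; since the defining function has nonzero derivative, \<open>cyl\<close> maps the
    neighbourhood into this set.\<close>
  define W1 where "W1 = W \<inter> (\<lambda>q. (vs q)\<^sup>2 + (vt q)\<^sup>2) -` {0<..}"
  have W1: "open W1" "W1 \<subseteq> W"
    unfolding W1_def by (auto intro!: continuous_open_preimage continuous_intros cv W)
  define U2 where "U2 = U1 \<inter> ball p \<rho>"
  have U2: "open U2" "p \<in> U2" "U2 \<subseteq> U" using U1 \<rho> by (auto simp: U2_def)
  have nz: "vs (cyl \<xi>) \<noteq> 0 \<or> vt (cyl \<xi>) \<noteq> 0" "hz \<xi> = 0 \<longrightarrow> vt (cyl \<xi>) \<noteq> 0" if "\<xi> \<in> U" for \<xi>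
    using Gnz[OF that] by (auto simp: G_def)
  have cylW1: "cyl \<xi> \<in> W1" if "\<xi> \<in> U2" for \<xi>
    using nz(1)[of \<xi>] cylW[of \<xi>] that U2(3) by (auto simp: W1_def sum_power2_gt_zero_iff)
  define R where "R q = sqrt ((vs q)\<^sup>2 + (vt q)\<^sup>2)" for q
  have R: "R q > 0" "(R q)\<^sup>2 = (vs q)\<^sup>2 + (vt q)\<^sup>2" if "q \<in> W1" for q using that by (auto simp: R_def W1_def)
  have dR: "R differentiable (at q)" if q1: "q \<in> W1" for q
  proof -
    obtain s' t' where d: "(vs has_derivative s') (at q)" "(vt has_derivative t') (at q)"
      using d2[of q] q1 W1(2) unfolding differentiable_def by blast
    have "(vs q)\<^sup>2 + (vt q)\<^sup>2 > 0" using q1 by (simp add: W1_def)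
    then show ?thesis unfolding R_def differentiable_def
      by (auto intro!: exI derivative_eq_intros d)
  qed
  have prof: "profile M U2 W1 (\<lambda>q. e * v q) R (\<lambda>q. e * vs q / R q) (\<lambda>q. e * vt q / R q)"
    if e: "e = 1 \<or> e = - 1" and out: "\<And>q. q \<in> M \<inter> ball p \<rho> \<Longrightarrow> outward_at M q (\<lambda>u. e * G q u)" for e :: real
  proof
    fix q assume q: "q \<in> W1"
    show "((\<lambda>q. e * v q) has_derivative (\<lambda>h. R q * (e * vs q / R q * fst h + e * vt q / R q * snd h))) (at q)"
      by (rule has_derivative_eq_rhs[OF has_derivative_mult_right[OF dv]])
        (use q W1 R(1)[OF q] in \<open>auto simp: fun_eq_iff field_simps\<close>)
    show "R q > 0" by (rule R[OF q])
    show "(e * vs q / R q)\<^sup>2 + (e * vt q / R q)\<^sup>2 = 1"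
      using e R[OF q] by (auto simp: power_divide add_divide_distrib[symmetric])
    show "(\<lambda>q. e * vs q / R q) differentiable (at q)" "(\<lambda>q. e * vt q / R q) differentiable (at q)"
      using d2[of q] dR[OF q] R(1)[OF q] W1 q by (auto intro!: differentiable_divide differentiable_mult)
  next
    fix \<xi> :: "'a heis" assume \<xi>: "\<xi> \<in> U2"
    then have U: "\<xi> \<in> U" using U2 by blast
    show "cyl \<xi> \<in> W1" by (rule cylW1[OF \<xi>])
    show "\<xi> \<in> M \<longleftrightarrow> e * v (cyl \<xi>) = 0" using memf[OF U] fc[OF U] e by auto
    show "hz \<xi> = 0 \<Longrightarrow> e * vt (cyl \<xi>) / R (cyl \<xi>) \<noteq> 0"
      using nz(2)[OF U] R(1)[OF cylW1[OF \<xi>]] e by auto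
  next
    fix \<xi> :: "'a heis" assume \<xi>: "\<xi> \<in> M" "\<xi> \<in> U2"
    have Rp: "R (cyl \<xi>) > 0" using R cylW1 \<xi> by blast
    have "e * vs (cyl \<xi>) / R (cyl \<xi>) * (2 * (hz \<xi> \<bullet> hz u)) + e * vt (cyl \<xi>) / R (cyl \<xi>) * ht u
      = e * G \<xi> u / R (cyl \<xi>)" for u
      using Rp by (simp add: G_def field_simps)
    then have "e * vs (cyl \<xi>) / R (cyl \<xi>) * (2 * (hz \<xi> \<bullet> hz u)) + e * vt (cyl \<xi>) / R (cyl \<xi>) * ht u > 0
      \<longleftrightarrow> e * G \<xi> u > 0" for u using Rp by (simp add: zero_less_divide_iff)
    note pos = this
    have "outward_at M \<xi> (\<lambda>u. e * G \<xi> u)" using out[of \<xi>] \<xi> by (simp add: U2_def)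
    then show "outward_at M \<xi> (\<lambda>u. e * vs (cyl \<xi>) / R (cyl \<xi>) * (2 * (hz \<xi> \<bullet> hz u)) + e * vt (cyl \<xi>) / R (cyl \<xi>) * ht u)"
      by (subst outward_at_cong[OF pos])
  qed (use U2 W1 in auto)
  from \<rho>(2) show ?thesis
  proof
    assume "\<forall>q\<in>M \<inter> ball p \<rho>. outward_at M q (G q)"
    then have "profile M U2 W1 (\<lambda>q. 1 * v q) R (\<lambda>q. 1 * vs q / R q) (\<lambda>q. 1 * vt q / R q)"
      by (intro prof) auto
    then show ?thesis using U2(2) by blast
  next
    assume "\<forall>q\<in>M \<inter> ball p \<rho>. outward_at M q (\<lambda>u. - G q u)"
    then have "profile M U2 W1 (\<lambda>q. -1 * v q) R (\<lambda>q. -1 * vs q / R q) (\<lambda>q. -1 * vt q / R q)"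
      by (intro prof) auto
    then show ?thesis using U2(2) by blast
  qed
qed

text \<open>Connectedness is available for \<open>M\<close>, not for \<open>D\<close>. So
  \<open>g\<close> is replaced by a function \<open>G\<close> on all of \<open>M\<close>, the value
  of \<open>g\<close> near each point; density makes this value unique, and \<open>G\<close> is
  locally constant.\<close>

lemma constant_on_dense_subset:
  assumes M: "connected M" "D \<subseteq> M"
    and dense: "\<And>V p. p \<in> M \<Longrightarrow> open V \<Longrightarrow> p \<in> V \<Longrightarrow> \<exists>\<xi>\<in>D. \<xi> \<in> V"
    and loc: "\<And>p. p \<in> M \<Longrightarrow> \<exists>V C. open V \<and> p \<in> V \<and> (\<forall>\<xi>\<in>D. \<xi> \<in> V \<longrightarrow> g \<xi> = C)"
  shows "\<exists>C. \<forall>\<xi>\<in>D. g \<xi> = C"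
proof -
  define P where "P p C \<longleftrightarrow> (\<exists>V. open V \<and> p \<in> V \<and> (\<forall>\<xi>\<in>D. \<xi> \<in> V \<longrightarrow> g \<xi> = C))" for p C
  define G where "G p = (THE C. P p C)" for p
  have uniq: "C = C'" if p: "p \<in> M" and C: "P p C" "P p C'" for p C C'
  proof -
    obtain V V' where V: "open V" "p \<in> V" "\<And>\<xi>. \<xi> \<in> D \<Longrightarrow> \<xi> \<in> V \<Longrightarrow> g \<xi> = C"
      "open V'" "p \<in> V'" "\<And>\<xi>. \<xi> \<in> D \<Longrightarrow> \<xi> \<in> V' \<Longrightarrow> g \<xi> = C'" using C unfolding P_def by blast
    then show ?thesis using dense[OF p, of "V \<inter> V'"] by auto
  qed
  have G: "G p = C" if "p \<in> M" "P p C" for p C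
    unfolding G_def using that uniq by (intro the_equality) auto
  have "\<forall>\<^sub>F q in at p within M. G p = G q" if p: "p \<in> M" for p
  proof -
    obtain V C where V: "open V" "p \<in> V" "\<forall>\<xi>\<in>D. \<xi> \<in> V \<longrightarrow> g \<xi> = C" using loc[OF p] by blast
    then have "G q = C" if "q \<in> M" "q \<in> V" for q using that by (intro G) (auto simp: P_def)
    then show ?thesis unfolding eventually_at_topological using V p by (intro exI[of _ V]) auto
  qed
  then have "G x = G y" if "x \<in> M" "y \<in> M" for x y using connected_local_const[OF M(1) that] by blast
  moreover have "G \<xi> = g \<xi>" if "\<xi> \<in> D" for \<xi>
  proof -
    have "\<xi> \<in> M" using that M by auto
    then obtain V C where V: "open V" "\<xi> \<in> V" "\<forall>\<xi>\<in>D. \<xi> \<in> V \<longrightarrow> g \<xi> = C" using loc by blast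
    then have "P \<xi> (g \<xi>)" using that unfolding P_def by metis
    then show ?thesis using G \<open>\<xi> \<in> M\<close> by blast
  qed
  ultimately show ?thesis using M(2) by (metis subsetD)
qed

lemma exists_unit_direction:
  "\<exists>e :: 'a::euclidean_space. norm e = 1 \<and> z = norm z *\<^sub>R e"
proof (cases "z = 0")
  case True
  then show ?thesis using vector_choose_size[of 1] by auto
next
  case False
  then show ?thesis by (intro exI[of _ "z /\<^sub>R norm z"]) auto
qed

lemma fst_cyl_pos: "hz \<xi> \<noteq> 0 \<longleftrightarrow> fst (cyl \<xi>) > 0"
  by (simp add: cyl_def)

text \<open>With \<open>e\<close> the direction of \<open>hz p\<close>, or any unit vector if
  \<open>p\<close> is on the axis, \<open>(sqrt s *\<^sub>R e, t)\<close> is a continuous section of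
  \<open>cyl\<close> passing through \<open>p\<close>.\<close>

lemma cyl_open:
  fixes p :: "'n::finite heis"
  assumes "open U" "p \<in> U"
  shows "\<exists>Q. open Q \<and> cyl p \<in> Q \<and> (\<forall>q\<in>Q. fst q \<ge> 0 \<longrightarrow> (\<exists>\<xi>\<in>U. cyl \<xi> = q))"
proof -
  obtain e where e: "norm e = 1" "hz p = norm (hz p) *\<^sub>R e" using exists_unit_direction by blast
  define g where "g q = heis_point (sqrt (fst q) *\<^sub>R e) (snd q)" for q :: "real \<times> real"
  have "continuous_on UNIV g" unfolding g_def by (intro continuous_intros)
  then have "open (g -` U)" using assms by (simp add: open_vimage)
  moreover have "g (cyl p) = p" unfolding g_def cyl_def using e by (simp add: flip: e(2))
  moreover have "cyl (g q) = q" if "fst q \<ge> 0" for q using that e by (simp add: cyl_def g_def)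
  ultimately show ?thesis using assms
    by (intro exI[of _ "g -` U"] conjI ballI impI) (simp, simp, metis vimage_eq)
qed

section \<open>Constancy and critical points along the profile curve\<close>

context profile
begin

text \<open>A zero derivative along the tangent makes \<open>\<Phi>\<close> constant on each arc of
  the profile curve in \<open>s > 0\<close>. The work lies in ensuring that near \<open>p\<close>
  there is only one such arc, also when \<open>p\<close> is on the axis.\<close>

lemma locally_constant:
  assumes p: "p \<in> M" "p \<in> U"
    and \<Phi>: "\<And>\<xi>. \<xi> \<in> M \<Longrightarrow> \<xi> \<in> U \<Longrightarrow> hz \<xi> \<noteq> 0 \<Longrightarrow>
      \<exists>D. (\<Phi> has_derivative D) (at (cyl \<xi>)) \<and> D (- b (cyl \<xi>), a (cyl \<xi>)) = (0::real)"
  shows "\<exists>V C. open V \<and> p \<in> V \<and> V \<subseteq> U \<and> (\<forall>\<xi>\<in>M. \<xi> \<in> V \<longrightarrow> hz \<xi> \<noteq> 0 \<longrightarrow> \<Phi> (cyl \<xi>) = C)"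
proof -
  define q0 where "q0 = cyl p"
  have q0W: "q0 \<in> W" using cyl_W p by (simp add: q0_def)
  text \<open>On the axis the curve has to be a graph over \<open>s\<close>, so that its part in \<open>s > 0\<close> is an interval.\<close>
  define w where "w = (if hz p = 0 then (0, sgn (b q0)) else (a q0, b q0))"
  \<comment> \<open>\<open>u\<close> is the unit vector \<open>w\<close> turned by a right angle, so
    \<open>(u, w)\<close> gives orthonormal coordinates around \<open>q0\<close>; on the axis
    \<open>u\<close> points along \<open>s\<close>.\<close>
  define u where "u = (snd w, - fst w)"
  have b0: "hz p = 0 \<Longrightarrow> b q0 \<noteq> 0" using axis p by (simp add: q0_def)
  have w1: "(fst w)\<^sup>2 + (snd w)\<^sup>2 = 1"
    using unit[OF q0W] b0 by (auto simp: w_def sgn_if)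
  have wpos: "a q0 * fst w + b q0 * snd w > 0"
    using unit[OF q0W] b0 by (auto simp: w_def power2_eq_square sgn_if)
  obtain Q where Q: "open Q" "q0 \<in> Q" "\<And>q. q \<in> Q \<Longrightarrow> fst q \<ge> 0 \<Longrightarrow> \<exists>\<xi>\<in>U. cyl \<xi> = q"
    using cyl_open[OF open_U p(2)] unfolding q0_def by blast
  have cab: "continuous_on W a" "continuous_on W b"
    using diff_a diff_b by (simp_all add: continuous_at_imp_continuous_on differentiable_imp_continuous_within)
  \<comment> \<open>Intersecting with \<open>Q\<close> makes every curve point with
    \<open>s \<ge> 0\<close> the image of a point of \<open>U\<close>, where the hypothesis on
    \<open>\<Phi>\<close> applies. If \<open>p\<close> is off the axis, the last factor keeps the
    curve in \<open>s > 0\<close>.\<close>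
  define W' where "W' = (W \<inter> (\<lambda>q. a q * fst w + b q * snd w) -` {0<..}) \<inter> Q \<inter>
    (if hz p = 0 then UNIV else fst -` {0<..})"
  have "continuous_on W (\<lambda>q. a q * fst w + b q * snd w)" by (intro continuous_intros cab)
  then have "open (W \<inter> (\<lambda>q. a q * fst w + b q * snd w) -` {0<..})"
    using open_W by (intro continuous_open_preimage) auto
  then have "open W'" unfolding W'_def using Q(1) by (auto intro!: open_Int open_vimage_fst)
  moreover have "q0 \<in> W'" using q0W wpos Q by (auto simp: W'_def q0_def cyl_def)
  moreover have "v q0 = 0" using mem_iff p by (simp add: q0_def)
  ultimately obtain \<delta> \<epsilon> \<tau> where \<delta>: "\<delta> > 0" "\<epsilon> > 0" and
    \<tau>: "\<And>s. \<bar>s\<bar> < \<delta> \<Longrightarrow> \<bar>\<tau> s\<bar> < \<epsilon> \<and> \<tau> differentiable (at s) \<and>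
     (\<forall>h. \<bar>h\<bar> < \<epsilon> \<longrightarrow> q0 + s *\<^sub>R u + h *\<^sub>R w \<in> W' \<and> (v (q0 + s *\<^sub>R u + h *\<^sub>R w) = 0 \<longleftrightarrow> h = \<tau> s))"
    using implicit_curve[of W' q0 v "\<lambda>q h. r q * (a q * fst h + b q * snd h)" w u]
      has_derivative_v r_pos unfolding W'_def by auto
  define \<gamma> where "\<gamma> s = q0 + s *\<^sub>R u + \<tau> s *\<^sub>R w" for s
  have \<gamma>: "\<gamma> s \<in> W'" "v (\<gamma> s) = 0" if "\<bar>s\<bar> < \<delta>" for s using \<tau>[OF that] by (auto simp: \<gamma>_def)
  define I where "I = {s. \<bar>s\<bar> < \<delta> \<and> fst (\<gamma> s) > 0}"
  have "convex I"
  proof (cases "hz p = 0")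
    case False
    then have "I = {- \<delta><..<\<delta>}" using \<gamma>(1) by (force simp: I_def W'_def)
    then show ?thesis by simp
  next
    case True
    then have "fst (\<gamma> s) = s * sgn (b q0)" for s by (simp add: \<gamma>_def u_def w_def q0_def cyl_def)
    then have "I = {- \<delta><..<\<delta>} \<inter> (if b q0 > 0 then {0<..} else {..<0})"
      using b0[OF True] by (auto simp: I_def sgn_if)
    then show ?thesis by (auto intro: convex_Int)
  qed
  moreover have "((\<lambda>s. \<Phi> (\<gamma> s)) has_derivative (\<lambda>h. 0)) (at s within I)" if s: "s \<in> I" for s
  proof -
    have s': "\<bar>s\<bar> < \<delta>" "fst (\<gamma> s) > 0" using s by (auto simp: I_def)
    obtain \<xi> where \<xi>: "\<xi> \<in> U" "cyl \<xi> = \<gamma> s" using Q(3)[of "\<gamma> s"] \<gamma>(1)[OF s'(1)] s'(2) by (auto simp: W'_def)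
    have \<xi>': "\<xi> \<in> M" "hz \<xi> \<noteq> 0" 
      using \<xi> mem_iff[OF \<xi>(1)] \<gamma>(2)[OF s'(1)] s'(2) by (simp_all add: fst_cyl_pos)
    obtain D where D: "(\<Phi> has_derivative D) (at (\<gamma> s))" "D (- b (\<gamma> s), a (\<gamma> s)) = 0"
      using \<Phi>[OF \<xi>'(1) \<xi>(1) \<xi>'(2)] \<xi>(2) by auto
    obtain \<tau>' where t: "(\<tau> has_derivative (\<lambda>h. \<tau>' * h)) (at s)"
      using \<tau>[OF s'(1)] by (auto simp: real_differentiable_def has_field_derivative_def)
    have dg: "(\<gamma> has_derivative (\<lambda>h. h *\<^sub>R (u + \<tau>' *\<^sub>R w))) (at s)"
      unfolding \<gamma>_def by (auto intro!: derivative_eq_intros t simp: fun_eq_iff algebra_simps)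
    define g1 g2 where g12: "g1 = fst (u + \<tau>' *\<^sub>R w)" "g2 = snd (u + \<tau>' *\<^sub>R w)"
    have sW: "\<gamma> s \<in> W" using \<gamma>(1)[OF s'(1)] by (simp add: W'_def)
    have "((\<lambda>s. v (\<gamma> s)) has_derivative (\<lambda>h. r (\<gamma> s) * (a (\<gamma> s) * (h * g1) + b (\<gamma> s) * (h * g2)))) (at s)"
      using has_derivative_compose[OF dg has_derivative_v[OF sW]] by (simp add: g12)
    then have "((\<lambda>s. 0) has_derivative (\<lambda>h. r (\<gamma> s) * (a (\<gamma> s) * (h * g1) + b (\<gamma> s) * (h * g2)))) (at s)"
      by (rule has_derivative_transform_within_open[of _ _ _ _ "{- \<delta><..<\<delta>}"]) (use s' \<gamma>(2) in auto)
    then have "(\<lambda>h. r (\<gamma> s) * (a (\<gamma> s) * (h * g1) + b (\<gamma> s) * (h * g2))) = (\<lambda>h. 0)"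
      using has_derivative_unique has_derivative_const by blast
    from fun_cong[OF this, of 1] have o: "a (\<gamma> s) * g1 + b (\<gamma> s) * g2 = 0" using r_pos[OF sW] by simp
    \<comment> \<open>The velocity \<open>(g1, g2)\<close> is orthogonal to the unit normal
      \<open>(a, b)\<close>, hence \<open>k\<close> times the unit tangent.\<close>
    define k where "k = a (\<gamma> s) * g2 - b (\<gamma> s) * g1"
    have "g1 = ((a (\<gamma> s))\<^sup>2 + (b (\<gamma> s))\<^sup>2) * g1" by (simp add: unit[OF sW])
    also have "\<dots> = a (\<gamma> s) * (a (\<gamma> s) * g1 + b (\<gamma> s) * g2) - b (\<gamma> s) * k"
      by (simp add: k_def algebra_simps power2_eq_square)
    finally have 1: "g1 = k * - b (\<gamma> s)" by (simp add: o)
    have "g2 = ((a (\<gamma> s))\<^sup>2 + (b (\<gamma> s))\<^sup>2) * g2" by (simp add: unit[OF sW])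
    also have "\<dots> = b (\<gamma> s) * (a (\<gamma> s) * g1 + b (\<gamma> s) * g2) + a (\<gamma> s) * k"
      by (simp add: k_def algebra_simps power2_eq_square)
    finally have 2: "g2 = k * a (\<gamma> s)" by (simp add: o)
    have gk: "u + \<tau>' *\<^sub>R w = k *\<^sub>R (- b (\<gamma> s), a (\<gamma> s))"
      using 1 2 by (simp add: g12 prod_eq_iff)
    interpret D: bounded_linear D using D(1) by (rule has_derivative_bounded_linear)
    have "((\<lambda>s. \<Phi> (\<gamma> s)) has_derivative (\<lambda>h. D (h *\<^sub>R (u + \<tau>' *\<^sub>R w)))) (at s)"
      by (rule has_derivative_compose[OF dg D(1)])
    then show ?thesis by (simp add: gk D.scaleR D(2) has_derivative_at_withinI del: scaleR_Pair)
  qed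
  ultimately obtain C where C: "\<And>s. s \<in> I \<Longrightarrow> \<Phi> (\<gamma> s) = C"
    using has_derivative_zero_constant[of I "\<lambda>s. \<Phi> (\<gamma> s)"] by blast
  define \<sigma> where "\<sigma> \<xi> = (cyl \<xi> - q0) \<bullet> u" for \<xi> :: "'n heis"
  define \<eta> where "\<eta> \<xi> = (cyl \<xi> - q0) \<bullet> w" for \<xi> :: "'n heis"
  have coords: "cyl \<xi> = q0 + \<sigma> \<xi> *\<^sub>R u + \<eta> \<xi> *\<^sub>R w" for \<xi>
  proof -
    define d where "d = cyl \<xi> - q0"
    have "(d \<bullet> u) *\<^sub>R u + (d \<bullet> w) *\<^sub>R w = ((fst w)\<^sup>2 + (snd w)\<^sup>2) *\<^sub>R d"
      by (simp add: u_def prod_eq_iff inner_prod_def algebra_simps power2_eq_square)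
    then show ?thesis by (simp add: w1 d_def \<sigma>_def \<eta>_def algebra_simps)
  qed
  define V where "V = U \<inter> ((\<lambda>\<xi>. \<bar>\<sigma> \<xi>\<bar>) -` {..<\<delta>} \<inter> (\<lambda>\<xi>. \<bar>\<eta> \<xi>\<bar>) -` {..<\<epsilon>})"
  have "open V" unfolding V_def \<sigma>_def \<eta>_def
    by (intro open_Int open_U open_vimage continuous_intros open_lessThan)
  moreover have "p \<in> V" using p \<delta> by (simp add: V_def \<sigma>_def \<eta>_def q0_def)
  moreover have "\<Phi> (cyl \<xi>) = C" if "\<xi> \<in> M" "\<xi> \<in> V" "hz \<xi> \<noteq> 0" for \<xi>
  proof -
    have d: "\<bar>\<sigma> \<xi>\<bar> < \<delta>" "\<bar>\<eta> \<xi>\<bar> < \<epsilon>" "\<xi> \<in> U" using that by (auto simp: V_def)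
    have "v (cyl \<xi>) = 0" using mem_iff[OF d(3)] that by simp
    then have "\<eta> \<xi> = \<tau> (\<sigma> \<xi>)" using \<tau>[OF d(1)] d(2) coords by metis
    then have "cyl \<xi> = \<gamma> (\<sigma> \<xi>)" using coords by (simp add: \<gamma>_def)
    moreover from this have "\<sigma> \<xi> \<in> I" using d that(3) unfolding I_def fst_cyl_pos by simp
    ultimately show ?thesis using C by simp
  qed
  ultimately show ?thesis by (intro exI[of _ V] exI[of _ C]) (auto simp: V_def)
qed

text \<open>Off the axis \<open>cyl\<close> is a submersion, so the unit tangent of the profile is
  the image of a vector tangent to \<open>M\<close>. A curve in \<open>M\<close> with this velocity
  reduces the claim to a maximum in one variable.\<close>

lemma critical_point:
  assumes p: "p \<in> M" "p \<in> U" "hz p \<noteq> 0" and D: "(\<Phi> has_derivative D) (at (cyl p))"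
    and max: "\<And>\<xi>. \<xi> \<in> M \<Longrightarrow> \<xi> \<in> U \<Longrightarrow> \<Phi> (cyl \<xi>) \<le> (\<Phi> (cyl p) :: real)"
  shows "D (- b (cyl p), a (cyl p)) = 0"
proof -
  define u where "u = heis_point ((- b (cyl p) / (2 * (norm (hz p))\<^sup>2)) *\<^sub>R hz p) (a (cyl p))"
  have cu: "2 * (hz p \<bullet> hz u) = - b (cyl p)" using p(3) by (simp add: u_def power2_norm_eq_inner)
  then have "u \<in> tangent_space M p" using p by (simp add: tangent_space_eq conormal_def) (simp add: u_def)
  then obtain \<gamma> \<epsilon> where g: "\<epsilon> > 0" "\<gamma> 0 = p" "\<And>s. \<bar>s\<bar> < \<epsilon> \<Longrightarrow> \<gamma> s \<in> M"
    "(\<gamma> has_vector_derivative u) (at (0::real))" by (auto simp: tangent_space_def)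
  have "isCont \<gamma> 0" using g(4) has_vector_derivative_continuous by blast
  then have "\<forall>\<^sub>F s in nhds 0. \<gamma> s \<in> U"
    using open_U p(2) g(2) unfolding continuous_at_open eventually_nhds by metis
  then obtain e where e: "e > 0" "\<And>s. \<bar>s\<bar> < e \<Longrightarrow> \<gamma> s \<in> U" unfolding eventually_nhds_metric by (auto simp: dist_norm)
  interpret bounded_linear D using D by (rule has_derivative_bounded_linear)
  have "((\<lambda>s. cyl (\<gamma> s)) has_derivative (\<lambda>h. (2 * (hz p \<bullet> hz (h *\<^sub>R u)), ht (h *\<^sub>R u)))) (at 0)"
    using has_derivative_compose[OF g(4)[unfolded has_vector_derivative_def] has_derivative_cyl] g(2) by simp
  then have "((\<lambda>s. cyl (\<gamma> s)) has_derivative (\<lambda>h. h *\<^sub>R (- b (cyl p), a (cyl p)))) (at 0)"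
  proof (rule has_derivative_eq_rhs)
    have "2 * (hz p \<bullet> (h *\<^sub>R hz u)) = h * - b (cyl p)" for h
      unfolding cu[symmetric] by simp
    then show "(\<lambda>h. (2 * (hz p \<bullet> hz (h *\<^sub>R u)), ht (h *\<^sub>R u))) = (\<lambda>h. h *\<^sub>R (- b (cyl p), a (cyl p)))"
      by (simp add: fun_eq_iff) (simp add: u_def)
  qed
  from has_derivative_compose[OF this] D g(2)
  have "((\<lambda>s. \<Phi> (cyl (\<gamma> s))) has_derivative (\<lambda>h. D (h *\<^sub>R (- b (cyl p), a (cyl p))))) (at 0)" by simp
  then have "((\<lambda>s. \<Phi> (cyl (\<gamma> s))) has_real_derivative D (- b (cyl p), a (cyl p))) (at 0)"
    by (simp add: scaleR has_field_derivative_def mult_commute_abs del: scaleR_Pair)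
  then show ?thesis
    by (rule DERIV_local_max[where d = "min e \<epsilon>"]) (use e g max in auto)
qed

end

section \<open>Gauge spheres\<close>

text \<open>For a centre on the axis the group law has no cross term, so the translation merely
  shifts \<open>t\<close>; the radius \<open>sqrt \<rho>\<close> has fourth power
  \<open>\<rho>\<^sup>2\<close>.\<close>

lemma gauge_ball_axis:
  fixes t0 :: real
  assumes "\<rho> > 0"
  shows "gauge_ball (0, 0, t0) (sqrt \<rho>) = {\<xi> :: 'n::finite heis. (norm (hz \<xi>)) ^ 4 + (ht \<xi> - t0)\<^sup>2 < \<rho>\<^sup>2}"
proof -
  have "gauge (heis_mult (heis_inv (0, 0, t0)) \<xi>) < sqrt \<rho> \<longleftrightarrow> (norm (hz \<xi>)) ^ 4 + (ht \<xi> - t0)\<^sup>2 < \<rho>\<^sup>2" for \<xi> :: "'n heis"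
  proof -
    obtain x y t where \<xi>: "\<xi> = (x, y, t)" by (cases \<xi>)
    have n: "(norm (hz \<xi>)) ^ 4 = ((norm x)\<^sup>2 + (norm y)\<^sup>2)\<^sup>2"
      using power_mult[of "norm (hz \<xi>)" 2 2] by (simp add: \<xi> hz_def norm_prod_def)
    have "sqrt \<rho> = root 4 (\<rho>\<^sup>2)"
      using assms by (intro real_root_pos_unique[symmetric]) (simp_all add: power4_eq_xxxx power2_eq_square flip: mult.assoc)
    then show ?thesis unfolding n by (simp add: \<xi> ht_def power2_commute algebra_simps)
  qed
  then show ?thesis by (simp add: gauge_ball_def)
qed

lemma frontier_axial_ball:
  assumes "\<rho> > 0"
  shows "frontier {\<xi> :: 'n::finite heis. (norm (hz \<xi>)) ^ 4 + (ht \<xi> - t0)\<^sup>2 < \<rho>} =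
    {\<xi>. (norm (hz \<xi>)) ^ 4 + (ht \<xi> - t0)\<^sup>2 = \<rho>}" (is "frontier ?B = ?S")
proof -
  have c: "continuous_on UNIV (\<lambda>\<xi> :: 'n heis. (norm (hz \<xi>)) ^ 4 + (ht \<xi> - t0)\<^sup>2)"
    by (intro continuous_intros continuous_on_id)
  have op: "open ?B" by (rule open_Collect_less[OF c]) (intro continuous_intros)
  have "closed {\<xi> :: 'n heis. (norm (hz \<xi>)) ^ 4 + (ht \<xi> - t0)\<^sup>2 \<le> \<rho>}"
    by (rule closed_Collect_le[OF c]) (intro continuous_intros)
  then have le: "closure ?B \<subseteq> {\<xi>. (norm (hz \<xi>)) ^ 4 + (ht \<xi> - t0)\<^sup>2 \<le> \<rho>}"
    by (intro closure_minimal) auto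
  have ge: "\<xi> \<in> closure ?B" if \<xi>: "\<xi> \<in> ?S" for \<xi>
  proof -
    \<comment> \<open>Linear contraction towards the centre. As
      \<open>l ^ 4 \<le> l\<^sup>2\<close>, it multiplies the defining expression by at most
      \<open>l\<^sup>2 < 1\<close>, so the sphere is approached from within the ball.\<close>
    define g where "g l = heis_point (l *\<^sub>R hz \<xi>) (t0 + l * (ht \<xi> - t0))" for l
    have "g l \<in> ?B" if l: "0 \<le> l" "l < 1" for l
    proof -
      have l2: "l ^ 2 < 1" using l by (simp add: power_less_one_iff)
      then have "l ^ 2 * l ^ 2 \<le> l ^ 2 * 1" by (intro mult_left_mono) auto
      then have "l ^ 4 \<le> l\<^sup>2" by (simp flip: power_add)
      then have "l ^ 4 * norm (hz \<xi>) ^ 4 + l\<^sup>2 * (ht \<xi> - t0)\<^sup>2 \<le> l\<^sup>2 * (norm (hz \<xi>) ^ 4 + (ht \<xi> - t0)\<^sup>2)"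
        by (simp add: distrib_left mult_right_mono)
      also have "\<dots> < \<rho>" using \<xi> assms l2 by simp
      finally show ?thesis using l by (simp add: g_def power_mult_distrib)
    qed
    then have "g ` {0<..<1} \<subseteq> ?B" by (intro image_subsetI) auto
    then have "g ` {0<..<1} \<subseteq> closure ?B" using closure_subset by (rule order_trans)
    moreover have "continuous_on {0..1} g" unfolding g_def by (intro continuous_intros)
    ultimately have "g ` closure {0<..<1} \<subseteq> closure ?B"
      by (intro image_closure_subset) auto
    then have "g 1 \<in> closure ?B" by auto
    then show ?thesis by (simp add: g_def)
  qed
  show ?thesis
  proof (intro equalityI subsetI)
    fix \<xi> assume "\<xi> \<in> frontier ?B"
    then have "\<xi> \<in> closure ?B" "\<xi> \<notin> ?B" using op by (auto simp: frontier_def interior_open)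
    then show "\<xi> \<in> ?S" using le by force
  next
    fix \<xi> assume s: "\<xi> \<in> ?S"
    then have "\<xi> \<notin> ?B" by simp
    then show "\<xi> \<in> frontier ?B" using ge[OF s] op by (simp add: frontier_def interior_open)
  qed
qed

text \<open>If a point \<open>q\<close> of the sphere were missing from \<open>M\<close>, a point of
  the ball could run to the centre and escape to infinity through \<open>q\<close>; any other point
  off \<open>M\<close> escapes along its own ray. Nothing would then be inside
  \<open>M\<close>.\<close>

lemma sphere_filled:
  fixes M :: "'n::finite heis set"
  assumes M: "M \<subseteq> {\<xi>. (norm (hz \<xi>)) ^ 4 + (ht \<xi> - t0)\<^sup>2 = \<rho>}" (is "_ \<subseteq> ?S") and "\<rho> > 0" and ne: "inside M \<noteq> {}"
  shows "M = ?S"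
proof (rule ccontr)
  assume "M \<noteq> ?S"
  then obtain q where q: "q \<in> ?S" "q \<notin> M" using M by blast
  define \<phi> where "\<phi> \<xi> = (norm (hz \<xi>)) ^ 4 + (ht \<xi> - t0)\<^sup>2" for \<xi> :: "'n heis"
  define g where "g x l = heis_point (l *\<^sub>R hz x) (t0 + l * (ht x - t0))" for x :: "'n heis" and l
  have \<phi>g: "\<phi> (g x l) = l ^ 4 * norm (hz x) ^ 4 + l\<^sup>2 * (ht x - t0)\<^sup>2" if "l \<ge> 0" for x l
    using that by (simp add: g_def \<phi>_def power_mult_distrib)
  have g1: "g x 1 = x" for x by (simp add: g_def)
  have cg: "continuous_on S (g x)" for S x unfolding g_def by (intro continuous_intros)
  have nM: "x \<notin> M" if "\<phi> x \<noteq> \<rho>" for x using M that by (auto simp: \<phi>_def)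
  have big: "\<phi> (g x l) > \<rho>" if l: "l > 1" and x: "\<phi> x \<ge> \<rho>" for x l
  proof -
    have l2: "l ^ 2 > 1" using l by (simp add: one_less_power)
    then have "l ^ 2 * l ^ 2 \<ge> l ^ 2 * 1" by (intro mult_left_mono) auto
    then have "l ^ 4 \<ge> l\<^sup>2" by (simp flip: power_add)
    then have "l ^ 4 * norm (hz x) ^ 4 + l\<^sup>2 * (ht x - t0)\<^sup>2 \<ge> l\<^sup>2 * \<phi> x"
      by (simp add: \<phi>_def distrib_left mult_right_mono)
    moreover have "l\<^sup>2 * \<phi> x > 1 * \<phi> x" using l2 x \<open>\<rho> > 0\<close> by (intro mult_strict_right_mono) auto
    ultimately show ?thesis using x l by (simp add: \<phi>g)
  qed
  have small: "\<phi> (g x l) < \<rho>" if l: "0 \<le> l" "l < 1" and x: "\<phi> x \<le> \<rho>" for x l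
  proof -
    have l2: "l ^ 2 < 1" using l by (simp add: power_less_one_iff)
    then have "l ^ 2 * l ^ 2 \<le> l ^ 2 * 1" by (intro mult_left_mono) auto
    then have "l ^ 4 \<le> l\<^sup>2" by (simp flip: power_add)
    then have "l ^ 4 * norm (hz x) ^ 4 + l\<^sup>2 * (ht x - t0)\<^sup>2 \<le> l\<^sup>2 * \<phi> x"
      by (simp add: \<phi>_def distrib_left mult_right_mono)
    also have "\<dots> \<le> l\<^sup>2 * \<rho>" using x by (intro mult_left_mono) auto
    also have "\<dots> < \<rho>" using l2 \<open>\<rho> > 0\<close> by simp
    finally show ?thesis using l by (simp add: \<phi>g)
  qed
  have unb: "\<not> bounded (g x ` {1..})" if "\<phi> x \<ge> \<rho>" for x
  proof
    assume "bounded (g x ` {1..})"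
    then obtain B where B: "\<And>l. l \<ge> 1 \<Longrightarrow> norm (g x l) \<le> B" unfolding bounded_iff by auto
    define y where "y = heis_point (hz x) (ht x - t0)"
    have gy: "g x l = heis_point 0 t0 + l *\<^sub>R y" for l by (intro heis_eqI) (simp_all add: g_def y_def)
    have "y \<noteq> 0"
    proof
      assume "y = 0"
      then have "hz y = 0" "ht y = 0" by simp_all
      then have "\<phi> x = 0" by (simp add: y_def \<phi>_def)
      then show False using that \<open>\<rho> > 0\<close> by simp
    qed
    \<comment> \<open>Large enough that \<open>l * norm y\<close> exceeds the supposed bound
      \<open>B\<close> plus the norm of the centre.\<close>
    define l where "l = 1 + (\<bar>B\<bar> + norm (heis_point 0 t0 :: 'n heis) + 1) / norm y"
    have l: "l \<ge> 1" using \<open>y \<noteq> 0\<close> by (simp add: l_def)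
    have "l * norm y = norm y + (\<bar>B\<bar> + norm (heis_point 0 t0 :: 'n heis) + 1)"
      using \<open>y \<noteq> 0\<close> by (simp add: l_def field_simps)
    moreover have "norm (l *\<^sub>R y) \<le> norm (g x l) + norm (heis_point 0 t0 :: 'n heis)"
      using norm_triangle_ineq4[of "g x l" "heis_point 0 t0"] by (simp add: gy)
    moreover have "norm (l *\<^sub>R y) = l * norm y" using l by simp
    moreover have "norm y \<ge> 0" by simp
    ultimately show False using B[OF l] by linarith
  qed
  have out: "x \<in> outside M" if x: "x \<notin> M" for x
  proof (cases "\<phi> x \<ge> \<rho>")
    case True
    have "g x l \<notin> M" if "l \<ge> 1" for l
      using big[of l x] nM[of "g x l"] that True x g1 by (cases "l = 1") auto
    then have "g x ` {1..} \<inter> M = {}" by auto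
    moreover have "connected (g x ` {1..})" by (intro connected_continuous_image cg) auto
    ultimately have "g x ` {1..} \<subseteq> outside M" using unb[OF True] by (intro unbounded_connected_subset_outside) auto
    then show ?thesis using g1[of x] by force
  next
    case False
    have q': "\<phi> q = \<rho>" using q by (simp add: \<phi>_def)
    have 1: "g x l \<notin> M" if "0 \<le> l" "l \<le> 1" for l
      using small[of l x] nM[of "g x l"] that False x g1 by (cases "l = 1") auto
    have 2: "g q l \<notin> M" if "0 \<le> l" for l
      using small[of l q] big[of l q] nM[of "g q l"] that q' q(2) g1 by (cases l "1::real" rule: linorder_cases) auto
    let ?T = "g x ` {0..1} \<union> g q ` {0..}"
    have "g x 0 = g q 0" by (simp add: g_def)
    then have "g x ` {0..1} \<inter> g q ` {0..} \<noteq> {}" by force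
    then have "connected ?T"
      by (intro connected_Un connected_continuous_image cg) auto
    moreover have "?T \<inter> M = {}" using 1 2 by auto
    moreover have "\<not> bounded ?T" using unb[of q] q' bounded_subset[of ?T "g q ` {1..}"] by force
    ultimately have "?T \<subseteq> outside M" by (intro unbounded_connected_subset_outside)
    moreover have "x \<in> ?T" using imageI[of 1 "{0..1}" "g x"] g1[of x] by simp
    ultimately show ?thesis by blast
  qed
  obtain x where "x \<in> inside M" using ne by blast
  moreover from this have "x \<notin> M" using inside_no_overlap by blast
  ultimately show False using out inside_Int_outside by blast
qed

section \<open>Classification\<close>

locale symmetric_hypersurface =
  fixes M :: "'n::finite heis set" and \<nu> :: "'n heis \<Rightarrow> 'n heis" and c :: real
  assumes nonempty: "M \<noteq> {}" and conn: "connected M" and comp: "compact M"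
    and normal: "outward_unit_normal M \<nu>" and sym: "cylindrically_symmetric M" and c: "c \<noteq> 0"
    and curv: "\<And>x y t. (x, y, t) \<in> M - characteristic_set M \<Longrightarrow>
           horizontal_mean_curvature M \<nu> (x, y, t) = c * sqrt ((norm x)\<^sup>2 + (norm y)\<^sup>2)"
begin

definition m :: real where "m = real CARD('n) - 1/2"

definition k :: real where "k = m * c / (m + 1)"

text \<open>\<open>nA\<close> and \<open>nB\<close> recover the components \<open>a\<close> and
  \<open>b\<close> of the profile normal from \<nu> alone, so they agree across different local
  profiles. They are meaningful off the axis only.\<close>

definition nA :: "'n heis \<Rightarrow> real" where
  "nA \<xi> = hz (horizontal_normal \<nu> \<xi>) \<bullet> hz \<xi> / norm (hz \<xi>)"

definition nB :: "'n heis \<Rightarrow> real" where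
  "nB \<xi> = hz (horizontal_normal \<nu> \<xi>) \<bullet> Jrot (hz \<xi>) / norm (hz \<xi>)"

lemma m_pos: "m > 0"
proof -
  have "real CARD('n) \<ge> 1" by (simp add: Suc_leI)
  then show ?thesis unfolding m_def by linarith
qed

lemma k_m: "(m + 1) * k = m * c" and k_nz: "k \<noteq> 0"
  using m_pos c by (simp_all add: k_def)

lemma exists_profile:
  assumes "p \<in> M"
  obtains U W v r a b where "p \<in> U" "profile M U W v r a b"
  using profile_exists[OF sym assms normal] by blast

lemma normal_components:
  assumes "profile M U W v r a b" "\<xi> \<in> M" "\<xi> \<in> U" "hz \<xi> \<noteq> 0"
  shows "nA \<xi> = a (cyl \<xi>)" "nB \<xi> = b (cyl \<xi>)"
proof -
  interpret profile M U W v r a b by fact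
  show "nA \<xi> = a (cyl \<xi>)" "nB \<xi> = b (cyl \<xi>)"
    unfolding nA_def nB_def horizontal_normal_eq[OF normal assms(2-)]
    using assms(4) by (simp_all add: inner_simps field_simps flip: power2_norm_eq_inner power2_eq_square)
qed

lemma normal_unit:
  assumes "\<xi> \<in> M" "hz \<xi> \<noteq> 0"
  shows "(nA \<xi>)\<^sup>2 + (nB \<xi>)\<^sup>2 = 1"
proof -
  obtain U W v r a b where p: "\<xi> \<in> U" "profile M U W v r a b" using exists_profile assms by blast
  interpret profile M U W v r a b by (rule p(2))
  show ?thesis using normal_components[OF p(2) assms(1) p(1) assms(2)] unit[OF cyl_W[OF p(1)]] by simp
qed

text \<open>At an axis point the conormal is a multiple of the differential of \<open>t\<close>, so
  \<open>(e, 0)\<close> is tangent to \<open>M\<close> for a unit vector \<open>e\<close>. A curve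
  in \<open>M\<close> with that velocity cannot remain on the axis.\<close>

lemma off_axis_dense:
  assumes "p \<in> M" "open V" "p \<in> V"
  shows "\<exists>\<xi>\<in>{\<xi>\<in>M. hz \<xi> \<noteq> 0}. \<xi> \<in> V"
proof (cases "hz p = 0")
  case True
  obtain U W v r a b where p: "p \<in> U" "profile M U W v r a b" using exists_profile assms by blast
  interpret profile M U W v r a b by (rule p(2))
  obtain e :: "(real, 'n) vec \<times> (real, 'n) vec" where e: "norm e = 1"
    using vector_choose_size[of 1] by (metis zero_le_one)
  have "heis_point e 0 \<in> tangent_space M p" using True by (simp add: tangent_space_eq assms p conormal_def)
  then obtain \<gamma> \<epsilon> where g: "\<epsilon> > 0" "\<gamma> 0 = p" "\<And>s. \<bar>s\<bar> < \<epsilon> \<Longrightarrow> \<gamma> s \<in> M"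
    "(\<gamma> has_vector_derivative heis_point e 0) (at (0::real))" by (auto simp: tangent_space_def)
  have "isCont \<gamma> 0" using g(4) has_vector_derivative_continuous by blast
  then have "\<forall>\<^sub>F s in nhds 0. \<gamma> s \<in> V"
    using assms(2,3) g(2) unfolding continuous_at_open eventually_nhds by metis
  then obtain d where d: "d > 0" "\<And>s. \<bar>s\<bar> < d \<Longrightarrow> \<gamma> s \<in> V" unfolding eventually_nhds_metric by (auto simp: dist_norm)
  show ?thesis
  proof (rule ccontr)
    assume "\<not> ?thesis"
    then have z: "hz (\<gamma> s) = 0" if "\<bar>s\<bar> < min d \<epsilon>" for s
    proof -
      have "\<gamma> s \<in> V" "\<gamma> s \<in> M" using d(2)[of s] g(3)[of s] that by simp_all
      then show ?thesis using \<open>\<not> (\<exists>\<xi>\<in>{\<xi>\<in>M. hz \<xi> \<noteq> 0}. \<xi> \<in> V)\<close> by blast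
    qed
    have "((\<lambda>s. hz (\<gamma> s)) has_vector_derivative e) (at 0)"
      using bounded_linear.has_vector_derivative[OF bounded_linear_hz g(4)] by simp
    then have "((\<lambda>s. 0) has_vector_derivative e) (at 0)"
      unfolding has_vector_derivative_def
      by (rule has_derivative_transform_within_open[of _ _ _ _ "ball 0 (min d \<epsilon>)"]) (use z d g in auto)
    then have "e = 0" using vector_derivative_unique_at has_vector_derivative_const by blast
    then show False using e by simp
  qed
qed (use assms in blast)

lemma profile_ode:
  assumes "profile M U W v r a b" "\<xi> \<in> M" "\<xi> \<in> U" "hz \<xi> \<noteq> 0"
  obtains a' b' \<kappa> where "(a has_derivative a') (at (cyl \<xi>))" "(b has_derivative b') (at (cyl \<xi>))"
     "a' (- b (cyl \<xi>), a (cyl \<xi>)) = - \<kappa> * b (cyl \<xi>)" "b' (- b (cyl \<xi>), a (cyl \<xi>)) = \<kappa> * a (cyl \<xi>)"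
     "fst (cyl \<xi>) * \<kappa> = m * (c * fst (cyl \<xi>) - a (cyl \<xi>))"
  using profile.curvature_ode[OF assms(1) normal assms(2-4) curv refl] unfolding m_def by blast

lemma meets_axis: "\<exists>p\<in>M. hz p = 0"
proof (rule ccontr)
  assume "\<not> ?thesis"
  then have off: "\<And>\<xi>. \<xi> \<in> M \<Longrightarrow> hz \<xi> \<noteq> 0" by blast
  have cs: "continuous_on M (\<lambda>\<xi>. (norm (hz \<xi>))\<^sup>2)" by (intro continuous_intros continuous_on_id)
  obtain p1 where p1: "p1 \<in> M" "\<And>\<xi>. \<xi> \<in> M \<Longrightarrow> (norm (hz p1))\<^sup>2 \<le> (norm (hz \<xi>))\<^sup>2"
    using continuous_attains_inf[OF comp nonempty cs] by blast
  obtain p2 where p2: "p2 \<in> M" "\<And>\<xi>. \<xi> \<in> M \<Longrightarrow> (norm (hz \<xi>))\<^sup>2 \<le> (norm (hz p2))\<^sup>2"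
    using continuous_attains_sup[OF comp nonempty cs] by blast
  define s1 s2 where s12: "s1 = (norm (hz p1))\<^sup>2" "s2 = (norm (hz p2))\<^sup>2"
  have s1: "s1 > 0" using off[OF p1(1)] by (simp add: s12)
  have s2: "s2 > 0" using off[OF p2(1)] by (simp add: s12)
  have c2: "c\<^sup>2 > 0" using c by simp
  \<comment> \<open>The loss caused by the correction will be at most
    \<open>\<alpha>\<^sup>2 / s\<close> times \<open>2 * c\<^sup>2 * s + 1 / (2 * s)\<close>;
    \<open>L\<close> bounds this factor for \<open>s1 \<le> s \<le> s2\<close>.\<close>
  define L where "L = 2 * c\<^sup>2 * s2 + 1 / (2 * s1)"
  have L: "L > 0" unfolding L_def using s1 s2 c2 by (intro add_pos_pos mult_pos_pos divide_pos_pos) auto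
  define e where "e = 1 / (m * L)"
  have em: "e * m = 1 / L" using m_pos by (simp add: e_def)
  define Ft where "Ft \<xi> = c * ht \<xi> - nB \<xi> / m - e * c * (nA \<xi> * nB \<xi>)" for \<xi>
  have Ft: "Ft \<xi> = c * snd (cyl \<xi>) - b (cyl \<xi>) / m - e * c * (a (cyl \<xi>) * b (cyl \<xi>))"
    if "profile M U W v r a b" "\<xi> \<in> M" "\<xi> \<in> U" for \<xi> U W v r a b
    using normal_components[OF that off[OF that(2)]] by (simp add: Ft_def cyl_def)
  have "continuous_on M Ft"
    unfolding continuous_on_eq_continuous_within
  proof
    fix p assume p: "p \<in> M"
    obtain U W v r a b where U: "p \<in> U" and pr: "profile M U W v r a b" using exists_profile p by blast
    interpret profile M U W v r a b by (rule pr)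
    let ?G = "\<lambda>\<xi>. c * snd (cyl \<xi>) - b (cyl \<xi>) / m - e * c * (a (cyl \<xi>) * b (cyl \<xi>))"
    have "continuous_on W a" "continuous_on W b"
      using diff_a diff_b by (simp_all add: continuous_at_imp_continuous_on differentiable_imp_continuous_within)
    then have "continuous_on U (\<lambda>\<xi>. a (cyl \<xi>))" "continuous_on U (\<lambda>\<xi>. b (cyl \<xi>))"
      by (auto intro: continuous_on_compose2 continuous_on_cyl cyl_W)
    then have "continuous_on U ?G" using m_pos by (intro continuous_intros) auto
    then have "isCont ?G p" using open_U U by (simp add: continuous_on_eq_continuous_at)
    then have "continuous (at p within M) ?G" by (rule continuous_at_imp_continuous_at_within)
    moreover obtain d where d: "d > 0" "ball p d \<subseteq> U" using open_U U openE by blast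
    ultimately show "continuous (at p within M) Ft"
      using Ft[OF pr] by (elim continuous_transform_within[OF _ d(1) p]) (use d in \<open>auto simp: dist_commute subset_iff\<close>)
  qed
  then obtain p where p: "p \<in> M" and max: "\<And>\<xi>. \<xi> \<in> M \<Longrightarrow> Ft \<xi> \<le> Ft p"
    using continuous_attains_sup[OF comp nonempty] by blast
  obtain U W v r a b where U: "p \<in> U" and pr: "profile M U W v r a b" using exists_profile p by blast
  interpret profile M U W v r a b by (rule pr)
  define q where "q = cyl p"
  obtain a' b' \<kappa> where ab: "(a has_derivative a') (at q)" "(b has_derivative b') (at q)"
    and ode: "a' (- b q, a q) = - \<kappa> * b q" "b' (- b q, a q) = \<kappa> * a q"
    and \<kappa>: "fst q * \<kappa> = m * (c * fst q - a q)"
    using profile_ode[OF pr p U off[OF p]] unfolding q_def by metis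
  define \<alpha> \<beta> s where abs: "\<alpha> = a q" "\<beta> = b q" "s = fst q"
  have "((\<lambda>q. c * snd q - b q / m - e * c * (a q * b q)) has_derivative
      (\<lambda>h. c * snd h - b' h / m - e * c * (a q * b' h + a' h * b q))) (at q)"
    using m_pos by (auto intro!: derivative_eq_intros ab)
  note deriv = this[unfolded q_def]
  have "c * snd (cyl \<xi>) - b (cyl \<xi>) / m - e * c * (a (cyl \<xi>) * b (cyl \<xi>))
      \<le> c * snd (cyl p) - b (cyl p) / m - e * c * (a (cyl p) * b (cyl p))" if "\<xi> \<in> M" "\<xi> \<in> U" for \<xi>
    using max[OF that(1)] unfolding Ft[OF pr that] Ft[OF pr p U] .
  from critical_point[OF p U off[OF p] deriv this]
  have D0: "c * \<alpha> - \<kappa> * \<alpha> / m - e * c * (\<kappa> * \<alpha>\<^sup>2 - \<kappa> * \<beta>\<^sup>2) = 0"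
    unfolding q_def[symmetric] by (simp add: ode abs algebra_simps power2_eq_square)
  have s: "s1 \<le> s" "s \<le> s2" using p1(2)[OF p] p2(2)[OF p] by (simp_all add: abs q_def cyl_def s12)
  then have sp: "s > 0" using s1 by simp
  have u: "\<alpha>\<^sup>2 + \<beta>\<^sup>2 = 1" using unit[OF cyl_W[OF U]] by (simp add: abs q_def)
  have \<kappa>': "\<kappa> = m * (c - \<alpha> / s)" using \<kappa> sp by (simp add: abs field_simps)
  have "c * \<alpha> - \<kappa> * \<alpha> / m = \<alpha>\<^sup>2 / s" using m_pos sp by (simp add: \<kappa>' field_simps power2_eq_square)
  moreover have "e * c * (\<kappa> * \<alpha>\<^sup>2 - \<kappa> * \<beta>\<^sup>2) = - (e * m) * ((c\<^sup>2 - c * \<alpha> / s) * (1 - 2 * \<alpha>\<^sup>2))"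
  proof -
    have b2: "\<beta>\<^sup>2 = 1 - \<alpha>\<^sup>2" using u by simp
    show ?thesis unfolding b2 \<kappa>'
      by (simp add: algebra_simps power2_eq_square diff_divide_distrib)
  qed
  \<comment> \<open>The vanishing derivative of \<open>Ft\<close> at its maximum. The estimates that
    follow show the left-hand side to be positive.\<close>
  ultimately have D1: "\<alpha>\<^sup>2 / s + (c\<^sup>2 - c * \<alpha> / s) * (1 - 2 * \<alpha>\<^sup>2) / L = 0" using D0 by (simp add: em)
  define y where "y = \<alpha> / s"
  have "\<alpha>\<^sup>2 \<le> 1" using u by (metis add_increasing2 le_add_same_cancel1 zero_le_power2)
  then have "\<bar>1 - 2 * \<alpha>\<^sup>2\<bar> \<le> 1" by (simp add: abs_le_iff)
  then have "\<bar>c * y * (1 - 2 * \<alpha>\<^sup>2)\<bar> \<le> \<bar>c * y\<bar> * 1" unfolding abs_mult by (intro mult_left_mono) auto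
  \<comment> \<open>Young's inequality spends half of \<open>c\<^sup>2\<close> on the mixed term;
    the other half gives the final strict inequality.\<close>
  moreover have "2 * \<bar>c * y\<bar> \<le> c\<^sup>2 + y\<^sup>2"
    using sum_squares_bound[of "\<bar>c\<bar>" "\<bar>y\<bar>"] by (simp add: abs_mult)
  ultimately have "c * y * (1 - 2 * \<alpha>\<^sup>2) \<le> c\<^sup>2 / 2 + y\<^sup>2 / 2" by linarith
  then have "(c\<^sup>2 - c * \<alpha> / s) * (1 - 2 * \<alpha>\<^sup>2) \<ge> c\<^sup>2 / 2 - (2 * c\<^sup>2 * \<alpha>\<^sup>2 + y\<^sup>2 / 2)"
    by (simp add: y_def algebra_simps)
  also have "2 * c\<^sup>2 * \<alpha>\<^sup>2 + y\<^sup>2 / 2 = \<alpha>\<^sup>2 / s * (2 * c\<^sup>2 * s + 1 / (2 * s))"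
    using sp by (simp add: y_def field_simps power2_eq_square)
  finally have "(c\<^sup>2 - c * \<alpha> / s) * (1 - 2 * \<alpha>\<^sup>2) \<ge> c\<^sup>2 / 2 - \<alpha>\<^sup>2 / s * (2 * c\<^sup>2 * s + 1 / (2 * s))" .
  moreover have "2 * c\<^sup>2 * s + 1 / (2 * s) \<le> L"
    unfolding L_def using s s1 c2 by (intro add_mono mult_left_mono divide_left_mono) auto
  then have "\<alpha>\<^sup>2 / s * (2 * c\<^sup>2 * s + 1 / (2 * s)) \<le> \<alpha>\<^sup>2 / s * L"
    using sp by (intro mult_left_mono) auto
  ultimately have "(c\<^sup>2 - c * \<alpha> / s) * (1 - 2 * \<alpha>\<^sup>2) > - (\<alpha>\<^sup>2 / s * L)" using c2 by linarith
  then have "(c\<^sup>2 - c * \<alpha> / s) * (1 - 2 * \<alpha>\<^sup>2) / L > - (\<alpha>\<^sup>2 / s)"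
    using L by (simp add: field_simps)
  then show False using D1 by linarith
qed

section \<open>First integrals of the profile equation and the resulting sphere\<close>

lemma first_integral_constant:
  assumes "\<And>p U W v r a b. p \<in> M \<Longrightarrow> p \<in> U \<Longrightarrow> profile M U W v r a b \<Longrightarrow>
     \<exists>\<Phi>. \<forall>\<xi>\<in>M. \<xi> \<in> U \<longrightarrow> hz \<xi> \<noteq> 0 \<longrightarrow> g \<xi> = \<Phi> (cyl \<xi>) \<and>
       (\<exists>D. (\<Phi> has_derivative D) (at (cyl \<xi>)) \<and> D (- b (cyl \<xi>), a (cyl \<xi>)) = (0::real))"
  shows "\<exists>C. \<forall>\<xi>\<in>M. hz \<xi> \<noteq> 0 \<longrightarrow> g \<xi> = C"
proof -
  have "\<exists>C. \<forall>\<xi>\<in>{\<xi>\<in>M. hz \<xi> \<noteq> 0}. g \<xi> = C"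
  proof (rule constant_on_dense_subset[OF conn])
    fix p assume p: "p \<in> M"
    obtain U W v r a b where U: "p \<in> U" and pr: "profile M U W v r a b" using exists_profile p by blast
    obtain \<Phi> where \<Phi>: "\<And>\<xi>. \<xi> \<in> M \<Longrightarrow> \<xi> \<in> U \<Longrightarrow> hz \<xi> \<noteq> 0 \<Longrightarrow> g \<xi> = \<Phi> (cyl \<xi>) \<and>
       (\<exists>D. (\<Phi> has_derivative D) (at (cyl \<xi>)) \<and> D (- b (cyl \<xi>), a (cyl \<xi>)) = (0::real))"
      using assms[OF p U pr] by blast
    then obtain V C where "open V \<and> p \<in> V \<and> V \<subseteq> U \<and> (\<forall>\<xi>\<in>M. \<xi> \<in> V \<longrightarrow> hz \<xi> \<noteq> 0 \<longrightarrow> \<Phi> (cyl \<xi>) = C)"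
      using profile.locally_constant[OF pr p U, of \<Phi>] by blast
    then show "\<exists>V C. open V \<and> p \<in> V \<and> (\<forall>\<xi>\<in>{\<xi>\<in>M. hz \<xi> \<noteq> 0}. \<xi> \<in> V \<longrightarrow> g \<xi> = C)"
      using \<Phi> by (intro exI[of _ V] exI[of _ C]) auto
  qed (use off_axis_dense in auto)
  then show ?thesis by blast
qed

text \<open>\<open>g\<close> is the first integral expressed through the normal. Its constant value
  is 0: there are points off the axis arbitrarily close to an axis point of \<open>M\<close>, and
  there the power of \<open>s\<close> is small while \<open>nA\<close> is bounded.\<close>

lemma nA_eq:
  assumes "\<xi> \<in> M" "hz \<xi> \<noteq> 0"
  shows "nA \<xi> = k * (norm (hz \<xi>))\<^sup>2"
proof -
  define g where "g \<xi> = (norm (hz \<xi>))\<^sup>2 powr m * (nA \<xi> - k * (norm (hz \<xi>))\<^sup>2)" for \<xi>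
  have "\<exists>C. \<forall>\<xi>\<in>M. hz \<xi> \<noteq> 0 \<longrightarrow> g \<xi> = C"
  proof (rule first_integral_constant)
    fix p U W v r a b assume p: "p \<in> M" "p \<in> U" and pr: "profile M U W v r a b"
    let ?\<Phi> = "\<lambda>q. fst q powr m * (a q - k * fst q)"
    have "g \<xi> = ?\<Phi> (cyl \<xi>) \<and> (\<exists>D. (?\<Phi> has_derivative D) (at (cyl \<xi>)) \<and> D (- b (cyl \<xi>), a (cyl \<xi>)) = 0)"
      if \<xi>: "\<xi> \<in> M" "\<xi> \<in> U" "hz \<xi> \<noteq> 0" for \<xi>
    proof
      show "g \<xi> = ?\<Phi> (cyl \<xi>)" using normal_components[OF pr \<xi>] by (simp add: g_def cyl_def)
      define q where "q = cyl \<xi>"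
      obtain a' b' \<kappa> where ab: "(a has_derivative a') (at q)" and ode: "a' (- b q, a q) = - \<kappa> * b q"
        and \<kappa>: "fst q * \<kappa> = m * (c * fst q - a q)" using profile_ode[OF pr \<xi>] unfolding q_def by metis
      have sp: "fst q > 0" using \<xi>(3) by (simp add: fst_cyl_pos q_def)
      have d: "((\<lambda>x. x powr m) has_derivative (\<lambda>h. m * fst q powr (m - 1) * h)) (at (fst q))"
        using has_real_derivative_powr[OF sp, of m] by (simp add: has_field_derivative_def)
      have dp: "((\<lambda>q. fst q powr m) has_derivative (\<lambda>h. m * fst q powr (m - 1) * fst h)) (at q)"
        using has_derivative_compose[OF has_derivative_fst[OF has_derivative_ident] d] by simp
      have "((\<lambda>q. a q - k * fst q) has_derivative (\<lambda>h. a' h - k * fst h)) (at q)"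
        by (auto intro!: derivative_eq_intros ab)
      from has_derivative_mult[OF dp this] have D: "(?\<Phi> has_derivative (\<lambda>h. fst q powr m * (a' h - k * fst h)
          + m * fst q powr (m - 1) * fst h * (a q - k * fst q))) (at q)" .
      have pw: "fst q powr m = fst q * fst q powr (m - 1)" using sp by (simp add: powr_mult_base)
      \<comment> \<open>The derivative along the tangent, where \<open>s' = - b\<close> and
        \<open>a' = - \<kappa> * b\<close>. The bracket vanishes by the curvature equation and
        \<open>(m + 1) * k = m * c\<close>.\<close>
      have "fst q powr m * (- \<kappa> * b q - k * - b q) + m * fst q powr (m - 1) * - b q * (a q - k * fst q)
         = fst q powr (m - 1) * b q * ((m + 1) * k * fst q - fst q * \<kappa> - m * a q)"
        unfolding pw by (simp add: algebra_simps)
      also have "\<dots> = 0" unfolding \<kappa> k_m by (simp add: algebra_simps)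
      finally show "\<exists>D. (?\<Phi> has_derivative D) (at (cyl \<xi>)) \<and> D (- b (cyl \<xi>), a (cyl \<xi>)) = 0"
        using D ode unfolding q_def by (intro exI[of _ "\<lambda>h. fst q powr m * (a' h - k * fst h)
          + m * fst q powr (m - 1) * fst h * (a q - k * fst q)"]) (simp add: q_def)
    qed
    then show "\<exists>\<Phi>. \<forall>\<xi>\<in>M. \<xi> \<in> U \<longrightarrow> hz \<xi> \<noteq> 0 \<longrightarrow> g \<xi> = \<Phi> (cyl \<xi>) \<and>
       (\<exists>D. (\<Phi> has_derivative D) (at (cyl \<xi>)) \<and> D (- b (cyl \<xi>), a (cyl \<xi>)) = (0::real))"
      by (intro exI[of _ ?\<Phi>]) blast
  qed
  then obtain C where C: "\<And>\<xi>. \<xi> \<in> M \<Longrightarrow> hz \<xi> \<noteq> 0 \<Longrightarrow> g \<xi> = C" by blast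
  have "C = 0"
  proof (rule ccontr)
    assume "C \<noteq> 0"
    obtain p where p: "p \<in> M" "hz p = 0" using meets_axis by blast
    \<comment> \<open>A majorant of \<open>\<bar>g\<bar>\<close> off the axis that is continuous
      everywhere and zero on the axis; it rests on \<open>\<bar>nA\<bar> \<le> 1\<close>.\<close>
    define B where "B \<xi> = ((norm (hz \<xi>))\<^sup>2) powr m * (1 + \<bar>k\<bar> * (norm (hz \<xi>))\<^sup>2)" for \<xi> :: "'n heis"
    have "continuous_on UNIV B" unfolding B_def
      using m_pos by (intro continuous_intros continuous_on_powr' continuous_on_id) auto
    then have "open (B -` {..<\<bar>C\<bar>})" by (intro open_vimage) auto
    moreover have "p \<in> B -` {..<\<bar>C\<bar>}" using p \<open>C \<noteq> 0\<close> by (simp add: B_def)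
    ultimately obtain \<xi> where \<xi>: "\<xi> \<in> M" "hz \<xi> \<noteq> 0" "B \<xi> < \<bar>C\<bar>" using off_axis_dense[OF p(1)] by blast
    have "(nA \<xi>)\<^sup>2 \<le> 1\<^sup>2" using normal_unit[OF \<xi>(1,2)] by (metis le_add_same_cancel1 one_power2 zero_le_power2)
    then have "\<bar>nA \<xi>\<bar> \<le> 1" using abs_le_square_iff[of "nA \<xi>" 1] by simp
    moreover have "\<bar>nA \<xi> - k * (norm (hz \<xi>))\<^sup>2\<bar> \<le> \<bar>nA \<xi>\<bar> + \<bar>k\<bar> * (norm (hz \<xi>))\<^sup>2"
      using abs_triangle_ineq4[of "nA \<xi>" "k * (norm (hz \<xi>))\<^sup>2"] by (simp add: abs_mult)
    ultimately have "\<bar>nA \<xi> - k * (norm (hz \<xi>))\<^sup>2\<bar> \<le> 1 + \<bar>k\<bar> * (norm (hz \<xi>))\<^sup>2" by linarith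
    then have "\<bar>g \<xi>\<bar> \<le> B \<xi>" unfolding g_def B_def abs_mult by (simp add: mult_left_mono)
    then show False using C[OF \<xi>(1,2)] \<xi>(3) by simp
  qed
  then have "g \<xi> = 0" using C assms by simp
  then show ?thesis using assms by (simp add: g_def)
qed

lemma nB_eq: "\<exists>t0. \<forall>\<xi>\<in>M. hz \<xi> \<noteq> 0 \<longrightarrow> nB \<xi> = k * (ht \<xi> - t0)"
proof -
  define g where "g \<xi> = ht \<xi> - nB \<xi> / k" for \<xi>
  have "\<exists>C. \<forall>\<xi>\<in>M. hz \<xi> \<noteq> 0 \<longrightarrow> g \<xi> = C"
  proof (rule first_integral_constant)
    fix p U W v r a b assume p: "p \<in> M" "p \<in> U" and pr: "profile M U W v r a b"
    let ?\<Phi> = "\<lambda>q. snd q - b q / k"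
    have "g \<xi> = ?\<Phi> (cyl \<xi>) \<and> (\<exists>D. (?\<Phi> has_derivative D) (at (cyl \<xi>)) \<and> D (- b (cyl \<xi>), a (cyl \<xi>)) = 0)"
      if \<xi>: "\<xi> \<in> M" "\<xi> \<in> U" "hz \<xi> \<noteq> 0" for \<xi>
    proof
      show "g \<xi> = ?\<Phi> (cyl \<xi>)" using normal_components[OF pr \<xi>] by (simp add: g_def cyl_def)
      define q where "q = cyl \<xi>"
      obtain a' b' \<kappa> where ab: "(b has_derivative b') (at q)" and ode: "b' (- b q, a q) = \<kappa> * a q"
        and \<kappa>: "fst q * \<kappa> = m * (c * fst q - a q)" using profile_ode[OF pr \<xi>] unfolding q_def by metis
      have sp: "fst q > 0" using \<xi>(3) by (simp add: fst_cyl_pos q_def)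
      have aq: "a q = k * fst q" using nA_eq[OF \<xi>(1,3)] normal_components[OF pr \<xi>] by (simp add: q_def cyl_def)
      \<comment> \<open>Inserting \<open>a = k s\<close> and \<open>m c = (m + 1) k\<close> turns
        the curvature equation into \<open>s \<kappa> = m (c - k) s = k s\<close>.\<close>
      have "fst q * \<kappa> = fst q * ((m + 1) * k - m * k)" unfolding \<kappa> aq k_m by (simp add: algebra_simps)
      then have "\<kappa> = k" using sp by (simp add: algebra_simps)
      moreover have "(?\<Phi> has_derivative (\<lambda>h. snd h - b' h / k)) (at q)"
        using k_nz by (auto intro!: derivative_eq_intros ab)
      ultimately show "\<exists>D. (?\<Phi> has_derivative D) (at (cyl \<xi>)) \<and> D (- b (cyl \<xi>), a (cyl \<xi>)) = 0"
        using ode k_nz unfolding q_def by (intro exI[of _ "\<lambda>h. snd h - b' h / k"]) simp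
    qed
    then show "\<exists>\<Phi>. \<forall>\<xi>\<in>M. \<xi> \<in> U \<longrightarrow> hz \<xi> \<noteq> 0 \<longrightarrow> g \<xi> = \<Phi> (cyl \<xi>) \<and>
       (\<exists>D. (\<Phi> has_derivative D) (at (cyl \<xi>)) \<and> D (- b (cyl \<xi>), a (cyl \<xi>)) = (0::real))"
      by (intro exI[of _ ?\<Phi>]) blast
  qed
  then obtain C where C: "\<And>\<xi>. \<xi> \<in> M \<Longrightarrow> hz \<xi> \<noteq> 0 \<Longrightarrow> g \<xi> = C" by blast
  have "nB \<xi> = k * (ht \<xi> - C)" if "\<xi> \<in> M" "hz \<xi> \<noteq> 0" for \<xi>
    using C[OF that] k_nz by (simp add: g_def field_simps)
  then show ?thesis by blast
qed

text \<open>At the largest \<open>s\<close> the profile normal is \<open>(1, 0)\<close> or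
  \<open>(-1, 0)\<close>. The radial ray beyond this point misses \<open>M\<close> and is unbounded,
  so it lies outside, which excludes the second case; then \<open>k s = 1\<close> there.\<close>

lemma k_pos: "k > 0"
proof -
  have cs: "continuous_on M (\<lambda>\<xi>. (norm (hz \<xi>))\<^sup>2)" by (intro continuous_intros continuous_on_id)
  obtain p where p: "p \<in> M" "\<And>\<xi>. \<xi> \<in> M \<Longrightarrow> (norm (hz \<xi>))\<^sup>2 \<le> (norm (hz p))\<^sup>2"
    using continuous_attains_sup[OF comp nonempty cs] by blast
  obtain \<xi>0 where "\<xi>0 \<in> M" "hz \<xi>0 \<noteq> 0" using off_axis_dense[OF p(1) open_UNIV] by blast
  then have hp: "hz p \<noteq> 0" using p(2) by fastforce
  obtain U W v r a b where U: "p \<in> U" and pr: "profile M U W v r a b" using exists_profile p by blast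
  interpret profile M U W v r a b by (rule pr)
  have "fst (- b (cyl p), a (cyl p)) = 0"
    by (rule critical_point[OF p(1) U hp has_derivative_fst[OF has_derivative_ident]])
      (use p(2) in \<open>auto simp: cyl_def\<close>)
  then have "a (cyl p) = 1 \<or> a (cyl p) = - 1" using unit[OF cyl_W[OF U]] by (simp add: power2_eq_1_iff)
  moreover have "a (cyl p) \<noteq> - 1"
  proof
    assume a1: "a (cyl p) = - 1"
    define w where "w = heis_point (- hz p) 0"
    have "conormal p w > 0" using a1 hp by (simp add: conormal_def w_def)
    then obtain e where e: "e > 0" "\<And>s. 0 < s \<Longrightarrow> s < e \<Longrightarrow> p - s *\<^sub>R w \<in> inside M"
      using outward_conormal[OF p(1) U] unfolding outward_at_def by blast
    let ?T = "(\<lambda>s. p - s *\<^sub>R w) ` {0<..}"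
    have hzT: "hz (p - s *\<^sub>R w) = (1 + s) *\<^sub>R hz p" for s by (simp add: w_def algebra_simps)
    have "p - s *\<^sub>R w \<notin> M" if "s > 0" for s
    proof
      assume "p - s *\<^sub>R w \<in> M"
      from p(2)[OF this] have "norm ((1 + s) *\<^sub>R hz p) \<le> norm (hz p)"
        unfolding hzT by (simp only: abs_le_square_iff[symmetric] abs_norm_cancel)
      then show False using that hp by simp
    qed
    then have "?T \<inter> M = {}" by auto
    moreover have "connected ?T" by (intro connected_continuous_image continuous_intros) auto
    moreover have "\<not> bounded ?T"
    proof
      assume "bounded ?T"
      then have "bounded (hz ` ?T)" using bounded_linear_image bounded_linear_hz by blast
      then obtain B where B: "\<And>s. s > 0 \<Longrightarrow> norm ((1 + s) *\<^sub>R hz p) \<le> B"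
        unfolding bounded_iff image_image hzT by auto
      \<comment> \<open>At this parameter the norm equals
        \<open>2 * norm (hz p) + \<bar>B\<bar>\<close>, which exceeds the supposed bound
        \<open>B\<close>.\<close>
      have "0 < 1 + \<bar>B\<bar> / norm (hz p)" by (simp add: add_pos_nonneg)
      from B[OF this] have "(2 + \<bar>B\<bar> / norm (hz p)) * norm (hz p) \<le> B" 
        by (simp add: abs_of_nonneg add_nonneg_nonneg)
      then have "2 * norm (hz p) + \<bar>B\<bar> \<le> B" using hp by (simp add: distrib_right)
      moreover have "norm (hz p) > 0" using hp by simp
      ultimately show False by linarith
    qed
    ultimately have "?T \<subseteq> outside M" by (intro unbounded_connected_subset_outside)
    then have "p - (e/2) *\<^sub>R w \<in> outside M"
      using imageI[of "e/2" "{0<..}" "\<lambda>s. p - s *\<^sub>R w"] e(1) by auto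
    moreover have "p - (e/2) *\<^sub>R w \<in> inside M" using e by simp
    ultimately show False using inside_Int_outside by blast
  qed
  ultimately have "a (cyl p) = 1" by blast
  then have "k * (norm (hz p))\<^sup>2 = 1" using nA_eq[OF p(1) hp] normal_components[OF pr p(1) U hp] by simp
  then show ?thesis by (metis zero_less_mult_pos2 zero_less_one zero_less_power2 norm_eq_zero hp)
qed

lemma eq_sphere: "\<exists>t0. M = {\<xi>. (norm (hz \<xi>)) ^ 4 + (ht \<xi> - t0)\<^sup>2 = (1 / k)\<^sup>2}"
proof -
  obtain t0 where t0: "\<And>\<xi>. \<xi> \<in> M \<Longrightarrow> hz \<xi> \<noteq> 0 \<Longrightarrow> nB \<xi> = k * (ht \<xi> - t0)" using nB_eq by blast
  let ?S = "{\<xi> :: 'n heis. (norm (hz \<xi>)) ^ 4 + (ht \<xi> - t0)\<^sup>2 = (1 / k)\<^sup>2}"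
  have S: "\<xi> \<in> ?S" if "\<xi> \<in> M" "hz \<xi> \<noteq> 0" for \<xi>
  proof -
    have "k\<^sup>2 * ((norm (hz \<xi>)) ^ 4 + (ht \<xi> - t0)\<^sup>2) = 1"
      using normal_unit[OF that] unfolding nA_eq[OF that] t0[OF that]
      by (simp add: power_mult_distrib distrib_left flip: power_mult)
    then show ?thesis using k_nz by (simp add: field_simps)
  qed
  have c: "continuous_on UNIV (\<lambda>\<xi> :: 'n heis. (norm (hz \<xi>)) ^ 4 + (ht \<xi> - t0)\<^sup>2)"
    by (intro continuous_intros continuous_on_id)
  have "closed ?S" by (rule closed_Collect_eq[OF c]) (intro continuous_intros)
  \<comment> \<open>The equation, so far known off the axis, extends to axis points of
    \<open>M\<close> by density, as the sphere is closed.\<close>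
  have sub: "M \<subseteq> ?S"
  proof
    fix p assume p: "p \<in> M"
    show "p \<in> ?S"
    proof (rule ccontr)
      assume "p \<notin> ?S"
      then show False using off_axis_dense[OF p, of "- ?S"] \<open>closed ?S\<close> S by (auto simp: closed_def)
    qed
  qed
  \<comment> \<open>The outward normal supplies an inside point, which rules out a proper subset of
    the sphere.\<close>
  obtain p where p: "p \<in> M" using nonempty by blast
  then obtain e where "e > 0" "\<And>s. 0 < s \<Longrightarrow> s < e \<Longrightarrow> p - s *\<^sub>R \<nu> p \<in> inside M"
    using normal unfolding outward_unit_normal_def by blast
  then have "p - (e/2) *\<^sub>R \<nu> p \<in> inside M" by simp
  then have "inside M \<noteq> {}" by blast
  from sphere_filled[OF sub _ this] show ?thesis using k_nz by auto
qed

end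

theorem corollary3p1:
  fixes M :: "'n::finite heis set" and \<nu> :: "'n heis \<Rightarrow> 'n heis" and c :: real
  assumes "smooth_hypersurface M"
    and "M \<noteq> {}" and "connected M" and "orientable M" and "compact M"
    and "outward_unit_normal M \<nu>"
    and "cylindrically_symmetric M"
    and "c \<noteq> 0"
    and "\<And>x y t. (x, y, t) \<in> M - characteristic_set M \<Longrightarrow>
           horizontal_mean_curvature M \<nu> (x, y, t) = c * sqrt ((norm x)\<^sup>2 + (norm y)\<^sup>2)"
  shows "c > 0 \<and>
    (\<exists>t0. M = frontier (gauge_ball (0, 0, t0)
       (sqrt (1 / c * ((2 * real CARD('n) + 1) / (2 * real CARD('n) - 1))))))"
proof -
  interpret symmetric_hypersurface M \<nu> c by unfold_locales (use assms in auto)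
  have "m * c > 0" using k_m k_pos m_pos by (metis add_pos_pos mult_pos_pos zero_less_one)
  then have "c > 0" using m_pos by (simp add: zero_less_mult_iff)
  \<comment> \<open>As \<open>m = n - 1/2\<close>, the left side is \<open>(m + 1) / (m c)\<close>;
    thus the gauge radius is \<open>sqrt (1 / k)\<close>.\<close>
  moreover have "1 / c * ((2 * real CARD('n) + 1) / (2 * real CARD('n) - 1)) = 1 / k"
    using m_pos c by (simp add: k_def m_def field_simps)
  moreover have "\<exists>t0. M = frontier (gauge_ball (0, 0, t0) (sqrt (1 / k)))"
    using eq_sphere k_pos by (simp add: gauge_ball_axis frontier_axial_ball)
  ultimately show ?thesis by simp
qed

end
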